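(* Let $\mathcal C$ be an essentially small category, $T$ the class of sieves $C\hookrightarrow y(X)$ on objects $X$ of $\mathcal C$, $S$ the class of presheaves on $\mathcal C$, $R\subseteq T\times S$ the duality relation between sieves and presheaves, and $$F_R:(\mathcal P(T),\subseteq)\to(\mathcal P(S),\supseteq),\qquad G_R:(\mathcal P(S),\supseteq)\to(\mathcal P(T),\subseteq)$$ the adjoint pair of order-preserving maps defined by $R$ (all defined in the context). Then: (i) A subclass $J\subseteq T$ is a fixed point of $G_R\circ F_R$ if and only if it is a Grothendieck topology, in the sense that it satisfies: (1) for every object $X$ of $\mathcal C$, the maximal sieve $C=y(X)$ is an element of $J$; (2) for every element $C\hookrightarrow y(X)$ of $J$ and every morphism $x:X'\to X$, the pullback $x^*C=C\times_{y(X)}y(X')\hookrightarrow y(X')$ is again an element of $J$; (3) if a sieve $C\hookrightarrow y(X)$ generated by a family $(X_i\xrightarrow{x_i}X)_{i\in I}$ is an element of $J$, then every sieve $C'\hookrightarrow y(X)$ such that $(x_i^*C'\hookrightarrow y(X_i))\in J$ for all $i\in I$ is again an element of $J$. (ii) A subclass $I\subseteq S$ is a fixed point of $F_R\circ G_R$ if and only if the full subcategory $\mathcal E_I\hookrightarrow\widehat{\mathcal C}$ on the presheaves that are elements of $I$ is a subtopos of $\widehat{\mathcal C}$, in the sense that it satisfies: (1) the fully faithful embedding functor $j_*:\mathcal E_I\hookrightarrow\widehat{\mathcal C}$ has a left adjoint $j^*:\widehat{\mathcal C}\to\mathcal E_I$; (2) this left adjoint preserves not only colimits but also finite limits; (3)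 an object $P$ of $\widehat{\mathcal C}$ is an object of $\mathcal E_I$ (i.e. an element of $I$) if and only if the canonical morphism $P\to j_*\circ j^*P$ is an isomorphism.
   Context: $\widehat{\mathcal C}=[\mathcal C^{\rm op},{\rm Set}]$ and $y:\mathcal C\hookrightarrow\widehat{\mathcal C}$ is the Yoneda embedding. A sieve on $X$ is a sub-presheaf $C\hookrightarrow y(X)$. $\mathcal P(\cdot)$ denotes the collection of subclasses. The relation $R\subseteq T\times S$ consists of the pairs $(C\hookrightarrow y(X),P)$ such that, for every morphism $x:X'\to X$ of $\mathcal C$, the restriction map $$P(X')={\rm Hom}(y(X'),P)\to{\rm Hom}(C\times_{y(X)}y(X'),P)$$ is a bijection. The associated maps are $$F_R(J)=\{s\in S\mid(t,s)\in R\ \forall t\in J\},\qquad G_R(I)=\{t\in T\mid(t,s)\in R\ \forall s\in I\}.$$ *)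

theory Defs
  imports Main "HOL-Library.FuncSet"
begin

section \<open>Universes of small sets\<close>

text \<open>
  HOL has no category of all sets. Set is the category of the \<open>U\<close>-small sets, for an arbitrary
  Grothendieck universe \<open>U\<close> of subsets of a type \<open>'v\<close>. The axioms are those of a universe, up to
  bijection: a power set is not again a subset of \<open>'v\<close>, so it is only asked to have a small copy.
  Nothing says that \<open>U\<close> contains an infinite set, so that the finite subsets of an infinite type
  are allowed too. In an extension of HOL by a type of all ZFC sets, \<open>U\<close> can be taken to be the
  collection of (the element sets of) all sets.
\<close>

definition set_universe :: "'v set set \<Rightarrow> bool" where
  "set_universe U \<longleftrightarrow>
     U \<noteq> {} \<and>
     (\<forall>A\<in>U. \<forall>B. B \<subseteq> A \<longrightarrow> B \<in> U) \<and>
     (\<forall>A\<in>U. \<forall>f :: 'v \<Rightarrow> 'v. f ` A \<in> U) \<and>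
     (\<forall>A\<in>U. \<forall>B :: 'v \<Rightarrow> 'v set. (\<forall>a\<in>A. B a \<in> U) \<longrightarrow> (\<Union>a\<in>A. B a) \<in> U) \<and>
     (\<forall>A\<in>U. \<exists>f :: 'v set \<Rightarrow> 'v. inj_on f (Pow A) \<and> f ` Pow A \<in> U)"

lemma set_universe_finite_sets: "set_universe {A :: nat set. finite A}"
proof -
  have "\<exists>f :: nat set \<Rightarrow> nat. inj_on f (Pow A) \<and> f ` Pow A \<in> {A. finite A}"
    if "finite A" for A :: "nat set"
    using finite_imp_inj_to_nat_seg[of "Pow A"] that by auto
  then show ?thesis
    unfolding set_universe_def by (auto intro: finite_subset)
qed

section \<open>Categories and functors\<close>

text \<open>\<open>Comp C g f\<close> is the composite "\<open>g\<close> after \<open>f\<close>". Nothing is assumed about the values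
  of the operations on arguments outside \<open>Obj C\<close> and \<open>Arr C\<close>, or on non-composable pairs.\<close>

record ('o, 'm) cat =
  Obj :: "'o set"
  Arr :: "'m set"
  Dom :: "'m \<Rightarrow> 'o"
  Cod :: "'m \<Rightarrow> 'o"
  Ident :: "'o \<Rightarrow> 'm"
  Comp :: "'m \<Rightarrow> 'm \<Rightarrow> 'm"

definition Hom :: "('o, 'm) cat \<Rightarrow> 'o \<Rightarrow> 'o \<Rightarrow> 'm set" where
  "Hom C X Y = {f \<in> Arr C. Dom C f = X \<and> Cod C f = Y}"

definition category :: "('o, 'm) cat \<Rightarrow> bool" where
  "category C \<longleftrightarrow>
     (\<forall>f\<in>Arr C. Dom C f \<in> Obj C \<and> Cod C f \<in> Obj C) \<and>
     (\<forall>X\<in>Obj C. Ident C X \<in> Hom C X X) \<and>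
     (\<forall>f\<in>Arr C. \<forall>g\<in>Arr C. Dom C g = Cod C f \<longrightarrow> Comp C g f \<in> Hom C (Dom C f) (Cod C g)) \<and>
     (\<forall>f\<in>Arr C. Comp C f (Ident C (Dom C f)) = f \<and> Comp C (Ident C (Cod C f)) f = f) \<and>
     (\<forall>f\<in>Arr C. \<forall>g\<in>Arr C. \<forall>h\<in>Arr C. Dom C g = Cod C f \<longrightarrow> Dom C h = Cod C g \<longrightarrow>
        Comp C h (Comp C g f) = Comp C (Comp C h g) f)"

definition is_iso :: "('o, 'm) cat \<Rightarrow> 'm \<Rightarrow> bool" where
  "is_iso C f \<longleftrightarrow> f \<in> Arr C \<and>
     (\<exists>g \<in> Hom C (Cod C f) (Dom C f).
        Comp C g f = Ident C (Dom C f) \<and> Comp C f g = Ident C (Cod C f))"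

definition full_subcat :: "('o, 'm) cat \<Rightarrow> 'o set \<Rightarrow> ('o, 'm) cat" where
  "full_subcat C I = C\<lparr>Obj := I, Arr := {f \<in> Arr C. Dom C f \<in> I \<and> Cod C f \<in> I}\<rparr>"

record ('o, 'm, 'p, 'n) functr =
  FObj :: "'o \<Rightarrow> 'p"
  FArr :: "'m \<Rightarrow> 'n"

definition is_functor :: "('o, 'm) cat \<Rightarrow> ('p, 'n) cat \<Rightarrow> ('o, 'm, 'p, 'n) functr \<Rightarrow> bool" where
  "is_functor C D F \<longleftrightarrow>
     (\<forall>X\<in>Obj C. FObj F X \<in> Obj D) \<and>
     (\<forall>f\<in>Arr C. FArr F f \<in> Hom D (FObj F (Dom C f)) (FObj F (Cod C f))) \<and>
     (\<forall>X\<in>Obj C. FArr F (Ident C X) = Ident D (FObj F X)) \<and>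
     (\<forall>f\<in>Arr C. \<forall>g\<in>Arr C. Dom C g = Cod C f \<longrightarrow>
        FArr F (Comp C g f) = Comp D (FArr F g) (FArr F f))"

definition id_functor :: "('o, 'm, 'o, 'm) functr" where
  "id_functor = \<lparr>FObj = (\<lambda>X. X), FArr = (\<lambda>f. f)\<rparr>"

definition comp_functor ::
  "('p, 'n, 'q, 'k) functr \<Rightarrow> ('o, 'm, 'p, 'n) functr \<Rightarrow> ('o, 'm, 'q, 'k) functr" where
  "comp_functor G F = \<lparr>FObj = (\<lambda>X. FObj G (FObj F X)), FArr = (\<lambda>f. FArr G (FArr F f))\<rparr>"

definition is_nat_transf ::
  "('o, 'm) cat \<Rightarrow> ('p, 'n) cat \<Rightarrow> ('o, 'm, 'p, 'n) functr \<Rightarrow> ('o, 'm, 'p, 'n) functr \<Rightarrow>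
    ('o \<Rightarrow> 'n) \<Rightarrow> bool" where
  "is_nat_transf C D F G \<eta> \<longleftrightarrow>
     (\<forall>X\<in>Obj C. \<eta> X \<in> Hom D (FObj F X) (FObj G X)) \<and>
     (\<forall>f\<in>Arr C. Comp D (\<eta> (Cod C f)) (FArr F f) = Comp D (FArr G f) (\<eta> (Dom C f)))"

definition is_equivalence :: "('o, 'm) cat \<Rightarrow> ('p, 'n) cat \<Rightarrow> ('o, 'm, 'p, 'n) functr \<Rightarrow> bool" where
  "is_equivalence C D F \<longleftrightarrow> is_functor C D F \<and>
     (\<forall>X\<in>Obj C. \<forall>Y\<in>Obj C. bij_betw (FArr F) (Hom C X Y) (Hom D (FObj F X) (FObj F Y))) \<and>
     (\<forall>Z\<in>Obj D. \<exists>X\<in>Obj C. \<exists>f \<in> Hom D (FObj F X) Z. is_iso D f)"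

definition small_cat :: "'v set set \<Rightarrow> ('v, 'v) cat \<Rightarrow> bool" where
  "small_cat U D \<longleftrightarrow> category D \<and> Obj D \<in> U \<and> Arr D \<in> U"

definition essentially_small :: "'v set set \<Rightarrow> ('o, 'm) cat \<Rightarrow> bool" where
  "essentially_small U C \<longleftrightarrow> (\<exists>D F. small_cat U D \<and> is_equivalence D C F)"

section \<open>Adjunctions, limits and colimits\<close>

text \<open>\<open>L : A \<rightarrow> B\<close> is left adjoint to \<open>R : B \<rightarrow> A\<close>, with unit \<open>\<eta>\<close> and counit \<open>\<epsilon>\<close>.\<close>

definition adjunction ::
  "('o, 'm) cat \<Rightarrow> ('p, 'n) cat \<Rightarrow> ('o, 'm, 'p, 'n) functr \<Rightarrow> ('p, 'n, 'o, 'm) functr \<Rightarrow>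
    ('o \<Rightarrow> 'm) \<Rightarrow> ('p \<Rightarrow> 'n) \<Rightarrow> bool" where
  "adjunction A B L R \<eta> \<epsilon> \<longleftrightarrow>
     is_functor A B L \<and> is_functor B A R \<and>
     is_nat_transf A A id_functor (comp_functor R L) \<eta> \<and>
     is_nat_transf B B (comp_functor L R) id_functor \<epsilon> \<and>
     (\<forall>a\<in>Obj A. Comp B (\<epsilon> (FObj L a)) (FArr L (\<eta> a)) = Ident B (FObj L a)) \<and>
     (\<forall>b\<in>Obj B. Comp A (FArr R (\<epsilon> b)) (\<eta> (FObj R b)) = Ident A (FObj R b))"

definition is_cone ::
  "('i, 'k) cat \<Rightarrow> ('o, 'm) cat \<Rightarrow> ('i, 'k, 'o, 'm) functr \<Rightarrow> 'o \<Rightarrow> ('i \<Rightarrow> 'm) \<Rightarrow> bool" where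
  "is_cone K C D X p \<longleftrightarrow> X \<in> Obj C \<and>
     (\<forall>i\<in>Obj K. p i \<in> Hom C X (FObj D i)) \<and>
     (\<forall>k\<in>Arr K. Comp C (FArr D k) (p (Dom K k)) = p (Cod K k))"

definition is_limit ::
  "('i, 'k) cat \<Rightarrow> ('o, 'm) cat \<Rightarrow> ('i, 'k, 'o, 'm) functr \<Rightarrow> 'o \<Rightarrow> ('i \<Rightarrow> 'm) \<Rightarrow> bool" where
  "is_limit K C D X p \<longleftrightarrow> is_cone K C D X p \<and>
     (\<forall>Y q. is_cone K C D Y q \<longrightarrow>
        (\<exists>!u. u \<in> Hom C Y X \<and> (\<forall>i\<in>Obj K. Comp C (p i) u = q i)))"

definition is_cocone ::
  "('i, 'k) cat \<Rightarrow> ('o, 'm) cat \<Rightarrow> ('i, 'k, 'o, 'm) functr \<Rightarrow> 'o \<Rightarrow> ('i \<Rightarrow> 'm) \<Rightarrow> bool" where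
  "is_cocone K C D X p \<longleftrightarrow> X \<in> Obj C \<and>
     (\<forall>i\<in>Obj K. p i \<in> Hom C (FObj D i) X) \<and>
     (\<forall>k\<in>Arr K. Comp C (p (Cod K k)) (FArr D k) = p (Dom K k))"

definition is_colimit ::
  "('i, 'k) cat \<Rightarrow> ('o, 'm) cat \<Rightarrow> ('i, 'k, 'o, 'm) functr \<Rightarrow> 'o \<Rightarrow> ('i \<Rightarrow> 'm) \<Rightarrow> bool" where
  "is_colimit K C D X p \<longleftrightarrow> is_cocone K C D X p \<and>
     (\<forall>Y q. is_cocone K C D Y q \<longrightarrow>
        (\<exists>!u. u \<in> Hom C X Y \<and> (\<forall>i\<in>Obj K. Comp C u (p i) = q i)))"

text \<open>Every finite category is isomorphic to one whose objects and arrows are natural numbers, and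
  every \<open>U\<close>-small one to one whose objects and arrows lie in \<open>'v\<close>.\<close>

definition preserves_finite_limits ::
  "('o, 'm) cat \<Rightarrow> ('p, 'n) cat \<Rightarrow> ('o, 'm, 'p, 'n) functr \<Rightarrow> bool" where
  "preserves_finite_limits A B F \<longleftrightarrow>
     (\<forall>(K :: (nat, nat) cat) D X p.
        category K \<and> finite (Obj K) \<and> finite (Arr K) \<and> is_functor K A D \<and> is_limit K A D X p \<longrightarrow>
        is_limit K B (comp_functor F D) (FObj F X) (\<lambda>i. FArr F (p i)))"

definition preserves_small_colimits ::
  "'v set set \<Rightarrow> ('o, 'm) cat \<Rightarrow> ('p, 'n) cat \<Rightarrow> ('o, 'm, 'p, 'n) functr \<Rightarrow> bool" where
  "preserves_small_colimits U A B F \<longleftrightarrow>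
     (\<forall>(K :: ('v, 'v) cat) D X p.
        small_cat U K \<and> is_functor K A D \<and> is_colimit K A D X p \<longrightarrow>
        is_colimit K B (comp_functor F D) (FObj F X) (\<lambda>i. FArr F (p i)))"

section \<open>Presheaves\<close>

text \<open>
  \<open>Ev P X\<close> is the set \<open>P(X)\<close>, and \<open>Res P f : P(X) \<rightarrow> P(X')\<close> is the action of \<open>f : X' \<rightarrow> X\<close>.
  All data are extensional (equal to \<^const>\<open>undefined\<close> outside their domains), so that equality
  of presheaves, and of morphisms between them, is equality in HOL.
  The type of the elements is arbitrary: representable presheaves and sieves have elements of type
  \<open>'m\<close>, the presheaves with values in Set have elements of type \<open>'v\<close>.
\<close>

record ('o, 'm, 'v) presheaf =
  Ev :: "'o \<Rightarrow> 'v set"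
  Res :: "'m \<Rightarrow> 'v \<Rightarrow> 'v"

definition is_presheaf :: "('o, 'm) cat \<Rightarrow> ('o, 'm, 'v) presheaf \<Rightarrow> bool" where
  "is_presheaf C P \<longleftrightarrow>
     Ev P \<in> extensional (Obj C) \<and>
     Res P \<in> (\<Pi>\<^sub>E f\<in>Arr C. Ev P (Cod C f) \<rightarrow>\<^sub>E Ev P (Dom C f)) \<and>
     (\<forall>X\<in>Obj C. \<forall>p\<in>Ev P X. Res P (Ident C X) p = p) \<and>
     (\<forall>f\<in>Arr C. \<forall>g\<in>Arr C. Dom C g = Cod C f \<longrightarrow>
        (\<forall>p\<in>Ev P (Cod C g). Res P (Comp C g f) p = Res P f (Res P g p)))"

definition presheaves :: "'v set set \<Rightarrow> ('o, 'm) cat \<Rightarrow> ('o, 'm, 'v) presheaf set" where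
  "presheaves U C = {P. is_presheaf C P \<and> (\<forall>X\<in>Obj C. Ev P X \<in> U)}"

text \<open>The set \<open>Hom(P, Q)\<close> of morphisms of presheaves.\<close>

definition NatT ::
  "('o, 'm) cat \<Rightarrow> ('o, 'm, 'v) presheaf \<Rightarrow> ('o, 'm, 'w) presheaf \<Rightarrow> ('o \<Rightarrow> 'v \<Rightarrow> 'w) set" where
  "NatT C P Q = {\<eta> \<in> (\<Pi>\<^sub>E X\<in>Obj C. Ev P X \<rightarrow>\<^sub>E Ev Q X).
     \<forall>f\<in>Arr C. \<forall>p\<in>Ev P (Cod C f).
       \<eta> (Dom C f) (Res P f p) = Res Q f (\<eta> (Cod C f) p)}"

definition nat_id :: "('o, 'm) cat \<Rightarrow> ('o, 'm, 'v) presheaf \<Rightarrow> 'o \<Rightarrow> 'v \<Rightarrow> 'v" where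
  "nat_id C P = (\<lambda>X\<in>Obj C. \<lambda>p\<in>Ev P X. p)"

definition nat_comp ::
  "('o, 'm) cat \<Rightarrow> ('o, 'm, 'u) presheaf \<Rightarrow> ('o \<Rightarrow> 'v \<Rightarrow> 'w) \<Rightarrow> ('o \<Rightarrow> 'u \<Rightarrow> 'v) \<Rightarrow> 'o \<Rightarrow> 'u \<Rightarrow> 'w" where
  "nat_comp C P \<theta> \<eta> = (\<lambda>X\<in>Obj C. \<lambda>p\<in>Ev P X. \<theta> X (\<eta> X p))"

text \<open>The category \<open>[C\<^sup>o\<^sup>p, Set]\<close>; an arrow carries its domain and its codomain.\<close>

type_synonym ('o, 'm, 'v) presheaf_arr =
  "('o, 'm, 'v) presheaf \<times> ('o \<Rightarrow> 'v \<Rightarrow> 'v) \<times> ('o, 'm, 'v) presheaf"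

definition psh_cat ::
  "'v set set \<Rightarrow> ('o, 'm) cat \<Rightarrow> (('o, 'm, 'v) presheaf, ('o, 'm, 'v) presheaf_arr) cat" where
  "psh_cat U C =
     \<lparr>Obj = presheaves U C,
      Arr = {(P, \<eta>, Q). P \<in> presheaves U C \<and> Q \<in> presheaves U C \<and> \<eta> \<in> NatT C P Q},
      Dom = (\<lambda>(P, \<eta>, Q). P),
      Cod = (\<lambda>(P, \<eta>, Q). Q),
      Ident = (\<lambda>P. (P, nat_id C P, P)),
      Comp = (\<lambda>(Q', \<theta>, R) (P, \<eta>, Q). (P, nat_comp C P \<theta> \<eta>, R))\<rparr>"

section \<open>Sieves\<close>

definition yoneda :: "('o, 'm) cat \<Rightarrow> 'o \<Rightarrow> ('o, 'm, 'm) presheaf" where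
  "yoneda C X =
     \<lparr>Ev = (\<lambda>Y\<in>Obj C. Hom C Y X),
      Res = (\<lambda>f\<in>Arr C. \<lambda>g\<in>Hom C (Cod C f) X. Comp C g f)\<rparr>"

definition subpresheaf ::
  "('o, 'm) cat \<Rightarrow> ('o, 'm, 'v) presheaf \<Rightarrow> ('o, 'm, 'v) presheaf \<Rightarrow> bool" where
  "subpresheaf C P Q \<longleftrightarrow> is_presheaf C P \<and>
     (\<forall>X\<in>Obj C. Ev P X \<subseteq> Ev Q X) \<and>
     (\<forall>f\<in>Arr C. \<forall>p\<in>Ev P (Cod C f). Res P f p = Res Q f p)"

text \<open>A sieve is paired with the object it lives on: the empty sieves on different
  objects have the same underlying presheaf.\<close>

definition sieves :: "('o, 'm) cat \<Rightarrow> ('o \<times> ('o, 'm, 'm) presheaf) set" where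
  "sieves C = {(X, K). X \<in> Obj C \<and> subpresheaf C K (yoneda C X)}"

definition sub_on ::
  "('o, 'm) cat \<Rightarrow> ('o, 'm, 'v) presheaf \<Rightarrow> ('o \<Rightarrow> 'v set) \<Rightarrow> ('o, 'm, 'v) presheaf" where
  "sub_on C Q A =
     \<lparr>Ev = (\<lambda>X\<in>Obj C. A X), Res = (\<lambda>f\<in>Arr C. \<lambda>p\<in>A (Cod C f). Res Q f p)\<rparr>"

text \<open>The fibre product of \<open>K\<close> and \<open>y(X')\<close> over \<open>y(X)\<close>, for \<open>x : X' \<rightarrow> X\<close>, as a sub-presheaf
  of \<open>y(X')\<close>: the pairs \<open>(k, f)\<close> with \<open>k = x f\<close> are identified with their second component.\<close>

definition pullback_sieve ::
  "('o, 'm) cat \<Rightarrow> 'm \<Rightarrow> ('o, 'm, 'm) presheaf \<Rightarrow> ('o, 'm, 'm) presheaf" where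
  "pullback_sieve C x K =
     sub_on C (yoneda C (Dom C x)) (\<lambda>Y. {f \<in> Hom C Y (Dom C x). Comp C x f \<in> Ev K Y})"

definition generated_sieve ::
  "('o, 'm) cat \<Rightarrow> 'o \<Rightarrow> 'i set \<Rightarrow> ('i \<Rightarrow> 'm) \<Rightarrow> ('o, 'm, 'm) presheaf" where
  "generated_sieve C X I x =
     sub_on C (yoneda C X) (\<lambda>Y. {Comp C (x i) f | i f. i \<in> I \<and> f \<in> Hom C Y (Dom C (x i))})"

section \<open>The duality between sieves and presheaves\<close>

definition yoneda_map ::
  "('o, 'm) cat \<Rightarrow> ('o, 'm, 'v) presheaf \<Rightarrow> 'o \<Rightarrow> 'v \<Rightarrow> 'o \<Rightarrow> 'm \<Rightarrow> 'v" where
  "yoneda_map C P X p = (\<lambda>Y\<in>Obj C. \<lambda>f\<in>Hom C Y X. Res P f p)"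

definition restrict_nat ::
  "('o, 'm) cat \<Rightarrow> ('o, 'm, 'v) presheaf \<Rightarrow> ('o \<Rightarrow> 'v \<Rightarrow> 'w) \<Rightarrow> 'o \<Rightarrow> 'v \<Rightarrow> 'w" where
  "restrict_nat C K \<eta> = (\<lambda>Y\<in>Obj C. \<lambda>k\<in>Ev K Y. \<eta> Y k)"

definition duality_rel ::
  "'v set set \<Rightarrow> ('o, 'm) cat \<Rightarrow>
    (('o \<times> ('o, 'm, 'm) presheaf) \<times> ('o, 'm, 'v) presheaf) set" where
  "duality_rel U C = {((X, K), P). (X, K) \<in> sieves C \<and> P \<in> presheaves U C \<and>
     (\<forall>X'\<in>Obj C. \<forall>x\<in>Hom C X' X.
        bij_betw (\<lambda>p. restrict_nat C (pullback_sieve C x K) (yoneda_map C P X' p))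
          (Ev P X') (NatT C (pullback_sieve C x K) P))}"

definition F_R ::
  "'v set set \<Rightarrow> ('o, 'm) cat \<Rightarrow> ('o \<times> ('o, 'm, 'm) presheaf) set \<Rightarrow> ('o, 'm, 'v) presheaf set" where
  "F_R U C J = {s \<in> presheaves U C. \<forall>t\<in>J. (t, s) \<in> duality_rel U C}"

definition G_R ::
  "'v set set \<Rightarrow> ('o, 'm) cat \<Rightarrow> ('o, 'm, 'v) presheaf set \<Rightarrow> ('o \<times> ('o, 'm, 'm) presheaf) set" where
  "G_R U C I = {t \<in> sieves C. \<forall>s\<in>I. (t, s) \<in> duality_rel U C}"

section \<open>Grothendieck topologies and subtoposes\<close>

text \<open>The families in the third condition are indexed by small sets.\<close>

definition grothendieck_topology ::
  "'v set set \<Rightarrow> ('o, 'm) cat \<Rightarrow> ('o \<times> ('o, 'm, 'm) presheaf) set \<Rightarrow> bool" where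
  "grothendieck_topology U C J \<longleftrightarrow>
     (\<forall>X\<in>Obj C. (X, yoneda C X) \<in> J) \<and>
     (\<forall>(X, K)\<in>J. \<forall>X'\<in>Obj C. \<forall>x\<in>Hom C X' X. (X', pullback_sieve C x K) \<in> J) \<and>
     (\<forall>X\<in>Obj C. \<forall>I\<in>U. \<forall>x :: 'v \<Rightarrow> 'm.
        (\<forall>i\<in>I. x i \<in> Arr C \<and> Cod C (x i) = X) \<longrightarrow> (X, generated_sieve C X I x) \<in> J \<longrightarrow>
        (\<forall>K. (X, K) \<in> sieves C \<longrightarrow>
           (\<forall>i\<in>I. (Dom C (x i), pullback_sieve C (x i) K) \<in> J) \<longrightarrow> (X, K) \<in> J))"

text \<open>The embedding of the full subcategory on \<open>I\<close> is \<^const>\<open>id_functor\<close>, and the canonical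
  morphism from \<open>P\<close> to its reflection is the unit \<open>\<eta> P\<close>.\<close>

definition is_subtopos ::
  "'v set set \<Rightarrow> ('o, 'm) cat \<Rightarrow> ('o, 'm, 'v) presheaf set \<Rightarrow> bool" where
  "is_subtopos U C I \<longleftrightarrow>
     (\<exists>L \<eta> \<epsilon>.
        adjunction (psh_cat U C) (full_subcat (psh_cat U C) I) L id_functor \<eta> \<epsilon> \<and>
        preserves_small_colimits U (psh_cat U C) (full_subcat (psh_cat U C) I) L \<and>
        preserves_finite_limits (psh_cat U C) (full_subcat (psh_cat U C) I) L \<and>
        (\<forall>P\<in>presheaves U C. P \<in> I \<longleftrightarrow> is_iso (psh_cat U C) (\<eta> P)))"

end

theory Submission
  imports Defs
begin

text \<open>
  Part (i). For a fixed presheaf \<open>P\<close>, the sieves all of whose pullbacks have unique amalgamation of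
  matching families in \<open>P\<close> form a Grothendieck topology (\<open>stably_sheaf_for_max\<close>,
  \<open>stably_sheaf_for_pb\<close>, \<open>stably_sheaf_for_trans\<close>); intersecting over \<open>P \<in> I\<close>, so do the sieves in
  \<open>G\<^sub>R(I)\<close>. Conversely, the elements of \<open>F\<^sub>R(J)\<close> for a topology \<open>J\<close> are the \<open>J\<close>-sheaves, and a sieve
  \<open>S\<close> on \<open>X\<close> for which all of them satisfy the sheaf condition is covering (\<open>cov_of_sheaf_for\<close>):
  the sheafification \<open>S \<rightarrow> aS\<close> extends to \<open>y(X)\<close>, so that the identity of \<open>X\<close> gives an element of
  \<open>aS(X)\<close>, which lies locally in the image of \<open>S\<close>.

  Part (ii). Everything about sheafification is deduced from three properties of the unit
  \<open>\<eta> : P \<rightarrow> aP\<close>: its target is a sheaf, and it is locally injective and locally surjective.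
  They give the universal property (\<open>extend_along_locally_bijective\<close>), and also the preservation of
  finite limits (\<open>locally_bijective_pointwise_limit\<close>), because finitely many local equalities hold
  simultaneously on a covering sieve. Preservation of colimits is formal. Such a unit is constructed
  in one step (\<open>sheafification_exists\<close>), without quotients: an element of \<open>aP(X)\<close> is the relation of
  all pairs \<open>(f, p)\<close> such that \<open>p\<close> agrees locally with it along \<open>f\<close>. These relations are subsets of
  small sets up to the choice of a small skeleton, so that they can be coded in the universe.

  Conversely, let \<open>I\<close> be a subtopos with reflector \<open>L\<close> and unit \<open>\<eta>\<close>, and \<open>J = G\<^sub>R(I)\<close>. An arrow
  inverted by \<open>L\<close> stays inverted when it is pulled back along an arrow from a representable, and
  objects of \<open>I\<close> do not see inverted arrows; hence inverted arrows are locally surjective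
  (\<open>inverted_sheaf_for\<close>). Applied to \<open>\<eta>\<^sub>P : P \<rightarrow> LP\<close> and to the diagonal of
  \<open>P \<times>\<^bsub>LP\<^esub> P\<close>, this says that \<open>\<eta>\<^sub>P\<close> is locally bijective. If \<open>P\<close> belongs to \<open>F\<^sub>R(J)\<close>, then \<open>\<eta>\<^sub>P\<close> is a
  locally bijective morphism of \<open>J\<close>-sheaves, hence an isomorphism, and \<open>P \<in> I\<close>
  (\<open>subtopos_fixed_point\<close>).
\<close>

section \<open>Smallness\<close>

text \<open>Sets of arrows, of pairs, or of subsets are not sets of elements of \<open>'v\<close>; what matters is that
  they have a copy in \<open>U\<close>.\<close>

definition small_set :: "'v set set \<Rightarrow> 'a set \<Rightarrow> bool" where
  "small_set U A \<longleftrightarrow> (\<exists>f :: 'a \<Rightarrow> 'v. inj_on f A \<and> f ` A \<in> U)"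

lemma universe_subset: "set_universe U \<Longrightarrow> A \<in> U \<Longrightarrow> B \<subseteq> A \<Longrightarrow> B \<in> U"
  unfolding set_universe_def by blast

lemma universe_image: "set_universe U \<Longrightarrow> A \<in> U \<Longrightarrow> f ` A \<in> U"
  unfolding set_universe_def by blast

lemma universe_UN:
  "set_universe U \<Longrightarrow> A \<in> U \<Longrightarrow> (\<And>a. a \<in> A \<Longrightarrow> B a \<in> U) \<Longrightarrow> (\<Union>a\<in>A. B a) \<in> U"
  unfolding set_universe_def by blast

lemma universe_Pow: "set_universe U \<Longrightarrow> A \<in> U \<Longrightarrow> small_set U (Pow A)"
  unfolding set_universe_def small_set_def by blast

lemma universe_singleton:
  assumes U: "set_universe U" shows "{v} \<in> U"
proof -
  have "U \<noteq> {}" using U unfolding set_universe_def by simp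
  then obtain A where "A \<in> U" by blast
  then have "{} \<in> U" using universe_subset[OF U] by blast
  then obtain f :: "'a set \<Rightarrow> 'a" where "f ` Pow {} \<in> U"
    using universe_Pow[OF U] unfolding small_set_def by blast
  from universe_image[OF U this, of "\<lambda>_. v"] have "(\<lambda>_. v) ` {f {}} \<in> U" by simp
  then show ?thesis by simp
qed

text \<open>A member of the universe of largest cardinality would be smaller than the copy of its power
  set.\<close>

lemma universe_infinite:
  assumes U: "set_universe (U :: 'v set set)" shows "infinite (UNIV :: 'v set)"
proof
  assume fin: "finite (UNIV :: 'v set)"
  have "finite U" using fin by (simp add: Finite_Set.finite_set finite_subset[OF subset_UNIV])
  moreover have "U \<noteq> {}" using U unfolding set_universe_def by simp
  ultimately have "Max (card ` U) \<in> card ` U" "\<And>B. B \<in> U \<Longrightarrow> card B \<le> Max (card ` U)" by auto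
  then obtain A where A: "A \<in> U" "\<And>B. B \<in> U \<Longrightarrow> card B \<le> card A" by auto
  obtain f :: "'v set \<Rightarrow> 'v" where f: "inj_on f (Pow A)" "f ` Pow A \<in> U"
    using universe_Pow[OF U A(1)] unfolding small_set_def by blast
  have finA: "finite A" by (rule finite_subset[OF subset_UNIV fin])
  have "card (f ` Pow A) = 2 ^ card A" using f(1) finA by (simp add: card_image card_Pow)
  then have "2 ^ card A \<le> card A" using A(2)[OF f(2)] by simp
  then show False using less_exp[of "card A"] by linarith
qed

lemma small_set_universe: "A \<in> U \<Longrightarrow> small_set U A"
  unfolding small_set_def by (metis image_ident inj_on_id2)

lemma small_set_inj_on:
  assumes U: "set_universe U" and "small_set U B" "inj_on g A" "g ` A \<subseteq> B"
  shows "small_set U A"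
proof -
  obtain f where f: "inj_on f B" "f ` B \<in> U" using assms(2) unfolding small_set_def by blast
  have "inj_on (f \<circ> g) A" using f(1) assms(3,4) by (meson comp_inj_on inj_on_subset)
  moreover have "(f \<circ> g) ` A \<in> U"
    using universe_subset[OF U f(2)] assms(4) by (metis image_comp image_mono)
  ultimately show ?thesis unfolding small_set_def by blast
qed

lemma small_set_subset: "set_universe U \<Longrightarrow> small_set U B \<Longrightarrow> A \<subseteq> B \<Longrightarrow> small_set U A"
  using small_set_inj_on[of U B "\<lambda>x. x" A] by auto

lemma small_set_image:
  assumes "set_universe U" "small_set U A" shows "small_set U (g ` A)"
  by (rule small_set_inj_on[OF assms, of "inv_into A g"]) (auto simp: inj_on_inv_into inv_into_into)

lemma small_set_Pow:
  assumes U: "set_universe U" and "small_set U A" shows "small_set U (Pow A)"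
proof -
  obtain f where f: "inj_on f A" "f ` A \<in> U" using assms(2) unfolding small_set_def by blast
  show ?thesis
    by (rule small_set_inj_on[OF U universe_Pow[OF U f(2)], of "image f"])
      (use f(1) in \<open>auto simp: inj_on_image_Pow\<close>)
qed

text \<open>Pairs are coded by an injection \<open>'v \<times> 'v \<rightarrow> 'v\<close>, which exists because \<open>'v\<close> is infinite.\<close>

lemma small_set_Sigma:
  assumes U: "set_universe (U :: 'v set set)" and A: "small_set U A"
    and B: "\<And>a. a \<in> A \<Longrightarrow> small_set U (B a)"
  shows "small_set U (Sigma A B)"
proof -
  have "\<exists>h :: 'v \<times> 'v \<Rightarrow> 'v. inj h"
    using card_of_Times_same_infinite[OF universe_infinite[OF U]]
    by (metis UNIV_Times_UNIV card_of_ordIso bij_betw_imp_inj_on)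
  then obtain h :: "'v \<times> 'v \<Rightarrow> 'v" where h: "inj h" ..
  obtain f where f: "inj_on f A" "f ` A \<in> U" using A unfolding small_set_def by blast
  have "\<forall>a\<in>A. \<exists>g. inj_on g (B a) \<and> g ` B a \<in> U" using B unfolding small_set_def by blast
  then obtain g where g: "\<And>a. a \<in> A \<Longrightarrow> inj_on (g a) (B a)" "\<And>a. a \<in> A \<Longrightarrow> g a ` B a \<in> U"
    by metis
  let ?F = "\<lambda>(a, b). h (f a, g a b)"
  have "inj_on ?F (Sigma A B)"
  proof (rule inj_onI, clarify)
    fix a b a' b' assume *: "a \<in> A" "b \<in> B a" "a' \<in> A" "b' \<in> B a'"
      "h (f a, g a b) = h (f a', g a' b')"
    have "f a = f a'" "g a b = g a' b'" using injD[OF h *(5)] by auto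
    then show "a = a' \<and> b = b'"
      using inj_onD[OF f(1), of a a'] inj_onD[OF g(1), of a b b'] * by auto
  qed
  moreover have "?F ` Sigma A B \<in> U"
  proof (rule universe_subset[OF U])
    show "(\<Union>u\<in>f ` A. \<Union>v\<in>g (inv_into A f u) ` B (inv_into A f u). {h (u, v)}) \<in> U"
      using f g by (intro universe_UN[OF U] universe_singleton[OF U]) auto
    show "?F ` Sigma A B \<subseteq> (\<Union>u\<in>f ` A. \<Union>v\<in>g (inv_into A f u) ` B (inv_into A f u). {h (u, v)})"
      using f(1) by auto
  qed
  ultimately show ?thesis unfolding small_set_def by blast
qed

section \<open>Categories and reflective subcategories\<close>

lemma Hom_D: "f \<in> Hom C X Y \<Longrightarrow> f \<in> Arr C" "f \<in> Hom C X Y \<Longrightarrow> Dom C f = X"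
  "f \<in> Hom C X Y \<Longrightarrow> Cod C f = Y"
  by (auto simp: Hom_def)

lemma Hom_obj: "category C \<Longrightarrow> f \<in> Hom C X Y \<Longrightarrow> X \<in> Obj C"
  "category C \<Longrightarrow> f \<in> Hom C X Y \<Longrightarrow> Y \<in> Obj C"
  by (auto simp: Hom_def category_def)

lemma Comp_Hom: "category C \<Longrightarrow> f \<in> Hom C X Y \<Longrightarrow> g \<in> Hom C Y Z \<Longrightarrow> Comp C g f \<in> Hom C X Z"
  by (auto simp: category_def Hom_def)

lemma Comp_assoc: "category C \<Longrightarrow> f \<in> Hom C W X \<Longrightarrow> g \<in> Hom C X Y \<Longrightarrow> h \<in> Hom C Y Z \<Longrightarrow>
  Comp C h (Comp C g f) = Comp C (Comp C h g) f"
  by (auto simp: category_def Hom_def)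

lemma Ident_Hom: "category C \<Longrightarrow> X \<in> Obj C \<Longrightarrow> Ident C X \<in> Hom C X X"
  by (auto simp: category_def)

lemma Comp_Ident: "category C \<Longrightarrow> f \<in> Hom C X Y \<Longrightarrow> Comp C f (Ident C X) = f"
  "category C \<Longrightarrow> f \<in> Hom C X Y \<Longrightarrow> Comp C (Ident C Y) f = f"
  by (auto simp: category_def Hom_def)

lemma is_functor_Hom: "is_functor C D F \<Longrightarrow> f \<in> Hom C X Y \<Longrightarrow> FArr F f \<in> Hom D (FObj F X) (FObj F Y)"
  by (auto simp: is_functor_def Hom_def)

lemma is_functor_Comp: "is_functor C D F \<Longrightarrow> f \<in> Hom C X Y \<Longrightarrow> g \<in> Hom C Y Z \<Longrightarrow>
  FArr F (Comp C g f) = Comp D (FArr F g) (FArr F f)"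
  by (auto simp: is_functor_def Hom_def)

lemma is_isoI: "f \<in> Hom C X Y \<Longrightarrow> g \<in> Hom C Y X \<Longrightarrow> Comp C g f = Ident C X \<Longrightarrow>
  Comp C f g = Ident C Y \<Longrightarrow> is_iso C f"
  by (auto simp: is_iso_def Hom_def)

lemma is_isoE: assumes "is_iso C f" "f \<in> Hom C X Y"
  obtains g where "g \<in> Hom C Y X" "Comp C g f = Ident C X" "Comp C f g = Ident C Y"
  using assms by (auto simp: is_iso_def Hom_def)

lemma full_subcat_simps [simp]:
  "Obj (full_subcat A I) = I" "Comp (full_subcat A I) = Comp A" "Ident (full_subcat A I) = Ident A"
  "Dom (full_subcat A I) = Dom A" "Cod (full_subcat A I) = Cod A"
  by (auto simp: full_subcat_def)

lemma Hom_full_subcat: "Hom (full_subcat A I) X Y = {f \<in> Hom A X Y. X \<in> I \<and> Y \<in> I}"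
  by (auto simp: full_subcat_def Hom_def)

lemma category_full_subcat:
  assumes "category A" "I \<subseteq> Obj A" shows "category (full_subcat A I)"
  using assms unfolding category_def Hom_full_subcat
  by (auto simp: full_subcat_def Hom_def subset_iff)

lemma is_iso_full_subcat:
  assumes "f \<in> Hom A X Y" "X \<in> I" "Y \<in> I"
  shows "is_iso (full_subcat A I) f \<longleftrightarrow> is_iso A f"
  using assms unfolding is_iso_def Hom_full_subcat by (auto simp: full_subcat_def Hom_def)

lemma is_iso_right_inverse:
  assumes C: "category C" and a: "a \<in> Hom C X Y" "is_iso C a" and b: "b \<in> Hom C Y X"
    and ab: "Comp C a b = Ident C Y"
  shows "is_iso C b"
proof -
  obtain g where g: "g \<in> Hom C Y X" "Comp C g a = Ident C X" "Comp C a g = Ident C Y"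
    using is_isoE[OF a(2,1)] .
  have "b = Comp C (Comp C g a) b" using Comp_Ident(2)[OF C b] g(2) by simp
  also have "\<dots> = g" using Comp_assoc[OF C b a(1) g(1)] ab Comp_Ident(1)[OF C g(1)] by simp
  finally have "b = g" .
  then show ?thesis using is_isoI[OF b a(1) ab] g(2) by simp
qed

text \<open>A left adjoint of the inclusion of a full subcategory, in terms of universal arrows: the form in
  which sheafification is constructed and in which a subtopos is used.\<close>

locale reflection =
  fixes A :: "('o, 'm) cat" and I :: "'o set" and L :: "('o, 'm, 'o, 'm) functr" and \<eta> :: "'o \<Rightarrow> 'm"
  assumes A: "category A" and I: "I \<subseteq> Obj A"
    and L: "is_functor A (full_subcat A I) L"
    and eta: "P \<in> Obj A \<Longrightarrow> \<eta> P \<in> Hom A P (FObj L P)"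
    and eta_nat: "f \<in> Hom A P Q \<Longrightarrow> Comp A (\<eta> Q) f = Comp A (FArr L f) (\<eta> P)"
    and univ: "P \<in> Obj A \<Longrightarrow> Q \<in> I \<Longrightarrow> f \<in> Hom A P Q \<Longrightarrow>
      \<exists>!g. g \<in> Hom A (FObj L P) Q \<and> Comp A g (\<eta> P) = f"
begin

lemma L_obj: "P \<in> Obj A \<Longrightarrow> FObj L P \<in> I" "P \<in> Obj A \<Longrightarrow> FObj L P \<in> Obj A"
  using L I by (auto simp: is_functor_def)

lemma L_Hom: "f \<in> Hom A P Q \<Longrightarrow> FArr L f \<in> Hom A (FObj L P) (FObj L Q)"
  using is_functor_Hom[OF L, of f P Q] by (simp add: Hom_full_subcat)

lemma univ_eq: "P \<in> Obj A \<Longrightarrow> Q \<in> I \<Longrightarrow> g \<in> Hom A (FObj L P) Q \<Longrightarrow> h \<in> Hom A (FObj L P) Q \<Longrightarrow>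
    Comp A g (\<eta> P) = Comp A h (\<eta> P) \<Longrightarrow> g = h"
  using univ[of P Q "Comp A h (\<eta> P)"] Comp_Hom[OF A eta] by metis

lemma eta_iso: assumes Q: "Q \<in> I" shows "is_iso A (\<eta> Q)"
proof -
  have QO: "Q \<in> Obj A" using Q I by auto
  obtain e where e: "e \<in> Hom A (FObj L Q) Q" "Comp A e (\<eta> Q) = Ident A Q"
    using univ[OF QO Q Ident_Hom[OF A QO]] by blast
  have "Comp A (\<eta> Q) e = Ident A (FObj L Q)"
  proof (rule univ_eq[OF QO L_obj(1)[OF QO]])
    show "Comp A (\<eta> Q) e \<in> Hom A (FObj L Q) (FObj L Q)" using Comp_Hom[OF A e(1) eta[OF QO]] .
    show "Ident A (FObj L Q) \<in> Hom A (FObj L Q) (FObj L Q)" using Ident_Hom[OF A L_obj(2)[OF QO]] .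
    show "Comp A (Comp A (\<eta> Q) e) (\<eta> Q) = Comp A (Ident A (FObj L Q)) (\<eta> Q)"
      using Comp_assoc[OF A eta[OF QO] e(1) eta[OF QO]] e(2) Comp_Ident[OF A eta[OF QO]] by simp
  qed
  then show ?thesis using is_isoI[OF eta[OF QO] e(1) e(2)] by simp
qed

text \<open>By the universal property \<open>L(\<eta>\<^sub>P)\<close> is the unit of \<open>LP\<close>, which is invertible as \<open>LP \<in> I\<close>.\<close>

lemma L_eta_iso: assumes P: "P \<in> Obj A" shows "is_iso A (FArr L (\<eta> P))"
proof -
  have "FArr L (\<eta> P) = \<eta> (FObj L P)"
    using univ_eq[OF P L_obj(1)[OF L_obj(2)[OF P]] L_Hom[OF eta[OF P]] eta[OF L_obj(2)[OF P]]]
      eta_nat[OF eta[OF P]] by simp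
  then show ?thesis using eta_iso[OF L_obj(1)[OF P]] by simp
qed

text \<open>Objects of \<open>I\<close> do not distinguish the two ends of an arrow inverted by \<open>L\<close>, because arrows into
  them correspond, along the units, to arrows from the values of \<open>L\<close>.\<close>

lemma inverted_orthogonal:
  assumes w: "w \<in> Hom A E X" and iso: "is_iso A (FArr L w)" and Q: "Q \<in> I" and g: "g \<in> Hom A E Q"
  shows "\<exists>!h. h \<in> Hom A X Q \<and> Comp A h w = g"
proof -
  have E: "E \<in> Obj A" and X: "X \<in> Obj A" using Hom_obj[OF A w] by auto
  note Lw = L_Hom[OF w]
  obtain k where k: "k \<in> Hom A (FObj L X) (FObj L E)" "Comp A k (FArr L w) = Ident A (FObj L E)"
    "Comp A (FArr L w) k = Ident A (FObj L X)"
    using is_isoE[OF iso Lw] .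
  obtain g' where g': "g' \<in> Hom A (FObj L E) Q" "Comp A g' (\<eta> E) = g"
    using univ[OF E Q g] by blast
  let ?gk = "Comp A g' k"
  let ?h = "Comp A ?gk (\<eta> X)"
  have gk: "?gk \<in> Hom A (FObj L X) Q" using Comp_Hom[OF A k(1) g'(1)] .
  have wn: "Comp A (Comp A h' (\<eta> X)) w = Comp A (Comp A h' (FArr L w)) (\<eta> E)"
    if "h' \<in> Hom A (FObj L X) Q" for h'
    using Comp_assoc[OF A w eta[OF X] that] eta_nat[OF w] Comp_assoc[OF A eta[OF E] Lw that] by simp
  show ?thesis
  proof (rule ex1I[of _ ?h], intro conjI)
    show "?h \<in> Hom A X Q" using Comp_Hom[OF A eta[OF X] gk] .
    have "Comp A ?gk (FArr L w) = g'"
      using Comp_assoc[OF A Lw k(1) g'(1)] k(2) Comp_Ident(1)[OF A g'(1)] by simp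
    then show "Comp A ?h w = g" using wn[OF gk] g'(2) by simp
  next
    fix h assume h: "h \<in> Hom A X Q \<and> Comp A h w = g"
    then obtain h' where h': "h' \<in> Hom A (FObj L X) Q" "Comp A h' (\<eta> X) = h"
      using univ[OF X Q] by blast
    have "Comp A h' (FArr L w) = g'"
      using univ_eq[OF E Q Comp_Hom[OF A Lw h'(1)] g'(1)] wn[OF h'(1)] h h'(2) g'(2) by simp
    then have "?gk = Comp A (Comp A h' (FArr L w)) k" by simp
    also have "\<dots> = h'" using Comp_assoc[OF A k(1) Lw h'(1)] k(3) Comp_Ident(1)[OF A h'(1)] by simp
    finally show "h = ?h" using h'(2) by simp
  qed
qed

lemma adjunction: "\<exists>\<epsilon>. adjunction A (full_subcat A I) L id_functor \<eta> \<epsilon>"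
proof -
  have "\<forall>Q\<in>I. \<exists>e. e \<in> Hom A (FObj L Q) Q \<and> Comp A e (\<eta> Q) = Ident A Q"
    using univ I Ident_Hom[OF A] by blast
  then obtain e where e: "\<And>Q. Q \<in> I \<Longrightarrow> e Q \<in> Hom A (FObj L Q) Q"
    "\<And>Q. Q \<in> I \<Longrightarrow> Comp A (e Q) (\<eta> Q) = Ident A Q" by metis
  have "adjunction A (full_subcat A I) L id_functor \<eta> e"
    unfolding adjunction_def is_nat_transf_def
  proof (intro conjI ballI)
    show "is_functor A (full_subcat A I) L" by (rule L)
    show "is_functor (full_subcat A I) A id_functor"
      using I by (auto simp: is_functor_def id_functor_def full_subcat_def Hom_def)
  next
    fix P assume "P \<in> Obj A"
    then show "\<eta> P \<in> Hom A (FObj id_functor P) (FObj (comp_functor id_functor L) P)"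
      using eta by (simp add: id_functor_def comp_functor_def)
  next
    fix f assume "f \<in> Arr A"
    then show "Comp A (\<eta> (Cod A f)) (FArr id_functor f) =
      Comp A (FArr (comp_functor id_functor L) f) (\<eta> (Dom A f))"
      using eta_nat[of f "Dom A f" "Cod A f"] by (simp add: id_functor_def comp_functor_def Hom_def)
  next
    fix Q assume "Q \<in> Obj (full_subcat A I)"
    then have Q: "Q \<in> I" by simp
    then show "e Q \<in> Hom (full_subcat A I) (FObj (comp_functor L id_functor) Q) (FObj id_functor Q)"
      using e(1)[OF Q] L_obj(1) I by (auto simp: id_functor_def comp_functor_def Hom_full_subcat)
    show "Comp A (FArr id_functor (e Q)) (\<eta> (FObj id_functor Q)) = Ident A (FObj id_functor Q)"
      using e(2)[OF Q] by (simp add: id_functor_def)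
  next
    fix f assume "f \<in> Arr (full_subcat A I)"
    then obtain P Q where f: "f \<in> Hom A P Q" and PQ: "P \<in> I" "Q \<in> I"
      by (auto simp: full_subcat_def Hom_def)
    have PO: "P \<in> Obj A" and QO: "Q \<in> Obj A" using PQ I by auto
    have "Comp A (e Q) (FArr L f) = Comp A f (e P)"
    proof (rule univ_eq[OF PO PQ(2)])
      show "Comp A (e Q) (FArr L f) \<in> Hom A (FObj L P) Q"
        using Comp_Hom[OF A L_Hom[OF f] e(1)[OF PQ(2)]] .
      show "Comp A f (e P) \<in> Hom A (FObj L P) Q" using Comp_Hom[OF A e(1)[OF PQ(1)] f] .
      have "Comp A (Comp A (e Q) (FArr L f)) (\<eta> P) = Comp A (Comp A (e Q) (\<eta> Q)) f"
        using Comp_assoc[OF A eta[OF PO] L_Hom[OF f] e(1)[OF PQ(2)]]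
          Comp_assoc[OF A f eta[OF QO] e(1)[OF PQ(2)]] eta_nat[OF f] by simp
      also have "\<dots> = f" using e(2)[OF PQ(2)] Comp_Ident(2)[OF A f] by simp
      also have "f = Comp A (Comp A f (e P)) (\<eta> P)"
        using Comp_assoc[OF A eta[OF PO] e(1)[OF PQ(1)] f] e(2)[OF PQ(1)] Comp_Ident(1)[OF A f]
          by simp
      finally show "Comp A (Comp A (e Q) (FArr L f)) (\<eta> P) = Comp A (Comp A f (e P)) (\<eta> P)" .
    qed
    then show "Comp (full_subcat A I) (e (Cod (full_subcat A I) f)) (FArr (comp_functor L
      id_functor) f) =
        Comp (full_subcat A I) (FArr id_functor f) (e (Dom (full_subcat A I) f))"
      using f by (simp add: id_functor_def comp_functor_def Hom_def)
  next
    fix P assume P: "P \<in> Obj A"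
    note LP = L_obj(1)[OF P] and LPO = L_obj(2)[OF P]
    have "Comp A (e (FObj L P)) (FArr L (\<eta> P)) = Ident A (FObj L P)"
    proof (rule univ_eq[OF P LP])
      show "Comp A (e (FObj L P)) (FArr L (\<eta> P)) \<in> Hom A (FObj L P) (FObj L P)"
        using Comp_Hom[OF A L_Hom[OF eta[OF P]] e(1)[OF LP]] .
      show "Ident A (FObj L P) \<in> Hom A (FObj L P) (FObj L P)" using Ident_Hom[OF A LPO] .
      have "Comp A (Comp A (e (FObj L P)) (FArr L (\<eta> P))) (\<eta> P) =
        Comp A (Comp A (e (FObj L P)) (\<eta> (FObj L P))) (\<eta> P)"
        using Comp_assoc[OF A eta[OF P] L_Hom[OF eta[OF P]] e(1)[OF LP]]
          Comp_assoc[OF A eta[OF P] eta[OF LPO] e(1)[OF LP]] eta_nat[OF eta[OF P]] by simp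
      then show "Comp A (Comp A (e (FObj L P)) (FArr L (\<eta> P))) (\<eta> P) =
        Comp A (Ident A (FObj L P)) (\<eta> P)"
        using e(2)[OF LP] by simp
    qed
    then show "Comp (full_subcat A I) (e (FObj L P)) (FArr L (\<eta> P)) =
      Ident (full_subcat A I) (FObj L P)" by simp
  qed
  then show ?thesis by blast
qed

lemma preserves_colimits:
  fixes U :: "'v set set"
  shows "preserves_small_colimits U A (full_subcat A I) L"
  unfolding preserves_small_colimits_def
proof (intro allI impI, elim conjE)
  let ?B = "full_subcat A I"
  fix K :: "('v, 'v) cat" and D X p
  assume K: "small_cat U K" and D: "is_functor K A D" and colim: "is_colimit K A D X p"
  have X: "X \<in> Obj A" and pH: "\<And>i. i \<in> Obj K \<Longrightarrow> p i \<in> Hom A (FObj D i) X"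
    and pk: "\<And>k. k \<in> Arr K \<Longrightarrow> Comp A (p (Cod K k)) (FArr D k) = p (Dom K k)"
    using colim by (auto simp: is_colimit_def is_cocone_def)
  have KD: "Dom K k \<in> Obj K" "Cod K k \<in> Obj K" if "k \<in> Arr K" for k
    using K that by (auto simp: small_cat_def category_def)
  have DO: "FObj D i \<in> Obj A" if "i \<in> Obj K" for i using D that by (simp add: is_functor_def)
  have DH: "FArr D k \<in> Hom A (FObj D (Dom K k)) (FObj D (Cod K k))" if "k \<in> Arr K" for k
    using D that by (simp add: is_functor_def)
  show "is_colimit K ?B (comp_functor L D) (FObj L X) (\<lambda>i. FArr L (p i))"
    unfolding is_colimit_def
  proof (intro conjI allI impI)
    show "is_cocone K ?B (comp_functor L D) (FObj L X) (\<lambda>i. FArr L (p i))"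
      unfolding is_cocone_def
    proof (intro conjI ballI)
      show "FObj L X \<in> Obj ?B" using L_obj(1)[OF X] by simp
      show "FArr L (p i) \<in> Hom ?B (FObj (comp_functor L D) i) (FObj L X)" if "i \<in> Obj K" for i
        using is_functor_Hom[OF L pH[OF that]] by (simp add: comp_functor_def)
      show "Comp ?B (FArr L (p (Cod K k))) (FArr (comp_functor L D) k) = FArr L (p (Dom K k))"
        if k: "k \<in> Arr K" for k
        using is_functor_Comp[OF L DH[OF k] pH[OF KD(2)[OF k]]] pk[OF k]
          by (simp add: comp_functor_def)
    qed
  next
    fix Y q assume q: "is_cocone K ?B (comp_functor L D) Y q"
    have Y: "Y \<in> I" and qH: "\<And>i. i \<in> Obj K \<Longrightarrow> q i \<in> Hom A (FObj L (FObj D i)) Y"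
      and qk: "\<And>k. k \<in> Arr K \<Longrightarrow> Comp A (q (Cod K k)) (FArr L (FArr D k)) = q (Dom K k)"
      using q by (auto simp: is_cocone_def comp_functor_def Hom_full_subcat)
    let ?q = "\<lambda>i. Comp A (q i) (\<eta> (FObj D i))"
    have "is_cocone K A D Y ?q"
      unfolding is_cocone_def
    proof (intro conjI ballI)
      show "Y \<in> Obj A" using Y I by blast
      show "?q i \<in> Hom A (FObj D i) Y" if "i \<in> Obj K" for i
        using Comp_Hom[OF A eta[OF DO[OF that]] qH[OF that]] .
      fix k assume k: "k \<in> Arr K"
      note i = KD(1)[OF k] and j = KD(2)[OF k]
      show "Comp A (?q (Cod K k)) (FArr D k) = ?q (Dom K k)"
        using Comp_assoc[OF A DH[OF k] eta[OF DO[OF j]] qH[OF j]] eta_nat[OF DH[OF k]]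
          Comp_assoc[OF A eta[OF DO[OF i]] L_Hom[OF DH[OF k]] qH[OF j]] qk[OF k] by simp
    qed
    then obtain u where u: "u \<in> Hom A X Y" "\<forall>i\<in>Obj K. Comp A u (p i) = ?q i"
      and uu: "\<And>u'. u' \<in> Hom A X Y \<Longrightarrow> \<forall>i\<in>Obj K. Comp A u' (p i) = ?q i \<Longrightarrow> u' = u"
      using colim unfolding is_colimit_def by blast
    have iff: "Comp A v (FArr L (p i)) = q i \<longleftrightarrow> Comp A (Comp A v (\<eta> X)) (p i) = ?q i"
      if v: "v \<in> Hom A (FObj L X) Y" and i: "i \<in> Obj K" for v i
    proof -
      have "Comp A (Comp A v (\<eta> X)) (p i) = Comp A (Comp A v (FArr L (p i))) (\<eta> (FObj D i))"
        using Comp_assoc[OF A pH[OF i] eta[OF X] v] eta_nat[OF pH[OF i]]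
          Comp_assoc[OF A eta[OF DO[OF i]] L_Hom[OF pH[OF i]] v] by simp
      then show ?thesis
        using univ_eq[OF DO[OF i] Y Comp_Hom[OF A L_Hom[OF pH[OF i]] v] qH[OF i]] by auto
    qed
    obtain v where v: "v \<in> Hom A (FObj L X) Y" "Comp A v (\<eta> X) = u" using univ[OF X Y u(1)] by blast
    show "\<exists>!v. v \<in> Hom ?B (FObj L X) Y \<and> (\<forall>i\<in>Obj K. Comp ?B v (FArr L (p i)) = q i)"
    proof (rule ex1I[of _ v])
      show "v \<in> Hom ?B (FObj L X) Y \<and> (\<forall>i\<in>Obj K. Comp ?B v (FArr L (p i)) = q i)"
        using v iff[OF v(1)] u(2) L_obj(1)[OF X] Y by (simp add: Hom_full_subcat)
      fix v' assume "v' \<in> Hom ?B (FObj L X) Y \<and> (\<forall>i\<in>Obj K. Comp ?B v' (FArr L (p i)) = q i)"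
      then have v': "v' \<in> Hom A (FObj L X) Y" "\<forall>i\<in>Obj K. Comp A v' (FArr L (p i)) = q i"
        by (auto simp: Hom_full_subcat)
      have "Comp A v' (\<eta> X) = u"
        using uu[OF Comp_Hom[OF A eta[OF X] v'(1)]] iff[OF v'(1)] v'(2) by simp
      then show "v' = v" using univ_eq[OF X Y v'(1) v(1)] v(2) by simp
    qed
  qed
qed

end

lemma reflection_of_adjunction:
  assumes A: "category A" and I: "I \<subseteq> Obj A"
    and adj: "adjunction A (full_subcat A I) L id_functor \<eta> \<epsilon>"
  shows "reflection A I L \<eta>"
proof
  have L: "is_functor A (full_subcat A I) L"
    and eta: "\<And>X. X \<in> Obj A \<Longrightarrow> \<eta> X \<in> Hom A X (FObj L X)"
    and eta_nat: "\<And>X Y f. f \<in> Hom A X Y \<Longrightarrow> Comp A (\<eta> Y) f = Comp A (FArr L f) (\<eta> X)"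
    and eps: "\<And>X. X \<in> I \<Longrightarrow> \<epsilon> X \<in> Hom A (FObj L X) X"
    and eps_nat: "\<And>X Y f. f \<in> Hom A X Y \<Longrightarrow> X \<in> I \<Longrightarrow> Y \<in> I \<Longrightarrow> Comp A (\<epsilon> Y) (FArr L f) = Comp A f (\<epsilon> X)"
    and tri1: "\<And>a. a \<in> Obj A \<Longrightarrow> Comp A (\<epsilon> (FObj L a)) (FArr L (\<eta> a)) = Ident A (FObj L a)"
    and tri2: "\<And>b. b \<in> I \<Longrightarrow> Comp A (\<epsilon> b) (\<eta> b) = Ident A b"
    using adj by (auto simp: adjunction_def is_nat_transf_def comp_functor_def id_functor_def
        Hom_full_subcat) (auto simp: Hom_def full_subcat_def)
  show "category A" "I \<subseteq> Obj A" "is_functor A (full_subcat A I) L" by fact+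
  show "P \<in> Obj A \<Longrightarrow> \<eta> P \<in> Hom A P (FObj L P)" for P by (rule eta)
  show "f \<in> Hom A P Q \<Longrightarrow> Comp A (\<eta> Q) f = Comp A (FArr L f) (\<eta> P)" for f P Q by (rule eta_nat)
  have LI: "P \<in> Obj A \<Longrightarrow> FObj L P \<in> I" for P using L by (auto simp: is_functor_def)
  have LH: "f \<in> Hom A P Q \<Longrightarrow> FArr L f \<in> Hom A (FObj L P) (FObj L Q)" for f P Q
    using is_functor_Hom[OF L, of f P Q] by (simp add: Hom_full_subcat)
  have LC: "f \<in> Hom A P Q \<Longrightarrow> g \<in> Hom A Q R \<Longrightarrow> FArr L (Comp A g f) = Comp A (FArr L g) (FArr L f)"
    for f g P Q R
    using is_functor_Comp[OF L, of f P Q g R] by simp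
  fix P Q f assume P: "P \<in> Obj A" and Q: "Q \<in> I" and f: "f \<in> Hom A P Q"
  let ?g = "Comp A (\<epsilon> Q) (FArr L f)"
  show "\<exists>!g. g \<in> Hom A (FObj L P) Q \<and> Comp A g (\<eta> P) = f"
  proof (rule ex1I[of _ ?g], intro conjI)
    show "?g \<in> Hom A (FObj L P) Q" using Comp_Hom[OF A LH[OF f] eps[OF Q]] .
    have "Comp A ?g (\<eta> P) = Comp A (Comp A (\<epsilon> Q) (\<eta> Q)) f"
      using Comp_assoc[OF A eta[OF P] LH[OF f] eps[OF Q]] Q I
        Comp_assoc[OF A f eta eps[OF Q]] eta_nat[OF f] by auto
    then show "Comp A ?g (\<eta> P) = f" using tri2[OF Q] Comp_Ident(2)[OF A f] by simp
  next
    fix g assume g: "g \<in> Hom A (FObj L P) Q \<and> Comp A g (\<eta> P) = f"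
    then have gH: "g \<in> Hom A (FObj L P) Q" and gf: "f = Comp A g (\<eta> P)" by auto
    have "?g = Comp A (Comp A (\<epsilon> Q) (FArr L g)) (FArr L (\<eta> P))"
      unfolding gf using LC[OF eta[OF P] gH] Comp_assoc[OF A LH[OF eta[OF P]] LH[OF gH] eps[OF Q]]
        by simp
    also have "\<dots> = Comp A g (Comp A (\<epsilon> (FObj L P)) (FArr L (\<eta> P)))"
      using eps_nat[OF gH LI[OF P] Q] Comp_assoc[OF A LH[OF eta[OF P]] eps[OF LI[OF P]] gH] by simp
    also have "\<dots> = g" using tri1[OF P] Comp_Ident(1)[OF A gH] by simp
    finally show "g = ?g" by simp
  qed
qed

lemma reflection_of_universal_arrows:
  fixes A :: "('o, 'm) cat" 
  assumes A: "category A" and I: "I \<subseteq> Obj A" and r: "\<And>P. P \<in> Obj A \<Longrightarrow> r P \<in> I"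
    and eta: "\<And>P. P \<in> Obj A \<Longrightarrow> \<eta> P \<in> Hom A P (r P)"
    and univ: "\<And>P Q f. P \<in> Obj A \<Longrightarrow> Q \<in> I \<Longrightarrow> f \<in> Hom A P Q \<Longrightarrow>
      \<exists>!g. g \<in> Hom A (r P) Q \<and> Comp A g (\<eta> P) = f"
  obtains L where "reflection A I L \<eta>" "\<And>P. FObj L P = r P"
proof -
  define LA where "LA f = (THE g. g \<in> Hom A (r (Dom A f)) (r (Cod A f)) \<and>
    Comp A g (\<eta> (Dom A f)) = Comp A (\<eta> (Cod A f)) f)" for f
  have LA: "LA f \<in> Hom A (r P) (r Q) \<and> Comp A (LA f) (\<eta> P) = Comp A (\<eta> Q) f"
    if f: "f \<in> Hom A P Q" for f P Q
  proof -
    have "P \<in> Obj A" "Q \<in> Obj A" using Hom_obj[OF A f] by auto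
    then have "\<exists>!g. g \<in> Hom A (r P) (r Q) \<and> Comp A g (\<eta> P) = Comp A (\<eta> Q) f"
      using univ r Comp_Hom[OF A f eta] by blast
    from theI'[OF this] show ?thesis unfolding LA_def using Hom_D[OF f] by simp
  qed
  have eq: "g = h" if "P \<in> Obj A" "Q \<in> I" "g \<in> Hom A (r P) Q" "h \<in> Hom A (r P) Q"
    "Comp A g (\<eta> P) = Comp A h (\<eta> P)" for P Q g h
    using univ[OF that(1,2) Comp_Hom[OF A eta[OF that(1)] that(3)]] that by metis
  define L where "L = \<lparr>FObj = r, FArr = LA\<rparr>"
  have L: "is_functor A (full_subcat A I) L"
    unfolding is_functor_def L_def
  proof (intro conjI ballI impI; simp)
    fix P assume P: "P \<in> Obj A"
    then show "r P \<in> I" by (rule r)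
    have rPO: "r P \<in> Obj A" using r[OF P] I by blast
    show "LA (Ident A P) = Ident A (r P)"
    proof (rule eq[OF P r[OF P]])
      show "LA (Ident A P) \<in> Hom A (r P) (r P)" using LA[OF Ident_Hom[OF A P]] by simp
      show "Ident A (r P) \<in> Hom A (r P) (r P)" by (rule Ident_Hom[OF A rPO])
      show "Comp A (LA (Ident A P)) (\<eta> P) = Comp A (Ident A (r P)) (\<eta> P)"
        using LA[OF Ident_Hom[OF A P]] Comp_Ident[OF A eta[OF P]] by simp
    qed
  next
    fix f assume "f \<in> Arr A"
    then have f: "f \<in> Hom A (Dom A f) (Cod A f)" by (simp add: Hom_def)
    show "LA f \<in> Hom (full_subcat A I) (r (Dom A f)) (r (Cod A f))"
      using LA[OF f] r Hom_obj[OF A f] by (simp add: Hom_full_subcat)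
    fix g assume "g \<in> Arr A" "Dom A g = Cod A f"
    then have g: "g \<in> Hom A (Cod A f) (Cod A g)" by (simp add: Hom_def)
    let ?P = "Dom A f" and ?Q = "Cod A f" and ?R = "Cod A g"
    have P: "?P \<in> Obj A" and Q: "?Q \<in> Obj A" and R: "?R \<in> Obj A"
      using Hom_obj[OF A f] Hom_obj[OF A g] by auto
    have LAf: "LA f \<in> Hom A (r ?P) (r ?Q)" and LAg: "LA g \<in> Hom A (r ?Q) (r ?R)"
      using LA[OF f] LA[OF g] by auto
    have gf: "Comp A g f \<in> Hom A ?P ?R" using Comp_Hom[OF A f g] .
    show "LA (Comp A g f) = Comp A (LA g) (LA f)"
    proof (rule eq[OF P r[OF R]])
      show "LA (Comp A g f) \<in> Hom A (r ?P) (r ?R)" using LA[OF gf] by simp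
      show "Comp A (LA g) (LA f) \<in> Hom A (r ?P) (r ?R)" using Comp_Hom[OF A LAf LAg] .
      show "Comp A (LA (Comp A g f)) (\<eta> ?P) = Comp A (Comp A (LA g) (LA f)) (\<eta> ?P)"
        using LA[OF gf] LA[OF f] LA[OF g] Comp_assoc[OF A eta[OF P] LAf LAg]
          Comp_assoc[OF A f eta[OF Q] LAg] Comp_assoc[OF A f g eta[OF R]] by simp
    qed
  qed
  have "reflection A I L \<eta>"
    using A I L eta univ LA by unfold_locales (auto simp: L_def)
  then show thesis using that by (auto simp: L_def)
qed

section \<open>Pullbacks\<close>

definition is_pullback ::
  "('o, 'm) cat \<Rightarrow> 'o \<Rightarrow> 'o \<Rightarrow> 'o \<Rightarrow> 'o \<Rightarrow> 'm \<Rightarrow> 'm \<Rightarrow> 'm \<Rightarrow> 'm \<Rightarrow> bool" where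
  "is_pullback C W X Z Y a b f g \<longleftrightarrow>
     a \<in> Hom C W X \<and> b \<in> Hom C W Z \<and> f \<in> Hom C X Y \<and> g \<in> Hom C Z Y \<and> Comp C f a = Comp C g b \<and>
     (\<forall>V h k. h \<in> Hom C V X \<longrightarrow> k \<in> Hom C V Z \<longrightarrow> Comp C f h = Comp C g k \<longrightarrow>
        (\<exists>!u. u \<in> Hom C V W \<and> Comp C a u = h \<and> Comp C b u = k))"

lemma pullback_of_iso:
  assumes C: "category C" and pb: "is_pullback C W X Z Y a b f g" and iso: "is_iso C g"
  shows "is_iso C a"
proof -
  have H: "a \<in> Hom C W X" "b \<in> Hom C W Z" "f \<in> Hom C X Y" "g \<in> Hom C Z Y" "Comp C f a = Comp C g b"
    and un: "\<And>V h k. h \<in> Hom C V X \<Longrightarrow> k \<in> Hom C V Z \<Longrightarrow> Comp C f h = Comp C g k \<Longrightarrow>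
        \<exists>!u. u \<in> Hom C V W \<and> Comp C a u = h \<and> Comp C b u = k"
    using pb unfolding is_pullback_def by blast+
  obtain g' where g': "g' \<in> Hom C Y Z" "Comp C g' g = Ident C Z" "Comp C g g' = Ident C Y"
    using is_isoE[OF iso H(4)] .
  have X: "X \<in> Obj C" and W: "W \<in> Obj C" using Hom_obj[OF C H(1)] by auto
  have g'f: "Comp C g' f \<in> Hom C X Z" using Comp_Hom[OF C H(3) g'(1)] .
  have "Comp C f (Ident C X) = Comp C g (Comp C g' f)"
    using Comp_assoc[OF C H(3) g'(1) H(4)] g'(3) Comp_Ident[OF C H(3)] by simp
  then obtain u where u: "u \<in> Hom C X W" "Comp C a u = Ident C X" "Comp C b u = Comp C g' f"
    using un[OF Ident_Hom[OF C X] g'f] by blast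
  have ua: "Comp C u a \<in> Hom C W W" using Comp_Hom[OF C H(1) u(1)] .
  have "Comp C a (Comp C u a) = a"
    using Comp_assoc[OF C H(1) u(1) H(1)] u(2) Comp_Ident[OF C H(1)] by simp
  moreover have "Comp C b (Comp C u a) = b"
    using Comp_assoc[OF C H(1) u(1) H(2)] u(3) Comp_assoc[OF C H(1) H(3) g'(1)] H(5)
      Comp_assoc[OF C H(2) H(4) g'(1)] g'(2) Comp_Ident[OF C H(2)] by simp
  ultimately have "Comp C u a = Ident C W"
    using un[OF H(1) H(2) H(5)] ua Ident_Hom[OF C W] Comp_Ident[OF C H(1)] Comp_Ident[OF C H(2)]
      by metis
  then show ?thesis using is_isoI[OF H(1) u(1)] u(2) by simp
qed

text \<open>The shape \<open>0 \<rightarrow> 2 \<leftarrow> 1\<close>: the number \<open>i \<le> 2\<close> is also the identity of the object \<open>i\<close>, and the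
  legs are \<open>3\<close> and \<open>4\<close>.\<close>

definition cospan :: "(nat, nat) cat" where
  "cospan = \<lparr>Obj = {0, 1, 2}, Arr = {0, 1, 2, 3, 4},
     Dom = (\<lambda>k. if k = 3 then 0 else if k = 4 then 1 else k), Cod = (\<lambda>k. if 3 \<le> k then 2 else k),
     Ident = (\<lambda>i. i), Comp = (\<lambda>g f. if f \<le> 2 then g else f)\<rparr>"

definition cospan_diagram :: "('o, 'm) cat \<Rightarrow> 'o \<Rightarrow> 'o \<Rightarrow> 'o \<Rightarrow> 'm \<Rightarrow> 'm \<Rightarrow> (nat, nat, 'o, 'm) functr"
  where
  "cospan_diagram C X Z Y f g =
     \<lparr>FObj = (\<lambda>i. if i = 0 then X else if i = 1 then Z else Y),
      FArr = (\<lambda>k. if k = 0 then Ident C X else if k = 1 then Ident C Z else if k = 2 then Ident C Y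
        else if k = 3 then f else g)\<rparr>"

lemma category_cospan: "category cospan"
  unfolding category_def cospan_def Hom_def by auto

lemma cospan_diagram_functor:
  assumes "category C" "f \<in> Hom C X Y" "g \<in> Hom C Z Y"
  shows "is_functor cospan C (cospan_diagram C X Z Y f g)"
proof -
  have obj: "X \<in> Obj C" "Y \<in> Obj C" "Z \<in> Obj C"
    using Hom_obj[OF assms(1,2)] Hom_obj[OF assms(1,3)] by auto
  have "Comp C (Ident C V) (Ident C V) = Ident C V" if "V \<in> Obj C" for V
    using Comp_Ident(1)[OF assms(1) Ident_Hom[OF assms(1) that]] .
  with obj show ?thesis
    using assms(2,3) Ident_Hom[OF assms(1)] Comp_Ident[OF assms(1,2)] Comp_Ident[OF assms(1,3)]
    unfolding is_functor_def cospan_diagram_def cospan_def by auto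
qed

lemma is_limit_cospan_diagram:
  assumes C: "category C" and pb: "is_pullback C W X Z Y a b f g"
  shows "is_limit cospan C (cospan_diagram C X Z Y f g) W
    (\<lambda>i. if i = 0 then a else if i = 1 then b else Comp C f a)"
proof -
  have H: "a \<in> Hom C W X" "b \<in> Hom C W Z" "f \<in> Hom C X Y" "g \<in> Hom C Z Y" "Comp C f a = Comp C g b"
    and un: "\<And>V h k. h \<in> Hom C V X \<Longrightarrow> k \<in> Hom C V Z \<Longrightarrow> Comp C f h = Comp C g k \<Longrightarrow>
        \<exists>!u. u \<in> Hom C V W \<and> Comp C a u = h \<and> Comp C b u = k"
    using pb unfolding is_pullback_def by blast+
  have fa: "Comp C f a \<in> Hom C W Y" using Comp_Hom[OF C H(1) H(3)] .
  show ?thesis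
    unfolding is_limit_def
  proof (intro conjI allI impI)
    show "is_cone cospan C (cospan_diagram C X Z Y f g) W
      (\<lambda>i. if i = 0 then a else if i = 1 then b else Comp C f a)"
      using H Hom_obj[OF C H(1)] fa Comp_Ident(2)[OF C H(1)] Comp_Ident(2)[OF C H(2)]
        Comp_Ident(2)[OF C fa]
      unfolding is_cone_def by (auto simp: cospan_def cospan_diagram_def)
  next
    fix V q assume q: "is_cone cospan C (cospan_diagram C X Z Y f g) V q"
    have q01: "q 0 \<in> Hom C V X" "q 1 \<in> Hom C V Z" "Comp C f (q 0) = q 2" "Comp C g (q 1) = q 2"
      using q unfolding is_cone_def by (auto simp: cospan_def cospan_diagram_def)
    have *: "(u \<in> Hom C V W \<and> (\<forall>i\<in>Obj cospan. Comp C (if i = 0 then a else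
      if i = 1 then b else Comp C f a) u = q i))
      \<longleftrightarrow> (u \<in> Hom C V W \<and> Comp C a u = q 0 \<and> Comp C b u = q 1)" for u
      using Comp_assoc[OF C _ H(1) H(3), of u V] q01(3) by (auto simp: cospan_def)
    show "\<exists>!u. u \<in> Hom C V W \<and> (\<forall>i\<in>Obj cospan. Comp C (if i = 0 then a else
      if i = 1 then b else Comp C f a) u = q i)"
      unfolding * using un[OF q01(1,2)] q01(3,4) by simp
  qed
qed

lemma is_pullback_of_limit:
  assumes C: "category C" and D: "is_functor cospan C D" and lim: "is_limit cospan C D W p"
  shows "is_pullback C W (FObj D 0) (FObj D 1) (FObj D 2) (p 0) (p 1) (FArr D 3) (FArr D 4)"
proof -
  have cone: "W \<in> Obj C" "p 0 \<in> Hom C W (FObj D 0)" "p 1 \<in> Hom C W (FObj D 1)"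
    "p 2 \<in> Hom C W (FObj D 2)"
    "Comp C (FArr D 3) (p 0) = p 2" "Comp C (FArr D 4) (p 1) = p 2"
    using lim unfolding is_limit_def is_cone_def by (auto simp: cospan_def)
  have D34: "FArr D 3 \<in> Hom C (FObj D 0) (FObj D 2)" "FArr D 4 \<in> Hom C (FObj D 1) (FObj D 2)"
    and Did: "FArr D 0 = Ident C (FObj D 0)" "FArr D 1 = Ident C (FObj D 1)"
      "FArr D 2 = Ident C (FObj D 2)"
    using D unfolding is_functor_def by (auto simp: cospan_def)
  show ?thesis unfolding is_pullback_def
  proof (intro conjI allI impI)
    fix V h k assume h: "h \<in> Hom C V (FObj D 0)" and k: "k \<in> Hom C V (FObj D 1)"
      and e: "Comp C (FArr D 3) h = Comp C (FArr D 4) k"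
    define q where "q = (\<lambda>i::nat. if i = 0 then h else if i = 1 then k else Comp C (FArr D 3) h)"
    have h3: "Comp C (FArr D 3) h \<in> Hom C V (FObj D 2)" using Comp_Hom[OF C h D34(1)] .
    have "is_cone cospan C D V q"
      using h k h3 e Hom_obj(1)[OF C h] Did Comp_Ident(2)[OF C h] Comp_Ident(2)[OF C k]
        Comp_Ident(2)[OF C h3]
      unfolding is_cone_def q_def by (auto simp: cospan_def)
    then have ex: "\<exists>!u. u \<in> Hom C V W \<and> (\<forall>i\<in>Obj cospan. Comp C (p i) u = q i)"
      using lim unfolding is_limit_def by blast
    have "Comp C (p 2) u = Comp C (FArr D 3) (Comp C (p 0) u)" if "u \<in> Hom C V W" for u
      using Comp_assoc[OF C that cone(2) D34(1)] cone(5) by simp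
    then have "(u \<in> Hom C V W \<and> (\<forall>i\<in>Obj cospan. Comp C (p i) u = q i)) \<longleftrightarrow>
      (u \<in> Hom C V W \<and> Comp C (p 0) u = h \<and> Comp C (p 1) u = k)" for u
      by (auto simp: cospan_def q_def)
    with ex show "\<exists>!u. u \<in> Hom C V W \<and> Comp C (p 0) u = h \<and> Comp C (p 1) u = k" by simp
  qed (use cone D34 in auto)
qed

lemma preserves_pullback:
  assumes A: "category A" and B: "category B" and F: "is_functor A B F"
    and pres: "preserves_finite_limits A B F" and pb: "is_pullback A W X Z Y a b f g"
  shows "is_pullback B (FObj F W) (FObj F X) (FObj F Z) (FObj F Y) (FArr F a) (FArr F b) (FArr F f)
    (FArr F g)"
proof -
  let ?D = "cospan_diagram A X Z Y f g"
  have H: "f \<in> Hom A X Y" "g \<in> Hom A Z Y" using pb unfolding is_pullback_def by blast+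
  have D: "is_functor cospan A ?D" using cospan_diagram_functor[OF A H] .
  have FD: "is_functor cospan B (comp_functor F ?D)"
    using D F unfolding is_functor_def comp_functor_def Hom_def by simp
  have fin: "finite (Obj cospan)" "finite (Arr cospan)" by (auto simp: cospan_def)
  have lim: "is_limit cospan B (comp_functor F ?D) (FObj F W)
    (\<lambda>i. FArr F (if i = 0 then a else if i = 1 then b else Comp A f a))"
    using pres fin category_cospan D is_limit_cospan_diagram[OF A pb]
    unfolding preserves_finite_limits_def by blast
  show ?thesis
    using is_pullback_of_limit[OF B FD lim] by (simp add: comp_functor_def cospan_diagram_def)
qed

lemma is_cone_image:
  assumes K: "category K" and F: "is_functor A B F" and D: "is_functor K A D"
    and cone: "is_cone K A D X p"
  shows "is_cone K B (comp_functor F D) (FObj F X) (\<lambda>i. FArr F (p i))"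
proof -
  have pH: "p i \<in> Hom A X (FObj D i)" if "i \<in> Obj K" for i
    using cone that by (simp add: is_cone_def)
  have DH: "FArr D k \<in> Hom A (FObj D (Dom K k)) (FObj D (Cod K k))" if "k \<in> Arr K" for k
    using D that by (simp add: is_functor_def)
  have KD: "Dom K k \<in> Obj K" if "k \<in> Arr K" for k using K that by (simp add: category_def)
  show ?thesis
    unfolding is_cone_def
  proof (intro conjI ballI)
    show "FObj F X \<in> Obj B" using F cone by (simp add: is_functor_def is_cone_def)
    show "FArr F (p i) \<in> Hom B (FObj F X) (FObj (comp_functor F D) i)" if "i \<in> Obj K" for i
      using is_functor_Hom[OF F pH[OF that]] by (simp add: comp_functor_def)
    show "Comp B (FArr (comp_functor F D) k) (FArr F (p (Dom K k))) = FArr F (p (Cod K k))"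
      if k: "k \<in> Arr K" for k
      using is_functor_Comp[OF F pH[OF KD[OF k]] DH[OF k]] cone k
        by (simp add: is_cone_def comp_functor_def)
  qed
qed

section \<open>Presheaves and their morphisms\<close>

lemma PiE_PiE_eqI:
  assumes f: "f \<in> (\<Pi>\<^sub>E x\<in>A. B x \<rightarrow>\<^sub>E C x)" and g: "g \<in> (\<Pi>\<^sub>E x\<in>A. B x \<rightarrow>\<^sub>E C x)"
    and eq: "\<And>x y. x \<in> A \<Longrightarrow> y \<in> B x \<Longrightarrow> f x y = g x y"
  shows "f = g"
proof (rule PiE_ext[OF f g])
  fix x assume x: "x \<in> A"
  show "f x = g x" by (rule PiE_ext[OF PiE_mem[OF f x] PiE_mem[OF g x] eq[OF x]])
qed

lemma NatT_app: "\<eta> \<in> NatT C P Q \<Longrightarrow> X \<in> Obj C \<Longrightarrow> p \<in> Ev P X \<Longrightarrow> \<eta> X p \<in> Ev Q X"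
  by (auto simp: NatT_def PiE_def Pi_def)

lemma NatT_nat: "\<eta> \<in> NatT C P Q \<Longrightarrow> f \<in> Arr C \<Longrightarrow> Cod C f = X \<Longrightarrow> p \<in> Ev P X \<Longrightarrow>
    \<eta> (Dom C f) (Res P f p) = Res Q f (\<eta> X p)"
  by (auto simp: NatT_def)

lemma NatT_eqI:
  assumes "\<eta> \<in> NatT C P Q" "\<theta> \<in> NatT C P Q" "\<And>X p. X \<in> Obj C \<Longrightarrow> p \<in> Ev P X \<Longrightarrow> \<eta> X p = \<theta> X p"
  shows "\<eta> = \<theta>"
proof -
  have "\<eta> \<in> (\<Pi>\<^sub>E X\<in>Obj C. Ev P X \<rightarrow>\<^sub>E Ev Q X)" "\<theta> \<in> (\<Pi>\<^sub>E X\<in>Obj C. Ev P X \<rightarrow>\<^sub>E Ev Q X)"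
    using assms by (auto simp: NatT_def)
  then show ?thesis using assms(3) by (rule PiE_PiE_eqI)
qed

definition mk_nat :: "('o, 'm) cat \<Rightarrow> ('o, 'm, 'v) presheaf \<Rightarrow> ('o \<Rightarrow> 'v \<Rightarrow> 'w) \<Rightarrow> 'o \<Rightarrow> 'v \<Rightarrow> 'w" where
  "mk_nat C P \<eta> = (\<lambda>X\<in>Obj C. \<lambda>p\<in>Ev P X. \<eta> X p)"

lemma mk_nat_app [simp]: "X \<in> Obj C \<Longrightarrow> p \<in> Ev P X \<Longrightarrow> mk_nat C P \<eta> X p = \<eta> X p"
  by (simp add: mk_nat_def)

lemma nat_comp_app [simp]: "X \<in> Obj C \<Longrightarrow> p \<in> Ev P X \<Longrightarrow> nat_comp C P \<theta> \<eta> X p = \<theta> X (\<eta> X p)"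
  by (simp add: nat_comp_def)

lemma nat_id_app [simp]: "X \<in> Obj C \<Longrightarrow> p \<in> Ev P X \<Longrightarrow> nat_id C P X p = p"
  by (simp add: nat_id_def)

locale site_cat =
  fixes C :: "('o, 'm) cat"
  assumes category: "category C"
begin

abbreviation comp (infixl "\<odot>" 70) where "g \<odot> f \<equiv> Comp C g f"

lemma Dom_obj [simp]: "f \<in> Arr C \<Longrightarrow> Dom C f \<in> Obj C"
  and Cod_obj [simp]: "f \<in> Arr C \<Longrightarrow> Cod C f \<in> Obj C"
  and comp_arr [simp]: "f \<in> Arr C \<Longrightarrow> g \<in> Arr C \<Longrightarrow> Cod C g = Dom C f \<Longrightarrow> f \<odot> g \<in> Arr C"
  and Dom_comp [simp]: "f \<in> Arr C \<Longrightarrow> g \<in> Arr C \<Longrightarrow> Cod C g = Dom C f \<Longrightarrow> Dom C (f \<odot> g) = Dom C g"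
  and Cod_comp [simp]: "f \<in> Arr C \<Longrightarrow> g \<in> Arr C \<Longrightarrow> Cod C g = Dom C f \<Longrightarrow> Cod C (f \<odot> g) = Cod C f"
  and comp_assoc [simp]: "f \<in> Arr C \<Longrightarrow> g \<in> Arr C \<Longrightarrow> h \<in> Arr C \<Longrightarrow> Cod C g = Dom C f \<Longrightarrow>
    Cod C h = Dom C g \<Longrightarrow> (f \<odot> g) \<odot> h = f \<odot> (g \<odot> h)"
  and Ident_arr [simp]: "X \<in> Obj C \<Longrightarrow> Ident C X \<in> Arr C"
  and Dom_Ident [simp]: "X \<in> Obj C \<Longrightarrow> Dom C (Ident C X) = X"
  and Cod_Ident [simp]: "X \<in> Obj C \<Longrightarrow> Cod C (Ident C X) = X"
  and comp_Ident [simp]: "f \<in> Arr C \<Longrightarrow> Dom C f = X \<Longrightarrow> f \<odot> Ident C X = f"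
  and Ident_comp [simp]: "f \<in> Arr C \<Longrightarrow> Cod C f = X \<Longrightarrow> Ident C X \<odot> f = f"
  using category by (auto simp: category_def Hom_def)

lemma Res_in: "is_presheaf C P \<Longrightarrow> f \<in> Arr C \<Longrightarrow> Dom C f = Y \<Longrightarrow> p \<in> Ev P (Cod C f) \<Longrightarrow> Res P f p \<in> Ev P Y"
  by (auto simp: is_presheaf_def PiE_def Pi_def)

lemma Res_Ident: "is_presheaf C P \<Longrightarrow> X \<in> Obj C \<Longrightarrow> p \<in> Ev P X \<Longrightarrow> Res P (Ident C X) p = p"
  by (auto simp: is_presheaf_def)

lemma Res_comp: "is_presheaf C P \<Longrightarrow> f \<in> Arr C \<Longrightarrow> g \<in> Arr C \<Longrightarrow> Cod C g = Dom C f \<Longrightarrow>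
    p \<in> Ev P (Cod C f) \<Longrightarrow> Res P (f \<odot> g) p = Res P g (Res P f p)"
  by (auto simp: is_presheaf_def)

lemmas Res_simps [simp] = Res_in Res_Ident Res_comp

lemma is_presheafI:
  assumes "P = \<lparr>Ev = (\<lambda>X\<in>Obj C. E X), Res = (\<lambda>f\<in>Arr C. \<lambda>p\<in>E (Cod C f). r f p)\<rparr>"
    and "\<And>f p. f \<in> Arr C \<Longrightarrow> p \<in> E (Cod C f) \<Longrightarrow> r f p \<in> E (Dom C f)"
    and "\<And>X p. X \<in> Obj C \<Longrightarrow> p \<in> E X \<Longrightarrow> r (Ident C X) p = p"
    and "\<And>f g p. f \<in> Arr C \<Longrightarrow> g \<in> Arr C \<Longrightarrow> Cod C g = Dom C f \<Longrightarrow> p \<in> E (Cod C f) \<Longrightarrow>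
      r (f \<odot> g) p = r g (r f p)"
  shows "is_presheaf C P"
  using assms(2-4) unfolding is_presheaf_def assms(1) by simp metis

lemma mk_nat_NatT:
  assumes "\<And>X p. X \<in> Obj C \<Longrightarrow> p \<in> Ev P X \<Longrightarrow> \<eta> X p \<in> Ev Q X"
    and "\<And>f p. f \<in> Arr C \<Longrightarrow> p \<in> Ev P (Cod C f) \<Longrightarrow> \<eta> (Dom C f) (Res P f p) = Res Q f (\<eta> (Cod C f) p)"
    and "is_presheaf C P"
  shows "mk_nat C P \<eta> \<in> NatT C P Q"
  using assms by (auto simp: NatT_def mk_nat_def)

lemma nat_comp_NatT:
  assumes "\<eta> \<in> NatT C P Q" "\<theta> \<in> NatT C Q R" "is_presheaf C P"
  shows "nat_comp C P \<theta> \<eta> \<in> NatT C P R"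
proof -
  have "nat_comp C P \<theta> \<eta> = mk_nat C P (\<lambda>X p. \<theta> X (\<eta> X p))" by (simp add: nat_comp_def mk_nat_def)
  then show ?thesis
    using assms by (auto intro!: mk_nat_NatT simp: NatT_app NatT_nat)
qed

lemma nat_id_NatT: "is_presheaf C P \<Longrightarrow> nat_id C P \<in> NatT C P P"
  by (auto simp: NatT_def nat_id_def)

lemma psh_cat_simps [simp]:
  "Obj (psh_cat U C) = presheaves U C" "Dom (psh_cat U C) (P, \<eta>, Q) = P"
    "Cod (psh_cat U C) (P, \<eta>, Q) = Q"
  "Ident (psh_cat U C) P = (P, nat_id C P, P)"
  "Comp (psh_cat U C) (Q', \<theta>, R) (P, \<eta>, Q) = (P, nat_comp C P \<theta> \<eta>, R)"
  by (auto simp: psh_cat_def)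

lemma Hom_psh_cat: "a \<in> Hom (psh_cat U C) P Q \<longleftrightarrow>
    P \<in> presheaves U C \<and> Q \<in> presheaves U C \<and> (\<exists>\<eta>\<in>NatT C P Q. a = (P, \<eta>, Q))"
  by (auto simp: Hom_def psh_cat_def)

lemma presheaves_D: "P \<in> presheaves U C \<Longrightarrow> is_presheaf C P"
  by (simp add: presheaves_def)

lemma category_psh_cat: "category (psh_cat U C)"
proof -
  have arr: "a \<in> Arr (psh_cat U C) \<Longrightarrow> \<exists>P \<eta> Q. a = (P, \<eta>, Q) \<and> P \<in> presheaves U C \<and>
    Q \<in> presheaves U C \<and> \<eta> \<in> NatT C P Q" for a
    by (auto simp: psh_cat_def)
  show ?thesis
    unfolding category_def
  proof (intro conjI ballI impI)
    fix a assume "a \<in> Arr (psh_cat U C)"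
    then obtain P \<eta> Q where a: "a = (P, \<eta>, Q)" and P: "P \<in> presheaves U C"
      and Q: "Q \<in> presheaves U C" and e: "\<eta> \<in> NatT C P Q"
      using arr by blast
    note psh = presheaves_D[OF P] presheaves_D[OF Q]
    show "Dom (psh_cat U C) a \<in> Obj (psh_cat U C)" "Cod (psh_cat U C) a \<in> Obj (psh_cat U C)"
      using a P Q by auto
    have "nat_comp C P \<eta> (nat_id C P) = \<eta>" "nat_comp C P (nat_id C Q) \<eta> = \<eta>"
      using e psh by (auto intro!: NatT_eqI[of _ C P Q] nat_comp_NatT nat_id_NatT simp: NatT_app)
    then show "Comp (psh_cat U C) a (Ident (psh_cat U C) (Dom (psh_cat U C) a)) = a"
      "Comp (psh_cat U C) (Ident (psh_cat U C) (Cod (psh_cat U C) a)) a = a"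
      using a by auto
    fix b assume "b \<in> Arr (psh_cat U C)" "Dom (psh_cat U C) b = Cod (psh_cat U C) a"
    then obtain \<theta> R where b: "b = (Q, \<theta>, R)" and R: "R \<in> presheaves U C" and t: "\<theta> \<in> NatT C Q R"
      using arr[of b] a by auto
    show "Comp (psh_cat U C) b a \<in> Hom (psh_cat U C) (Dom (psh_cat U C) a) (Cod (psh_cat U C) b)"
      using a b P R nat_comp_NatT[OF e t psh(1)] by (auto simp: Hom_psh_cat)
    fix c assume "c \<in> Arr (psh_cat U C)" "Dom (psh_cat U C) c = Cod (psh_cat U C) b"
    then obtain \<kappa> S where c: "c = (R, \<kappa>, S)" and t2: "\<kappa> \<in> NatT C R S"
      using arr[of c] b by auto
    have "nat_comp C P \<kappa> (nat_comp C P \<theta> \<eta>) = nat_comp C P (nat_comp C Q \<kappa> \<theta>) \<eta>"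
    proof (rule NatT_eqI)
      show "nat_comp C P \<kappa> (nat_comp C P \<theta> \<eta>) \<in> NatT C P S"
        by (rule nat_comp_NatT[OF nat_comp_NatT[OF e t psh(1)] t2 psh(1)])
      show "nat_comp C P (nat_comp C Q \<kappa> \<theta>) \<eta> \<in> NatT C P S"
        by (rule nat_comp_NatT[OF e nat_comp_NatT[OF t t2 psh(2)] psh(1)])
    qed (use e in \<open>auto simp: NatT_app\<close>)
    then show "Comp (psh_cat U C) c (Comp (psh_cat U C) b a) =
      Comp (psh_cat U C) (Comp (psh_cat U C) c b) a"
      using a b c by auto
  next
    fix P assume "P \<in> Obj (psh_cat U C)"
    then show "Ident (psh_cat U C) P \<in> Hom (psh_cat U C) P P"
      using nat_id_NatT[OF presheaves_D] by (auto simp: Hom_psh_cat)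
  qed
qed

lemma NatT_inverse:
  assumes e: "\<eta> \<in> NatT C P Q" and P: "is_presheaf C P" and Q: "is_presheaf C Q"
    and bij: "\<And>X. X \<in> Obj C \<Longrightarrow> bij_betw (\<eta> X) (Ev P X) (Ev Q X)"
  shows "\<exists>\<theta>\<in>NatT C Q P. \<forall>X\<in>Obj C. (\<forall>p\<in>Ev P X. \<theta> X (\<eta> X p) = p) \<and> (\<forall>q\<in>Ev Q X. \<eta> X (\<theta> X q) = q)"
proof (intro bexI[of _ "mk_nat C Q (\<lambda>X. inv_into (Ev P X) (\<eta> X))"] ballI conjI)
  have inv: "inv_into (Ev P X) (\<eta> X) q \<in> Ev P X" "\<eta> X (inv_into (Ev P X) (\<eta> X) q) = q"
    if "X \<in> Obj C" "q \<in> Ev Q X" for X q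
    using bij[OF that(1)] that(2) by (auto simp: bij_betw_def inv_into_into f_inv_into_f)
  have inv2: "inv_into (Ev P X) (\<eta> X) (\<eta> X p) = p" if "X \<in> Obj C" "p \<in> Ev P X" for X p
    using bij[OF that(1)] that(2) by (auto simp: bij_betw_def)
  show "mk_nat C Q (\<lambda>X. inv_into (Ev P X) (\<eta> X)) \<in> NatT C Q P"
  proof (rule mk_nat_NatT[OF inv(1) _ Q])
    fix f q assume f: "f \<in> Arr C" and q: "q \<in> Ev Q (Cod C f)"
    let ?p = "inv_into (Ev P (Cod C f)) (\<eta> (Cod C f)) q"
    have p: "?p \<in> Ev P (Cod C f)" "\<eta> (Cod C f) ?p = q" using inv[OF _ q] f by auto
    have "Res Q f q = \<eta> (Dom C f) (Res P f ?p)" using NatT_nat[OF e f refl p(1)] p(2) by simp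
    then show "inv_into (Ev P (Dom C f)) (\<eta> (Dom C f)) (Res Q f q) = Res P f ?p"
      using inv2 f p(1) P by simp
  qed
  fix X assume X: "X \<in> Obj C"
  show "mk_nat C Q (\<lambda>X. inv_into (Ev P X) (\<eta> X)) X (\<eta> X p) = p" if "p \<in> Ev P X" for p
    using inv2[OF X that] X that e by (simp add: NatT_app)
  show "\<eta> X (mk_nat C Q (\<lambda>X. inv_into (Ev P X) (\<eta> X)) X q) = q" if "q \<in> Ev Q X" for q
    using inv[OF X that] X that by simp
qed

lemma is_iso_psh_catI:
  assumes e: "\<eta> \<in> NatT C P Q" and P: "P \<in> presheaves U C" and Q: "Q \<in> presheaves U C"
    and bij: "\<And>X. X \<in> Obj C \<Longrightarrow> bij_betw (\<eta> X) (Ev P X) (Ev Q X)"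
  shows "is_iso (psh_cat U C) (P, \<eta>, Q)"
proof -
  note psh = presheaves_D[OF P] presheaves_D[OF Q]
  obtain \<theta> where t: "\<theta> \<in> NatT C Q P" and inv: "\<And>X p. X \<in> Obj C \<Longrightarrow> p \<in> Ev P X \<Longrightarrow> \<theta> X (\<eta> X p) = p"
    "\<And>X q. X \<in> Obj C \<Longrightarrow> q \<in> Ev Q X \<Longrightarrow> \<eta> X (\<theta> X q) = q"
    using NatT_inverse[OF e psh bij] by blast
  have "nat_comp C P \<theta> \<eta> = nat_id C P"
    using e t inv psh by (intro NatT_eqI[of _ C P P]) (auto intro: nat_comp_NatT nat_id_NatT)
  moreover have "nat_comp C Q \<eta> \<theta> = nat_id C Q"
    using e t inv psh by (intro NatT_eqI[of _ C Q Q]) (auto intro: nat_comp_NatT nat_id_NatT)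
  ultimately show ?thesis
    using e t P Q by (intro is_isoI[of _ _ P Q "(Q, \<theta>, P)"]) (auto simp: Hom_psh_cat)
qed

lemma is_iso_psh_catD:
  assumes iso: "is_iso (psh_cat U C) (P, \<eta>, Q)" and X: "X \<in> Obj C"
  shows "bij_betw (\<eta> X) (Ev P X) (Ev Q X)"
proof -
  have e: "(P, \<eta>, Q) \<in> Hom (psh_cat U C) P Q" using iso by (auto simp: is_iso_def Hom_def)
  from is_isoE[OF iso e] obtain b where b: "b \<in> Hom (psh_cat U C) Q P"
    "Comp (psh_cat U C) b (P, \<eta>, Q) = Ident (psh_cat U C) P"
    "Comp (psh_cat U C) (P, \<eta>, Q) b = Ident (psh_cat U C) Q" .
  then obtain \<theta> where t: "\<theta> \<in> NatT C Q P" "b = (Q, \<theta>, P)" by (auto simp: Hom_psh_cat)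
  have e': "\<eta> \<in> NatT C P Q" using e by (auto simp: Hom_psh_cat)
  have eqs: "nat_comp C P \<theta> \<eta> = nat_id C P" "nat_comp C Q \<eta> \<theta> = nat_id C Q" using b t by auto
  have "\<theta> X (\<eta> X p) = p" if "p \<in> Ev P X" for p
    using fun_cong[OF fun_cong[OF eqs(1)], of X p] X that by simp
  moreover have "\<eta> X (\<theta> X q) = q" if "q \<in> Ev Q X" for q
    using fun_cong[OF fun_cong[OF eqs(2)], of X q] X that by simp
  ultimately show ?thesis
    using X e' t(1) by (intro bij_betw_byWitness[of _ "\<theta> X"]) (auto simp: NatT_app)
qed

text \<open>Allows presheaves to be built on any type of elements, and smallness to be checked afterwards.\<close>

lemma encode_presheaf:
  fixes U :: "'v set set" and P :: "('o, 'm, 'w) presheaf"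
  assumes P: "is_presheaf C P" and small: "\<And>X. X \<in> Obj C \<Longrightarrow> small_set U (Ev P X)"
  obtains P' \<theta> where "P' \<in> presheaves U C" "\<theta> \<in> NatT C P P'"
    "\<And>X. X \<in> Obj C \<Longrightarrow> bij_betw (\<theta> X) (Ev P X) (Ev P' X)"
proof -
  have "\<forall>X\<in>Obj C. \<exists>f :: 'w \<Rightarrow> 'v. inj_on f (Ev P X) \<and> f ` Ev P X \<in> U"
    using small by (auto simp: small_set_def)
  then obtain e :: "'o \<Rightarrow> 'w \<Rightarrow> 'v" where e: "\<And>X. X \<in> Obj C \<Longrightarrow> inj_on (e X) (Ev P X)"
    "\<And>X. X \<in> Obj C \<Longrightarrow> e X ` Ev P X \<in> U" by metis
  define d where "d X = inv_into (Ev P X) (e X)" for X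
  have d: "d X (e X p) = p" if "X \<in> Obj C" "p \<in> Ev P X" for X p
    using e(1) that by (simp add: d_def)
  define P' where "P' = \<lparr>Ev = (\<lambda>X\<in>Obj C. e X ` Ev P X),
    Res = (\<lambda>f\<in>Arr C. \<lambda>q\<in>e (Cod C f) ` Ev P (Cod C f). e (Dom C f) (Res P f (d (Cod C f) q)))\<rparr>"
  have "is_presheaf C P'"
    by (rule is_presheafI[OF P'_def]) (use P d in auto)
  moreover have EvP': "Ev P' X = e X ` Ev P X" if "X \<in> Obj C" for X using that by (simp add: P'_def)
  ultimately have "P' \<in> presheaves U C" using e(2) by (simp add: presheaves_def)
  moreover have "mk_nat C P e \<in> NatT C P P'"
    by (rule mk_nat_NatT) (use P d in \<open>auto simp: P'_def\<close>)
  moreover have "bij_betw (mk_nat C P e X) (Ev P X) (Ev P' X)" if X: "X \<in> Obj C" for X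
    using e(1)[OF X] EvP'[OF X] X by (subst bij_betw_cong[of _ _ "e X"]) (auto simp: bij_betw_def)
  ultimately show thesis by (rule that)
qed

section \<open>Sieves as sets of arrows\<close>

definition is_sieve :: "'o \<Rightarrow> 'm set \<Rightarrow> bool" where
  "is_sieve X S \<longleftrightarrow> X \<in> Obj C \<and> (\<forall>f\<in>S. f \<in> Arr C \<and> Cod C f = X \<and>
     (\<forall>g\<in>Arr C. Cod C g = Dom C f \<longrightarrow> f \<odot> g \<in> S))"

definition max_sieve :: "'o \<Rightarrow> 'm set" where
  "max_sieve X = {f \<in> Arr C. Cod C f = X}"

definition pb :: "'m \<Rightarrow> 'm set \<Rightarrow> 'm set" where
  "pb x S = {f \<in> Arr C. Cod C f = Dom C x \<and> x \<odot> f \<in> S}"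

lemma is_sieveI:
  assumes "X \<in> Obj C" "\<And>f. f \<in> S \<Longrightarrow> f \<in> Arr C" "\<And>f. f \<in> S \<Longrightarrow> Cod C f = X"
    "\<And>f g. f \<in> S \<Longrightarrow> g \<in> Arr C \<Longrightarrow> Cod C g = Dom C f \<Longrightarrow> f \<odot> g \<in> S"
  shows "is_sieve X S"
  using assms by (auto simp: is_sieve_def)

lemma is_sieveD: 
  assumes "is_sieve X S"
  shows "X \<in> Obj C" "f \<in> S \<Longrightarrow> f \<in> Arr C" "f \<in> S \<Longrightarrow> Cod C f = X"
    "f \<in> S \<Longrightarrow> g \<in> Arr C \<Longrightarrow> Cod C g = Dom C f \<Longrightarrow> f \<odot> g \<in> S"
  using assms by (auto simp: is_sieve_def)

lemma is_sieve_pb: "is_sieve X S \<Longrightarrow> x \<in> Arr C \<Longrightarrow> Cod C x = X \<Longrightarrow> is_sieve (Dom C x) (pb x S)"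
  by (auto simp: is_sieve_def pb_def simp flip: comp_assoc)

lemma pb_comp: "x \<in> Arr C \<Longrightarrow> y \<in> Arr C \<Longrightarrow> Cod C y = Dom C x \<Longrightarrow> pb (x \<odot> y) S = pb y (pb x S)"
  by (auto simp: pb_def)

lemma pb_Ident: "is_sieve X S \<Longrightarrow> pb (Ident C X) S = S"
  by (auto simp: pb_def is_sieve_def)

lemma pb_mem: "is_sieve X S \<Longrightarrow> f \<in> S \<Longrightarrow> pb f S = max_sieve (Dom C f)"
  by (auto simp: pb_def is_sieve_def max_sieve_def)

lemma pb_max: "x \<in> Arr C \<Longrightarrow> Cod C x = X \<Longrightarrow> pb x (max_sieve X) = max_sieve (Dom C x)"
  by (auto simp: pb_def max_sieve_def)

definition sieve_arrows :: "('o, 'm, 'm) presheaf \<Rightarrow> 'm set" where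
  "sieve_arrows K = {f \<in> Arr C. f \<in> Ev K (Dom C f)}"

definition sieve_presheaf :: "'o \<Rightarrow> 'm set \<Rightarrow> ('o, 'm, 'm) presheaf" where
  "sieve_presheaf X S = sub_on C (yoneda C X) (\<lambda>Y. {f \<in> S. Dom C f = Y})"

lemma yoneda_simps: "Y \<in> Obj C \<Longrightarrow> Ev (yoneda C X) Y = Hom C Y X"
  "f \<in> Arr C \<Longrightarrow> g \<in> Hom C (Cod C f) X \<Longrightarrow> Res (yoneda C X) f g = g \<odot> f"
  by (auto simp: yoneda_def)

lemma sieve_presheaf_simps:
  "Y \<in> Obj C \<Longrightarrow> Ev (sieve_presheaf X S) Y = {f \<in> S. Dom C f = Y}"
  "f \<in> Arr C \<Longrightarrow> g \<in> S \<Longrightarrow> Dom C g = Cod C f \<Longrightarrow> is_sieve X S \<Longrightarrow> Res (sieve_presheaf X S) f g = g \<odot> f"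
  by (auto simp: sieve_presheaf_def sub_on_def yoneda_simps Hom_def is_sieve_def)

lemma is_presheaf_sieve: "is_sieve X S \<Longrightarrow> is_presheaf C (sieve_presheaf X S)"
  unfolding sieve_presheaf_def sub_on_def
  by (rule is_presheafI[OF refl]) (auto simp: yoneda_simps is_sieve_def Hom_def)

lemma sieve_presheaf_sieves: "is_sieve X S \<Longrightarrow> (X, sieve_presheaf X S) \<in> sieves C"
  using is_presheaf_sieve[of X S]
  by (auto simp: sieves_def subpresheaf_def sieve_presheaf_simps yoneda_simps Hom_def is_sieve_def)

lemma sieve_arrows_sieve_presheaf: "is_sieve X S \<Longrightarrow> sieve_arrows (sieve_presheaf X S) = S"
  by (auto simp: sieve_arrows_def sieve_presheaf_simps is_sieve_def)

lemma sieves_D: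
  assumes "(X, K) \<in> sieves C"
  shows "is_presheaf C K" "X \<in> Obj C" "is_sieve X (sieve_arrows K)"
    "Y \<in> Obj C \<Longrightarrow> Ev K Y = {f \<in> sieve_arrows K. Dom C f = Y}"
    "f \<in> Arr C \<Longrightarrow> g \<in> sieve_arrows K \<Longrightarrow> Dom C g = Cod C f \<Longrightarrow> Res K f g = g \<odot> f"
proof -
  have K: "is_presheaf C K" and X: "X \<in> Obj C" and sub: "\<And>Y. Y \<in> Obj C \<Longrightarrow> Ev K Y \<subseteq> Hom C Y X"
    and res: "\<And>f p. f \<in> Arr C \<Longrightarrow> p \<in> Ev K (Cod C f) \<Longrightarrow> Res K f p = p \<odot> f"
    using assms by (auto simp: sieves_def subpresheaf_def yoneda_simps subset_iff)
  show "is_presheaf C K" "X \<in> Obj C" by fact+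
  show ev: "Ev K Y = {f \<in> sieve_arrows K. Dom C f = Y}" if "Y \<in> Obj C" for Y
    using sub[OF that] by (auto simp: sieve_arrows_def Hom_def)
  show r: "Res K f g = g \<odot> f" if "f \<in> Arr C" "g \<in> sieve_arrows K" "Dom C g = Cod C f" for f g
    using res[OF that(1), of g] that by (auto simp: sieve_arrows_def)
  show "is_sieve X (sieve_arrows K)"
  proof (rule is_sieveI[OF X])
    fix f assume f: "f \<in> sieve_arrows K"
    then show fa: "f \<in> Arr C" by (simp add: sieve_arrows_def)
    show "Cod C f = X" using f sub[OF Dom_obj[OF fa]] by (auto simp: sieve_arrows_def Hom_def)
    fix g assume g: "g \<in> Arr C" "Cod C g = Dom C f"
    have "Res K g f \<in> Ev K (Dom C g)"
      using Res_in[OF K g(1) refl] g f by (simp add: sieve_arrows_def)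
    then show "f \<odot> g \<in> sieve_arrows K" using r[OF g(1) f] g fa by (simp add: sieve_arrows_def)
  qed
qed

lemma presheaf_eqI:
  fixes P Q :: "('o, 'm, 'w) presheaf"
  assumes P: "is_presheaf C P" and Q: "is_presheaf C Q" and ev: "\<And>X. X \<in> Obj C \<Longrightarrow> Ev P X = Ev Q X"
    and res: "\<And>f p. f \<in> Arr C \<Longrightarrow> p \<in> Ev P (Cod C f) \<Longrightarrow> Res P f p = Res Q f p"
  shows "P = Q"
proof -
  have "Ev P = Ev Q"
    using P Q ev by (auto simp: is_presheaf_def intro!: extensionalityI[of _ "Obj C"])
  moreover have "Res P = Res Q"
  proof (rule PiE_PiE_eqI[OF _ _ res])
    show "Res P \<in> (\<Pi>\<^sub>E f\<in>Arr C. Ev P (Cod C f) \<rightarrow>\<^sub>E Ev P (Dom C f))"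
      using P by (simp add: is_presheaf_def)
    show "Res Q \<in> (\<Pi>\<^sub>E f\<in>Arr C. Ev P (Cod C f) \<rightarrow>\<^sub>E Ev P (Dom C f))"
      using Q \<open>Ev P = Ev Q\<close> by (simp add: is_presheaf_def)
  qed
  ultimately show ?thesis by simp
qed

lemma sieve_eqI:
  assumes "(X, K) \<in> sieves C" "(X, K') \<in> sieves C" "sieve_arrows K = sieve_arrows K'"
  shows "K = K'"
  by (rule presheaf_eqI) (use sieves_D[OF assms(1)] sieves_D[OF assms(2)] assms(3) in auto)

lemma sieve_presheaf_sieve_arrows: "(X, K) \<in> sieves C \<Longrightarrow> sieve_presheaf X (sieve_arrows K) = K"
  by (rule sieve_eqI[of X]) (auto simp: sieves_D(3) sieve_presheaf_sieves
    sieve_arrows_sieve_presheaf)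

lemma yoneda_sieve: assumes "X \<in> Obj C"
  shows "(X, yoneda C X) \<in> sieves C" "sieve_arrows (yoneda C X) = max_sieve X" 
proof -
  have "is_presheaf C (yoneda C X)"
    unfolding yoneda_def by (rule is_presheafI[OF refl]) (auto simp: Hom_def)
  then show "(X, yoneda C X) \<in> sieves C" using assms by (auto simp: sieves_def subpresheaf_def)
  show "sieve_arrows (yoneda C X) = max_sieve X"
    by (auto simp: sieve_arrows_def max_sieve_def yoneda_simps Hom_def)
qed

lemma pullback_sieve_eq:
  assumes K: "(X, K) \<in> sieves C" and x: "x \<in> Arr C" "Cod C x = X"
  shows "pullback_sieve C x K = sieve_presheaf (Dom C x) (pb x (sieve_arrows K))"
proof -
  have "{f \<in> Hom C Y (Dom C x). x \<odot> f \<in> Ev K Y} = {f \<in> pb x (sieve_arrows K). Dom C f = Y}"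
    if "Y \<in> Obj C" for Y
  proof (rule set_eqI)
    fix f
    show "f \<in> {f \<in> Hom C Y (Dom C x). x \<odot> f \<in> Ev K Y} \<longleftrightarrow> f \<in> {f \<in> pb x (sieve_arrows K). Dom C f =
      Y}"
      unfolding sieves_D(4)[OF K that] using x by (auto simp: pb_def Hom_def)
  qed
  then show ?thesis unfolding pullback_sieve_def sieve_presheaf_def sub_on_def
    by (auto intro!: restrict_ext)
qed

lemma generated_sieve_eq:
  assumes "\<And>i. i \<in> I \<Longrightarrow> x i \<in> Arr C \<and> Cod C (x i) = X"
  shows "generated_sieve C X I x =
    sieve_presheaf X {x i \<odot> f | i f. i \<in> I \<and> f \<in> Arr C \<and> Cod C f = Dom C (x i)}" (is "_ =
      sieve_presheaf X ?S")
proof -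
  have "{x i \<odot> f |i f. i \<in> I \<and> f \<in> Hom C Y (Dom C (x i))} = {f \<in> ?S. Dom C f = Y}" for Y
    using assms by (auto simp: Hom_def) blast+
  then show ?thesis unfolding generated_sieve_def sieve_presheaf_def sub_on_def by simp
qed

lemma is_sieve_generated:
  assumes "X \<in> Obj C" "\<And>i. i \<in> I \<Longrightarrow> x i \<in> Arr C \<and> Cod C (x i) = X"
  shows "is_sieve X {x i \<odot> f | i f. i \<in> I \<and> f \<in> Arr C \<and> Cod C f = Dom C (x i)}"
proof (rule is_sieveI[OF assms(1)]; clarify)
  fix i f g assume "i \<in> I" "f \<in> Arr C" "Cod C f = Dom C (x i)" "g \<in> Arr C"
    "Cod C g = Dom C (x i \<odot> f)"
  then show "\<exists>j h. x i \<odot> f \<odot> g = x j \<odot> h \<and> j \<in> I \<and> h \<in> Arr C \<and> Cod C h = Dom C (x j)"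
    using assms(2)[of i] by (intro exI[of _ i] exI[of _ "f \<odot> g"]) auto
qed (use assms(2) in auto)

end

section \<open>Matching families\<close>

context site_cat
begin

definition matching :: "('o, 'm, 'w) presheaf \<Rightarrow> 'm set \<Rightarrow> ('m \<Rightarrow> 'w) \<Rightarrow> bool" where
  "matching P S s \<longleftrightarrow> (\<forall>f\<in>S. s f \<in> Ev P (Dom C f) \<and>
     (\<forall>g\<in>Arr C. Cod C g = Dom C f \<longrightarrow> s (f \<odot> g) = Res P g (s f)))"

definition sheaf_for :: "('o, 'm, 'w) presheaf \<Rightarrow> 'o \<Rightarrow> 'm set \<Rightarrow> bool" where
  "sheaf_for P X S \<longleftrightarrow>
     (\<forall>s. matching P S s \<longrightarrow> (\<exists>!p. p \<in> Ev P X \<and> (\<forall>f\<in>S. Res P f p = s f)))"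

definition stably_sheaf_for :: "('o, 'm, 'w) presheaf \<Rightarrow> 'o \<Rightarrow> 'm set \<Rightarrow> bool" where
  "stably_sheaf_for P X S \<longleftrightarrow> (\<forall>x\<in>Arr C. Cod C x = X \<longrightarrow> sheaf_for P (Dom C x) (pb x S))"

lemma matchingD: "matching P S s \<Longrightarrow> f \<in> S \<Longrightarrow> s f \<in> Ev P (Dom C f)"
  and matching_comp: "matching P S s \<Longrightarrow> f \<in> S \<Longrightarrow> g \<in> Arr C \<Longrightarrow> Cod C g = Dom C f \<Longrightarrow>
    s (f \<odot> g) = Res P g (s f)"
  by (auto simp: matching_def)

lemma matching_restriction:
  assumes "is_presheaf C P" "is_sieve X S" "p \<in> Ev P X"
  shows "matching P S (\<lambda>f. Res P f p)"
  using assms by (auto simp: matching_def is_sieveD)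

lemma sheaf_for_eq:
  assumes "sheaf_for P X S" "is_presheaf C P" "is_sieve X S" "p \<in> Ev P X" "q \<in> Ev P X"
    "\<And>f. f \<in> S \<Longrightarrow> Res P f p = Res P f q"
  shows "p = q"
  using assms(1) matching_restriction[OF assms(2,3,5)] assms(4-6) unfolding sheaf_for_def by metis

lemma sheaf_for_ex:
  assumes "sheaf_for P X S" "matching P S s"
  obtains p where "p \<in> Ev P X" "\<And>f. f \<in> S \<Longrightarrow> Res P f p = s f"
  using assms unfolding sheaf_for_def by metis

lemma sheaf_forI:
  assumes "\<And>s. matching P S s \<Longrightarrow> \<exists>p\<in>Ev P X. \<forall>f\<in>S. Res P f p = s f"
    and "\<And>p q. p \<in> Ev P X \<Longrightarrow> q \<in> Ev P X \<Longrightarrow> (\<And>f. f \<in> S \<Longrightarrow> Res P f p = Res P f q) \<Longrightarrow> p = q"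
  shows "sheaf_for P X S"
  unfolding sheaf_for_def
proof (intro allI impI)
  fix s assume "matching P S s"
  then obtain p where p: "p \<in> Ev P X" "\<forall>f\<in>S. Res P f p = s f" using assms(1) by blast
  show "\<exists>!p. p \<in> Ev P X \<and> (\<forall>f\<in>S. Res P f p = s f)"
  proof (rule ex1I[of _ p])
    fix q assume "q \<in> Ev P X \<and> (\<forall>f\<in>S. Res P f q = s f)"
    then show "q = p" using p by - (rule assms(2), auto)
  qed (use p in auto)
qed

text \<open>A morphism from a sieve to \<open>P\<close> is a matching family, and the morphism that comes from
  \<open>p \<in> P(X)\<close> is the family of the restrictions of \<open>p\<close>.\<close>

lemma sheaf_for_bij:
  assumes K: "(X, K) \<in> sieves C" and P: "is_presheaf C P"
  shows "bij_betw (\<lambda>p. restrict_nat C K (yoneda_map C P X p)) (Ev P X) (NatT C K P)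
    \<longleftrightarrow> sheaf_for P X (sieve_arrows K)"
proof -
  let ?S = "sieve_arrows K" and ?\<Phi> = "\<lambda>p. restrict_nat C K (yoneda_map C P X p)"
  note sv = sieves_D[OF K]
  have Kp: "is_presheaf C K" and S: "is_sieve X ?S" by (rule sv)+
  note SD = is_sieveD(2-4)[OF S]
  have \<Phi>: "?\<Phi> p Y f = Res P f p" if "Y \<in> Obj C" "f \<in> Ev K Y" for p Y f
    using that SD by (auto simp: restrict_nat_def yoneda_map_def sv(4) Hom_def)
  have \<Phi>N: "?\<Phi> p \<in> NatT C K P" if p: "p \<in> Ev P X" for p
  proof -
    have "?\<Phi> p = mk_nat C K (\<lambda>Y f. Res P f p)"
      unfolding mk_nat_def using \<Phi>
      by (auto simp: restrict_nat_def fun_eq_iff)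
    then show ?thesis
      using p P Kp SD by (auto intro!: mk_nat_NatT simp: sv(4) sv(5) )
  qed
  have \<Phi>iff: "?\<Phi> p = \<nu> \<longleftrightarrow> (\<forall>f\<in>?S. Res P f p = \<nu> (Dom C f) f)" if p: "p \<in> Ev P X"
    and \<nu>: "\<nu> \<in> NatT C K P" for p \<nu>
  proof
    assume "?\<Phi> p = \<nu>"
    then show "\<forall>f\<in>?S. Res P f p = \<nu> (Dom C f) f" using \<Phi>[of "Dom C _" _ p] SD by (auto simp: sv(4))
  next
    assume *: "\<forall>f\<in>?S. Res P f p = \<nu> (Dom C f) f"
    show "?\<Phi> p = \<nu>"
      by (rule NatT_eqI[OF \<Phi>N[OF p] \<nu>]) (use * \<Phi> in \<open>auto simp: sv(4)\<close>)
  qed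
  have fam: "matching P ?S (\<lambda>f. \<nu> (Dom C f) f)" if \<nu>: "\<nu> \<in> NatT C K P" for \<nu>
    unfolding matching_def
  proof (intro ballI conjI impI)
    fix f assume f: "f \<in> ?S"
    then show "\<nu> (Dom C f) f \<in> Ev P (Dom C f)" using NatT_app[OF \<nu>] SD by (simp add: sv(4))
    fix g assume g: "g \<in> Arr C" "Cod C g = Dom C f"
    then show "\<nu> (Dom C (f \<odot> g)) (f \<odot> g) = Res P g (\<nu> (Dom C f) f)"
      using NatT_nat[OF \<nu> g, of f] f SD sv(5)[OF g(1) f] by (simp add: sv(4))
  qed
  have nat: "mk_nat C K (\<lambda>Y f. s f) \<in> NatT C K P" if "matching P ?S s" for s
    using that Kp SD by (auto intro!: mk_nat_NatT simp: matching_def sv(4,5))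
  show ?thesis
  proof
    assume bij: "bij_betw ?\<Phi> (Ev P X) (NatT C K P)"
    show "sheaf_for P X ?S"
    proof (rule sheaf_forI)
      fix s assume s: "matching P ?S s"
      let ?\<nu> = "mk_nat C K (\<lambda>Y f. s f)"
      obtain p where p: "p \<in> Ev P X" "?\<Phi> p = ?\<nu>"
        using bij nat[OF s] unfolding bij_betw_def by (metis (no_types, lifting) imageE)
      have "Res P f p = s f" if f: "f \<in> ?S" for f
        using \<Phi>iff[OF p(1) nat[OF s]] p(2) f SD by (simp add: sv(4))
      then show "\<exists>p\<in>Ev P X. \<forall>f\<in>?S. Res P f p = s f" using p(1) by blast
    next
      fix p q assume pq: "p \<in> Ev P X" "q \<in> Ev P X" and e: "\<And>f. f \<in> ?S \<Longrightarrow> Res P f p = Res P f q"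
      have "?\<Phi> p = ?\<Phi> q"
        using \<Phi>iff[OF pq(1) \<Phi>N[OF pq(2)]] e \<Phi> SD by (simp add: sv(4))
      then show "p = q" using bij pq unfolding bij_betw_def inj_on_def by blast
    qed
  next
    assume sh: "sheaf_for P X ?S"
    show "bij_betw ?\<Phi> (Ev P X) (NatT C K P)"
      unfolding bij_betw_def
    proof (intro conjI inj_onI equalityI subsetI)
      fix p q assume pq: "p \<in> Ev P X" "q \<in> Ev P X" and e: "?\<Phi> p = ?\<Phi> q"
      show "p = q"
      proof (rule sheaf_for_eq[OF sh P S pq])
        fix f assume f: "f \<in> ?S"
        then have "f \<in> Ev K (Dom C f)" "Dom C f \<in> Obj C" using SD by (auto simp: sv(4))
        then show "Res P f p = Res P f q" using \<Phi>[of "Dom C f" f p] \<Phi>[of "Dom C f" f q] e by simp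
      qed
    next
      fix \<nu> assume "\<nu> \<in> ?\<Phi> ` Ev P X"
      then show "\<nu> \<in> NatT C K P" using \<Phi>N by blast
    next
      fix \<nu> assume \<nu>: "\<nu> \<in> NatT C K P"
      obtain p where "p \<in> Ev P X" "\<And>f. f \<in> ?S \<Longrightarrow> Res P f p = \<nu> (Dom C f) f"
        using sheaf_for_ex[OF sh fam[OF \<nu>]] by metis
      then show "\<nu> \<in> ?\<Phi> ` Ev P X" using \<Phi>iff[OF _ \<nu>, of p] by (metis (no_types, lifting) imageI)
    qed
  qed
qed

lemma duality_rel_iff:
  assumes K: "(X, K) \<in> sieves C" and P: "P \<in> presheaves U C"
  shows "((X, K), P) \<in> duality_rel U C \<longleftrightarrow> stably_sheaf_for P X (sieve_arrows K)"
proof -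
  have "bij_betw (\<lambda>p. restrict_nat C (pullback_sieve C x K) (yoneda_map C P (Dom C x) p))
          (Ev P (Dom C x)) (NatT C (pullback_sieve C x K) P) \<longleftrightarrow>
            sheaf_for P (Dom C x) (pb x (sieve_arrows K))"
    if x: "x \<in> Arr C" "Cod C x = X" for x
  proof -
    have sv: "is_sieve (Dom C x) (pb x (sieve_arrows K))"
      using is_sieve_pb[OF sieves_D(3)[OF K] x] .
    show ?thesis
      unfolding pullback_sieve_eq[OF K x]
      using sheaf_for_bij[OF sieve_presheaf_sieves[OF sv] presheaves_D[OF P]]
        sieve_arrows_sieve_presheaf[OF sv] by simp
  qed
  then show ?thesis
    using K P unfolding duality_rel_def stably_sheaf_for_def by (auto simp: Hom_def)
qed

lemma stably_sheaf_for_self: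
  assumes "stably_sheaf_for P X S" "is_sieve X S" shows "sheaf_for P X S"
  using assms is_sieveD(1)[OF assms(2)] unfolding stably_sheaf_for_def
  by (metis Cod_Ident Dom_Ident Ident_arr pb_Ident)

lemma stably_sheaf_for_max:
  assumes P: "is_presheaf C P" and X: "X \<in> Obj C" shows "stably_sheaf_for P X (max_sieve X)"
proof -
  have "sheaf_for P Y (max_sieve Y)" if Y: "Y \<in> Obj C" for Y
  proof (rule sheaf_forI)
    have id: "Ident C Y \<in> max_sieve Y" using Y by (simp add: max_sieve_def)
    show "\<exists>p\<in>Ev P Y. \<forall>f\<in>max_sieve Y. Res P f p = s f" if s: "matching P (max_sieve Y) s" for s
    proof (intro bexI[of _ "s (Ident C Y)"] ballI)
      show "s (Ident C Y) \<in> Ev P Y" using matchingD[OF s id] Y by simp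
      fix f assume "f \<in> max_sieve Y"
      then have f: "f \<in> Arr C" "Cod C f = Y" by (auto simp: max_sieve_def)
      then have "s (Ident C Y \<odot> f) = Res P f (s (Ident C Y))"
        using matching_comp[OF s id f(1)] f Y by simp
      then show "Res P f (s (Ident C Y)) = s f" using f by simp
    qed
    show "p = q" if "p \<in> Ev P Y" "q \<in> Ev P Y" "\<And>f. f \<in> max_sieve Y \<Longrightarrow> Res P f p = Res P f q" for p q
      using that(3)[OF id] that(1,2) P Y by simp
  qed
  then show ?thesis by (auto simp: stably_sheaf_for_def pb_max)
qed

lemma stably_sheaf_for_pb:
  "stably_sheaf_for P X S \<Longrightarrow> x \<in> Arr C \<Longrightarrow> Cod C x = X \<Longrightarrow> stably_sheaf_for P (Dom C x) (pb x S)"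
  unfolding stably_sheaf_for_def
proof (intro ballI impI)
  fix y assume P: "\<forall>x\<in>Arr C. Cod C x = X \<longrightarrow> sheaf_for P (Dom C x) (pb x S)"
    and x: "x \<in> Arr C" "Cod C x = X" and y: "y \<in> Arr C" "Cod C y = Dom C x"
  from bspec[OF P comp_arr[OF x(1) y]]
  have "sheaf_for P (Dom C (x \<odot> y)) (pb (x \<odot> y) S)" using x y by simp
  then show "sheaf_for P (Dom C y) (pb y (pb x S))" using x y by (simp add: pb_comp)
qed

text \<open>A matching family on \<open>S'\<close> is amalgamated first over each \<open>f\<^sup>*S'\<close> with \<open>f \<in> S\<close>; by uniqueness
  these amalgams match on \<open>S\<close>,
    and their amalgam has the right restriction to \<open>g \<in> S'\<close> because it has
  so on \<open>g\<^sup>*S\<close>.\<close>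

lemma sheaf_for_trans:
  assumes P: "is_presheaf C P" and S: "is_sieve X S" and S': "is_sieve X S'"
    and stS: "stably_sheaf_for P X S"
    and stS': "\<And>f. f \<in> S \<Longrightarrow> stably_sheaf_for P (Dom C f) (pb f S')"
  shows "sheaf_for P X S'"
proof -
  note SD = is_sieveD(2-4)[OF S] and SD' = is_sieveD(2-4)[OF S']
  have svf: "is_sieve (Dom C f) (pb f S')" if "f \<in> S" for f using is_sieve_pb[OF S'] SD that by simp
  have shf: "sheaf_for P (Dom C f) (pb f S')" if "f \<in> S" for f
    using stably_sheaf_for_self[OF stS'[OF that] svf[OF that]] .
  show ?thesis
  proof (rule sheaf_forI)
    fix p q assume pq: "p \<in> Ev P X" "q \<in> Ev P X" and e: "\<And>f. f \<in> S' \<Longrightarrow> Res P f p = Res P f q"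
    show "p = q"
    proof (rule sheaf_for_eq[OF stably_sheaf_for_self[OF stS S] P S pq])
      fix f assume f: "f \<in> S"
      show "Res P f p = Res P f q"
      proof (rule sheaf_for_eq[OF shf[OF f] P svf[OF f]])
        fix g assume g: "g \<in> pb f S'"
        then show "Res P g (Res P f p) = Res P g (Res P f q)"
          using e[of "f \<odot> g"] f SD pq P by (simp add: pb_def)
      qed (use f SD pq P in auto)
    qed
  next
    fix s assume s: "matching P S' s"
    note sD = matching_comp[OF s] and sE = matchingD[OF s]
    have "\<exists>r. r \<in> Ev P (Dom C f) \<and> (\<forall>g\<in>pb f S'. Res P g r = s (f \<odot> g))" if f: "f \<in> S" for f
    proof -
      have "matching P (pb f S') (\<lambda>g. s (f \<odot> g))"
        unfolding matching_def
      proof (intro ballI conjI impI)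
        fix g assume "g \<in> pb f S'"
        then have g: "g \<in> Arr C" "Cod C g = Dom C f" "f \<odot> g \<in> S'" by (auto simp: pb_def)
        show "s (f \<odot> g) \<in> Ev P (Dom C g)" using sE[OF g(3)] g f SD by simp
        fix h assume "h \<in> Arr C" "Cod C h = Dom C g"
        then show "s (f \<odot> (g \<odot> h)) = Res P h (s (f \<odot> g))"
          using sD[OF g(3), of h] g f SD by simp
      qed
      from sheaf_for_ex[OF shf[OF f] this] show ?thesis by metis
    qed
    then obtain r where r: "\<And>f. f \<in> S \<Longrightarrow> r f \<in> Ev P (Dom C f)"
      "\<And>f g. f \<in> S \<Longrightarrow> g \<in> pb f S' \<Longrightarrow> Res P g (r f) = s (f \<odot> g)" by metis
    have "matching P S r"
      unfolding matching_def
    proof (intro ballI conjI impI)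
      fix f assume f: "f \<in> S"
      show "r f \<in> Ev P (Dom C f)" using r(1)[OF f] .
      fix g assume g: "g \<in> Arr C" "Cod C g = Dom C f"
      have fg: "f \<odot> g \<in> S" "f \<in> Arr C" using SD f g by auto
      show "r (f \<odot> g) = Res P g (r f)"
      proof (rule sheaf_for_eq[OF shf[OF fg(1)] P svf[OF fg(1)]])
        show "r (f \<odot> g) \<in> Ev P (Dom C (f \<odot> g))" using r(1)[OF fg(1)] .
        show "Res P g (r f) \<in> Ev P (Dom C (f \<odot> g))" using r(1)[OF f] P g fg by simp
        fix h assume h: "h \<in> pb (f \<odot> g) S'"
        then have h': "g \<odot> h \<in> pb f S'" "h \<in> Arr C" "Cod C h = Dom C g"
          using fg g by (auto simp: pb_def)
        show "Res P h (r (f \<odot> g)) = Res P h (Res P g (r f))"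
          using r(2)[OF fg(1) h] r(2)[OF f h'(1)] h' g fg r(1)[OF f] P by simp
      qed
    qed
    then obtain p where p: "p \<in> Ev P X" "\<And>f. f \<in> S \<Longrightarrow> Res P f p = r f"
      using sheaf_for_ex[OF stably_sheaf_for_self[OF stS S]] by metis
    have "Res P g p = s g" if g: "g \<in> S'" for g
    proof -
      have ga: "g \<in> Arr C" "Cod C g = X" using SD' g by auto
      have shg: "sheaf_for P (Dom C g) (pb g S)" using stS ga by (simp add: stably_sheaf_for_def)
      show ?thesis
      proof (rule sheaf_for_eq[OF shg P is_sieve_pb[OF S ga]])
        show "Res P g p \<in> Ev P (Dom C g)" using P p ga by simp
        show "s g \<in> Ev P (Dom C g)" using sE[OF g] .
        fix h assume "h \<in> pb g S"
        then have h: "h \<in> Arr C" "Cod C h = Dom C g" "g \<odot> h \<in> S" by (auto simp: pb_def)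
        have gh: "g \<odot> h \<in> S'" using SD'(3)[OF g h(1,2)] .
        have "Ident C (Dom C h) \<in> pb (g \<odot> h) S'" using gh h ga by (simp add: pb_def)
        from r(2)[OF h(3) this] have "r (g \<odot> h) = s (g \<odot> h)" using r(1)[OF h(3)] h ga P by simp
        then show "Res P h (Res P g p) = Res P h (s g)"
          using p(2)[OF h(3)] sD[OF g h(1,2)] P p(1) ga h by simp
      qed
    qed
    then show "\<exists>p\<in>Ev P X. \<forall>f\<in>S'. Res P f p = s f" using p(1) by blast
  qed
qed

lemma stably_sheaf_for_trans:
  assumes P: "is_presheaf C P" and S: "is_sieve X S" and S': "is_sieve X S'"
    and stS: "stably_sheaf_for P X S"
    and stS': "\<And>f. f \<in> S \<Longrightarrow> stably_sheaf_for P (Dom C f) (pb f S')"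
  shows "stably_sheaf_for P X S'"
  unfolding stably_sheaf_for_def
proof (intro ballI impI)
  fix x assume x: "x \<in> Arr C" "Cod C x = X"
  show "sheaf_for P (Dom C x) (pb x S')"
  proof (rule sheaf_for_trans[OF P is_sieve_pb[OF S x] is_sieve_pb[OF S' x] stably_sheaf_for_pb[OF
    stS x]])
    fix f assume "f \<in> pb x S"
    then have f: "f \<in> Arr C" "Cod C f = Dom C x" "x \<odot> f \<in> S" by (auto simp: pb_def)
    then show "stably_sheaf_for P (Dom C f) (pb f (pb x S'))"
      using stS'[OF f(3)] x by (simp add: pb_comp)
  qed
qed

lemma sheaf_for_iso:
  fixes P :: "('o, 'm, 'w) presheaf" and Q :: "('o, 'm, 'v) presheaf"
  assumes e: "\<eta> \<in> NatT C P Q" and P: "is_presheaf C P" and Q: "is_presheaf C Q"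
    and bij: "\<And>X. X \<in> Obj C \<Longrightarrow> bij_betw (\<eta> X) (Ev P X) (Ev Q X)"
    and S: "is_sieve X S" and sh: "sheaf_for P X S"
  shows "sheaf_for Q X S"
proof -
  obtain \<theta> where t: "\<theta> \<in> NatT C Q P" and inv: "\<And>X p. X \<in> Obj C \<Longrightarrow> p \<in> Ev P X \<Longrightarrow> \<theta> X (\<eta> X p) = p"
    "\<And>X q. X \<in> Obj C \<Longrightarrow> q \<in> Ev Q X \<Longrightarrow> \<eta> X (\<theta> X q) = q"
    using NatT_inverse[OF e P Q bij] by blast
  note SD = is_sieveD(2-4)[OF S]
  have X: "X \<in> Obj C" using is_sieveD(1)[OF S] .
  show ?thesis
  proof (rule sheaf_forI)
    fix s assume s: "matching Q S s"
    have ts: "matching P S (\<lambda>f. \<theta> (Dom C f) (s f))"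
      unfolding matching_def
    proof (intro ballI conjI impI)
      fix f assume f: "f \<in> S"
      then show "\<theta> (Dom C f) (s f) \<in> Ev P (Dom C f)"
        using NatT_app[OF t _ matchingD[OF s f]] SD by simp
      fix g assume g: "g \<in> Arr C" "Cod C g = Dom C f"
      show "\<theta> (Dom C (f \<odot> g)) (s (f \<odot> g)) = Res P g (\<theta> (Dom C f) (s f))"
        using NatT_nat[OF t g matchingD[OF s f]] matching_comp[OF s f g] SD(1)[OF f] g by simp
    qed
    obtain p where p: "p \<in> Ev P X" "\<And>f. f \<in> S \<Longrightarrow> Res P f p = \<theta> (Dom C f) (s f)"
      using sheaf_for_ex[OF sh ts] by blast
    have "Res Q f (\<eta> X p) = s f" if f: "f \<in> S" for f
    proof -
      have "Res Q f (\<eta> X p) = \<eta> (Dom C f) (Res P f p)" using NatT_nat[OF e _ _ p(1)] SD f by simp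
      then show ?thesis using p(2)[OF f] inv(2) matchingD[OF s f] SD(1)[OF f] by simp
    qed
    then show "\<exists>p\<in>Ev Q X. \<forall>f\<in>S. Res Q f p = s f" using NatT_app[OF e X p(1)] by blast
  next
    fix p q assume pq: "p \<in> Ev Q X" "q \<in> Ev Q X" and eq: "\<And>f. f \<in> S \<Longrightarrow> Res Q f p = Res Q f q"
    have "\<theta> X p = \<theta> X q"
    proof (rule sheaf_for_eq[OF sh P S])
      fix f assume f: "f \<in> S"
      then show "Res P f (\<theta> X p) = Res P f (\<theta> X q)"
        using NatT_nat[OF t _ _ pq(1), of f] NatT_nat[OF t _ _ pq(2), of f] eq[OF f] SD by simp
    qed (use NatT_app[OF t X] pq in auto)
    then show "p = q" using inv(2)[OF X] pq by metis
  qed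
qed

definition equalizer_sieve :: "('o, 'm, 'w) presheaf \<Rightarrow> 'o \<Rightarrow> 'w \<Rightarrow> 'w \<Rightarrow> 'm set" where
  "equalizer_sieve P X p q = {f \<in> Arr C. Cod C f = X \<and> Res P f p = Res P f q}"

definition lift_sieve ::
  "('o, 'm, 'w) presheaf \<Rightarrow> ('o, 'm, 'u) presheaf \<Rightarrow> ('o \<Rightarrow> 'w \<Rightarrow> 'u) \<Rightarrow> 'o \<Rightarrow> 'u \<Rightarrow> 'm set" where
  "lift_sieve P A \<eta> X a = {f \<in> Arr C. Cod C f = X \<and> (\<exists>p\<in>Ev P (Dom C f). Res A f a = \<eta> (Dom C f) p)}"

lemma is_sieve_equalizer:
  "is_presheaf C P \<Longrightarrow> X \<in> Obj C \<Longrightarrow> p \<in> Ev P X \<Longrightarrow> q \<in> Ev P X \<Longrightarrow> is_sieve X (equalizer_sieve P X p q)"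
  by (auto simp: equalizer_sieve_def is_sieve_def)

lemma is_sieve_lift:
  assumes P: "is_presheaf C P" and A: "is_presheaf C A" and e: "\<eta> \<in> NatT C P A" and X: "X \<in> Obj C"
    and a: "a \<in> Ev A X"
  shows "is_sieve X (lift_sieve P A \<eta> X a)"
proof (rule is_sieveI[OF X])
  fix f g assume f: "f \<in> lift_sieve P A \<eta> X a" and g: "g \<in> Arr C" "Cod C g = Dom C f"
  then obtain p where p: "f \<in> Arr C" "Cod C f = X" "p \<in> Ev P (Dom C f)" "Res A f a = \<eta> (Dom C f) p"
    by (auto simp: lift_sieve_def)
  then have "Res A (f \<odot> g) a = \<eta> (Dom C g) (Res P g p)"
    using NatT_nat[OF e g p(3)] A a g by simp
  then show "f \<odot> g \<in> lift_sieve P A \<eta> X a" using p g P by (auto simp: lift_sieve_def)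
qed (auto simp: lift_sieve_def)

end

section \<open>Locally bijective morphisms\<close>

locale topology = site_cat C for C :: "('o, 'm) cat" +
  fixes cov :: "'o \<Rightarrow> 'm set \<Rightarrow> bool"
  assumes cov_sieve: "cov X S \<Longrightarrow> is_sieve X S"
    and cov_max: "X \<in> Obj C \<Longrightarrow> cov X (max_sieve X)"
    and cov_pb: "cov X S \<Longrightarrow> x \<in> Arr C \<Longrightarrow> Cod C x = X \<Longrightarrow> cov (Dom C x) (pb x S)"
    and cov_local: "cov X S \<Longrightarrow> is_sieve X S' \<Longrightarrow> (\<And>f. f \<in> S \<Longrightarrow> cov (Dom C f) (pb f S')) \<Longrightarrow> cov X S'"
begin

lemma cov_mono: assumes S: "cov X S" and S': "is_sieve X S'" and sub: "S \<subseteq> S'" shows "cov X S'"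
proof (rule cov_local[OF S S'])
  fix f assume "f \<in> S"
  then show "cov (Dom C f) (pb f S')"
    using pb_mem[OF S', of f] sub cov_max is_sieveD(2)[OF S', of f] by auto
qed

lemma cov_trans:
  assumes S: "cov X S" and S': "is_sieve X S'"
    and loc: "\<And>f. f \<in> S \<Longrightarrow> \<exists>R. cov (Dom C f) R \<and> (\<forall>g\<in>R. f \<odot> g \<in> S')"
  shows "cov X S'"
proof (rule cov_local[OF S S'])
  fix f assume f: "f \<in> S"
  obtain R where R: "cov (Dom C f) R" "\<forall>g\<in>R. f \<odot> g \<in> S'" using loc[OF f] by blast
  have "f \<in> Arr C" "Cod C f = X" using is_sieveD[OF cov_sieve[OF S]] f by auto
  then show "cov (Dom C f) (pb f S')"
    using R is_sieveD[OF cov_sieve[OF R(1)]]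
      by (intro cov_mono[OF R(1) is_sieve_pb[OF S']]) (auto simp: pb_def)
qed

lemma is_sieve_Int: "is_sieve X S \<Longrightarrow> is_sieve X S' \<Longrightarrow> is_sieve X (S \<inter> S')"
  by (auto simp: is_sieve_def)

lemma cov_Int: assumes S: "cov X S" and S': "cov X S'" shows "cov X (S \<inter> S')"
proof (rule cov_trans[OF S is_sieve_Int[OF cov_sieve[OF S] cov_sieve[OF S']]])
  fix f assume f: "f \<in> S"
  have "f \<in> Arr C" "Cod C f = X" using is_sieveD[OF cov_sieve[OF S]] f by auto
  then show "\<exists>R. cov (Dom C f) R \<and> (\<forall>g\<in>R. f \<odot> g \<in> S \<inter> S')"
    using f cov_pb[OF S'] is_sieveD(4)[OF cov_sieve[OF S] f]
    by (intro exI[of _ "pb f S'"]) (auto simp: pb_def)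
qed

lemma cov_INT:
  assumes "finite A" "X \<in> Obj C" "\<And>i. i \<in> A \<Longrightarrow> cov X (S i)"
  shows "cov X ({f \<in> Arr C. Cod C f = X} \<inter> (\<Inter>i\<in>A. S i))"
  using assms
proof (induction A rule: finite_induct)
  case empty
  then show ?case using cov_max[of X] by (simp add: max_sieve_def)
next
  case (insert i A)
  have "cov X (S i \<inter> ({f \<in> Arr C. Cod C f = X} \<inter> (\<Inter>i\<in>A. S i)))"
    by (rule cov_Int) (use insert in auto)
  moreover have "S i \<inter> ({f \<in> Arr C. Cod C f = X} \<inter> (\<Inter>i\<in>A. S i)) =
    {f \<in> Arr C. Cod C f = X} \<inter> (\<Inter>i\<in>insert i A. S i)" by auto
  ultimately show ?case by simp
qed

definition sheaf :: "('o, 'm, 'w) presheaf \<Rightarrow> bool" where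
  "sheaf P \<longleftrightarrow> is_presheaf C P \<and> (\<forall>X S. cov X S \<longrightarrow> sheaf_for P X S)"

lemma sheaf_presheaf: "sheaf P \<Longrightarrow> is_presheaf C P"
  by (simp add: sheaf_def)

lemma sheaf_eq:
  assumes "sheaf P" "cov X S" "p \<in> Ev P X" "q \<in> Ev P X" "\<And>f. f \<in> S \<Longrightarrow> Res P f p = Res P f q"
  shows "p = q"
  by (rule sheaf_for_eq[OF _ _ cov_sieve[OF assms(2)] assms(3,4,5)])
    (use assms(1,2) in \<open>auto simp: sheaf_def\<close>)

lemma sheaf_ex:
  assumes "sheaf P" "cov X S" "matching P S s"
  obtains p where "p \<in> Ev P X" "\<And>f. f \<in> S \<Longrightarrow> Res P f p = s f"
  using assms by (metis sheaf_def sheaf_for_ex)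

definition locally_injective :: "('o, 'm, 'w) presheaf \<Rightarrow> ('o \<Rightarrow> 'w \<Rightarrow> 'u) \<Rightarrow> bool" where
  "locally_injective P \<eta> \<longleftrightarrow> (\<forall>X\<in>Obj C. \<forall>p\<in>Ev P X. \<forall>q\<in>Ev P X. \<eta> X p = \<eta> X q \<longrightarrow>
    cov X (equalizer_sieve P X p q))"

definition locally_surjective ::
  "('o, 'm, 'w) presheaf \<Rightarrow> ('o, 'm, 'u) presheaf \<Rightarrow> ('o \<Rightarrow> 'w \<Rightarrow> 'u) \<Rightarrow> bool" where
  "locally_surjective P A \<eta> \<longleftrightarrow> (\<forall>X\<in>Obj C. \<forall>a\<in>Ev A X. cov X (lift_sieve P A \<eta> X a))"

text \<open>Sheaves cannot tell apart elements that are locally equal.\<close>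

lemma locally_injective_image_eq:
  assumes "locally_injective P \<eta>" and Q: "sheaf Q" and ph: "\<phi> \<in> NatT C P Q"
    and "X \<in> Obj C" "p \<in> Ev P X" "q \<in> Ev P X" "\<eta> X p = \<eta> X q"
  shows "\<phi> X p = \<phi> X q"
proof (rule sheaf_eq[OF Q])
  show "cov X (equalizer_sieve P X p q)" using assms by (auto simp: locally_injective_def)
  fix f assume "f \<in> equalizer_sieve P X p q"
  then have "f \<in> Arr C" "Cod C f = X" "Res P f p = Res P f q" by (auto simp: equalizer_sieve_def)
  then show "Res Q f (\<phi> X p) = Res Q f (\<phi> X q)"
    using NatT_nat[OF ph _ _ assms(5), of f] NatT_nat[OF ph _ _ assms(6), of f] by simp
qed (use NatT_app[OF ph] assms in auto)

lemma locally_surjective_eq: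
  assumes ls: "locally_surjective P A \<eta>" and A: "is_presheaf C A" and e: "\<eta> \<in> NatT C P A"
    and Q: "sheaf Q"
    and "\<phi> \<in> NatT C A Q" "\<psi> \<in> NatT C A Q"
    and eq: "\<And>X p. X \<in> Obj C \<Longrightarrow> p \<in> Ev P X \<Longrightarrow> \<phi> X (\<eta> X p) = \<psi> X (\<eta> X p)"
  shows "\<phi> = \<psi>"
proof (rule NatT_eqI[OF assms(5,6)])
  fix X a assume X: "X \<in> Obj C" and a: "a \<in> Ev A X"
  show "\<phi> X a = \<psi> X a"
  proof (rule sheaf_eq[OF Q])
    show "cov X (lift_sieve P A \<eta> X a)" using ls X a by (auto simp: locally_surjective_def)
    fix f assume "f \<in> lift_sieve P A \<eta> X a"
    then obtain p where p: "f \<in> Arr C" "Cod C f = X" "p \<in> Ev P (Dom C f)"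
      "Res A f a = \<eta> (Dom C f) p"
      by (auto simp: lift_sieve_def)
    then show "Res Q f (\<phi> X a) = Res Q f (\<psi> X a)"
      using NatT_nat[OF assms(5) p(1,2) a] NatT_nat[OF assms(6) p(1,2) a] eq[OF _ p(3)] by simp
  qed (rule NatT_app[OF assms(5) X a], rule NatT_app[OF assms(6) X a])
qed

text \<open>An element \<open>a\<close> comes locally from elements \<open>p\<close> of \<open>P\<close>, so that the restrictions of \<open>\<psi>(a)\<close> are
  forced to be the elements \<open>\<phi>(p)\<close>. These match, since different choices of \<open>p\<close> are locally equal.\<close>

lemma extend_along_locally_bijective:
  assumes P: "is_presheaf C P" and A: "is_presheaf C A" and e: "\<eta> \<in> NatT C P A"
    and li: "locally_injective P \<eta>" and ls: "locally_surjective P A \<eta>"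
    and Q: "sheaf Q" and ph: "\<phi> \<in> NatT C P Q"
  obtains \<psi> where "\<psi> \<in> NatT C A Q" "\<And>X p. X \<in> Obj C \<Longrightarrow> p \<in> Ev P X \<Longrightarrow> \<psi> X (\<eta> X p) = \<phi> X p"
proof -
  have Qp: "is_presheaf C Q" using Q by (rule sheaf_presheaf)
  define ext where "ext X a q \<longleftrightarrow> q \<in> Ev Q X \<and> (\<forall>f\<in>Arr C. Cod C f = X \<longrightarrow>
    (\<forall>p\<in>Ev P (Dom C f). Res A f a = \<eta> (Dom C f) p \<longrightarrow> Res Q f q = \<phi> (Dom C f) p))" for X a q
  have eq: "\<phi> X p = \<phi> X q" if "X \<in> Obj C" "p \<in> Ev P X" "q \<in> Ev P X" "\<eta> X p = \<eta> X q" for X p q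
    using locally_injective_image_eq[OF li Q ph that] .
  have ex: "\<exists>q. ext X a q" if X: "X \<in> Obj C" and a: "a \<in> Ev A X" for X a
  proof -
    let ?S = "lift_sieve P A \<eta> X a"
    have S: "cov X ?S" using ls X a by (auto simp: locally_surjective_def)
    have "\<forall>f\<in>?S. \<exists>p. p \<in> Ev P (Dom C f) \<and> Res A f a = \<eta> (Dom C f) p" by (auto simp: lift_sieve_def)
    then obtain s where s: "\<And>f. f \<in> ?S \<Longrightarrow> s f \<in> Ev P (Dom C f)"
      "\<And>f. f \<in> ?S \<Longrightarrow> Res A f a = \<eta> (Dom C f) (s f)" by metis
    have fa: "f \<in> Arr C" "Cod C f = X" if "f \<in> ?S" for f using that by (auto simp: lift_sieve_def)
    have fam: "matching Q ?S (\<lambda>f. \<phi> (Dom C f) (s f))"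
      unfolding matching_def
    proof (intro ballI conjI impI)
      fix f assume f: "f \<in> ?S"
      show "\<phi> (Dom C f) (s f) \<in> Ev Q (Dom C f)" using NatT_app[OF ph _ s(1)[OF f]] fa[OF f] by simp
      fix g assume g: "g \<in> Arr C" "Cod C g = Dom C f"
      have fg: "f \<odot> g \<in> ?S" using is_sieveD(4)[OF cov_sieve[OF S] f g] .
      have "\<eta> (Dom C g) (s (f \<odot> g)) = \<eta> (Dom C g) (Res P g (s f))"
        using s(2)[OF fg] s(2)[OF f] NatT_nat[OF e g s(1)[OF f]] fa[OF f] g A a by simp
      then have "\<phi> (Dom C g) (s (f \<odot> g)) = \<phi> (Dom C g) (Res P g (s f))"
        using s(1)[OF fg] s(1)[OF f] fa[OF f] g P by (intro eq) auto
      then show "\<phi> (Dom C (f \<odot> g)) (s (f \<odot> g)) = Res Q g (\<phi> (Dom C f) (s f))"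
        using NatT_nat[OF ph g s(1)[OF f]] fa[OF f] g by simp
    qed
    obtain q where q: "q \<in> Ev Q X" "\<And>f. f \<in> ?S \<Longrightarrow> Res Q f q = \<phi> (Dom C f) (s f)"
      using sheaf_ex[OF Q S fam] by blast
    have "ext X a q"
      unfolding ext_def
    proof (intro conjI ballI impI q(1))
      fix f p assume f: "f \<in> Arr C" "Cod C f = X"
        and p: "p \<in> Ev P (Dom C f)" "Res A f a = \<eta> (Dom C f) p"
      then have fS: "f \<in> ?S" by (auto simp: lift_sieve_def)
      show "Res Q f q = \<phi> (Dom C f) p"
        using q(2)[OF fS] eq[of "Dom C f" "s f" p] s[OF fS] p f by simp
    qed
    then show ?thesis by blast
  qed
  have un: "q = r" if X: "X \<in> Obj C" and a: "a \<in> Ev A X" and "ext X a q" "ext X a r" for X a q r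
  proof (rule sheaf_eq[OF Q])
    show "cov X (lift_sieve P A \<eta> X a)" using ls X a by (auto simp: locally_surjective_def)
    show "Res Q f q = Res Q f r" if "f \<in> lift_sieve P A \<eta> X a" for f
      using that \<open>ext X a q\<close> \<open>ext X a r\<close> by (auto simp: lift_sieve_def ext_def)
  qed (use that in \<open>auto simp: ext_def\<close>)
  define \<psi> where "\<psi> = mk_nat C A (\<lambda>X a. THE q. ext X a q)"
  have psi: "ext X a (\<psi> X a)" if "X \<in> Obj C" "a \<in> Ev A X" for X a
  proof -
    have "\<exists>!q. ext X a q" using ex[OF that] un[OF that] by blast
    from theI'[OF this] show ?thesis using that by (simp add: \<psi>_def)
  qed
  have the: "(THE q. ext X a q) = \<psi> X a" if "X \<in> Obj C" "a \<in> Ev A X" for X a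
    using that by (simp add: \<psi>_def)
  have psiE: "\<psi> X a \<in> Ev Q X" if "X \<in> Obj C" "a \<in> Ev A X" for X a
    using psi[OF that] by (simp add: ext_def)
  have N: "\<psi> \<in> NatT C A Q"
    unfolding \<psi>_def
  proof (rule mk_nat_NatT[OF _ _ A])
    fix X a assume "X \<in> Obj C" "a \<in> Ev A X"
    then show "(THE q. ext X a q) \<in> Ev Q X" using the psiE by simp
  next
    fix f a assume f: "f \<in> Arr C" and a: "a \<in> Ev A (Cod C f)"
    have "ext (Dom C f) (Res A f a) (Res Q f (\<psi> (Cod C f) a))"
      unfolding ext_def
    proof (intro conjI ballI impI)
      show "Res Q f (\<psi> (Cod C f) a) \<in> Ev Q (Dom C f)" using psiE[OF _ a] f Qp by simp
      fix g p assume g: "g \<in> Arr C" "Cod C g = Dom C f"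
        and p: "p \<in> Ev P (Dom C g)" "Res A g (Res A f a) = \<eta> (Dom C g) p"
      have "Res A (f \<odot> g) a = \<eta> (Dom C g) p" using p f g a A by simp
      then have "Res Q (f \<odot> g) (\<psi> (Cod C f) a) = \<phi> (Dom C g) p"
        using psi[OF _ a] f g p unfolding ext_def by fastforce
      then show "Res Q g (Res Q f (\<psi> (Cod C f) a)) = \<phi> (Dom C g) p"
        using f g psiE[OF _ a] Qp by simp
    qed
    then have "Res Q f (\<psi> (Cod C f) a) = \<psi> (Dom C f) (Res A f a)"
      using un[OF _ _ _ psi] f a A by simp
    then show "(THE q. ext (Dom C f) (Res A f a) q) = Res Q f (THE q. ext (Cod C f) a q)"
      using the f a A by simp
  qed
  moreover have "\<psi> X (\<eta> X p) = \<phi> X p" if X: "X \<in> Obj C" and p: "p \<in> Ev P X" for X p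
  proof -
    have "Res Q (Ident C X) (\<psi> X (\<eta> X p)) = \<phi> X p"
      using psi[OF X NatT_app[OF e X p]] X p A NatT_app[OF e X p] unfolding ext_def by fastforce
    then show ?thesis using psiE[OF X NatT_app[OF e X p]] X Qp by simp
  qed
  ultimately show thesis by (rule that)
qed

text \<open>The inverse is the extension of the identity of \<open>P\<close> along \<open>\<eta>\<close>.\<close>

lemma locally_bijective_sheaves:
  assumes P: "sheaf P" and A: "sheaf A" and e: "\<eta> \<in> NatT C P A"
    and li: "locally_injective P \<eta>" and ls: "locally_surjective P A \<eta>" and X: "X \<in> Obj C"
  shows "bij_betw (\<eta> X) (Ev P X) (Ev A X)"
proof -
  note Pp = sheaf_presheaf[OF P] and Ap = sheaf_presheaf[OF A]
  obtain \<psi> where psi: "\<psi> \<in> NatT C A P" "\<And>X p. X \<in> Obj C \<Longrightarrow> p \<in> Ev P X \<Longrightarrow> \<psi> X (\<eta> X p) = nat_id C P X p"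
    using extend_along_locally_bijective[OF Pp Ap e li ls P nat_id_NatT[OF Pp]] by metis
  have "nat_comp C A \<eta> \<psi> = nat_id C A"
    using psi(2) NatT_app[OF e]
    by (intro locally_surjective_eq[OF ls Ap e A nat_comp_NatT[OF psi(1) e Ap] nat_id_NatT[OF Ap]])
      simp
  then have "nat_comp C A \<eta> \<psi> X a = nat_id C A X a" for a by simp
  then have "\<eta> X (\<psi> X a) = a" if "a \<in> Ev A X" for a using X that by (metis nat_comp_app nat_id_app)
  then show ?thesis
    using psi NatT_app[OF e X] NatT_app[OF psi(1) X] X
      by (intro bij_betw_byWitness[of _ "\<psi> X"]) auto
qed

end

section \<open>Sheafification\<close>

locale sheafification = topology C cov for C :: "('o, 'm) cat" and cov +
  fixes P :: "('o, 'm, 'w) presheaf"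
  assumes P: "is_presheaf C P"
begin

definition loc_eq :: "'o \<Rightarrow> 'w \<Rightarrow> 'w \<Rightarrow> bool" where
  "loc_eq X p q \<longleftrightarrow> cov X (equalizer_sieve P X p q)"

lemma pb_equalizer:
  "f \<in> Arr C \<Longrightarrow> Cod C f = X \<Longrightarrow> p \<in> Ev P X \<Longrightarrow> q \<in> Ev P X \<Longrightarrow>
    pb f (equalizer_sieve P X p q) = equalizer_sieve P (Dom C f) (Res P f p) (Res P f q)"
  using P by (auto simp: pb_def equalizer_sieve_def)

lemma loc_eq_refl: "X \<in> Obj C \<Longrightarrow> loc_eq X p p"
  using cov_max[of X] by (simp add: loc_eq_def equalizer_sieve_def max_sieve_def)

lemma loc_eq_sym: "loc_eq X p q \<Longrightarrow> loc_eq X q p"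
  by (simp add: loc_eq_def equalizer_sieve_def eq_commute)

lemma loc_eq_trans:
  assumes "X \<in> Obj C" "p \<in> Ev P X" "q \<in> Ev P X" "r \<in> Ev P X" "loc_eq X p q" "loc_eq X q r"
  shows "loc_eq X p r"
  unfolding loc_eq_def
  by (rule cov_mono[OF cov_Int[OF assms(5,6)[unfolded loc_eq_def]] is_sieve_equalizer[OF P
    assms(1,2,4)]])
    (auto simp: equalizer_sieve_def)

lemma loc_eq_Res:
  assumes "loc_eq X p q" "f \<in> Arr C" "Cod C f = X" "p \<in> Ev P X" "q \<in> Ev P X"
  shows "loc_eq (Dom C f) (Res P f p) (Res P f q)"
  using cov_pb[OF assms(1)[unfolded loc_eq_def] assms(2,3)] pb_equalizer[OF assms(2-5)]
    by (simp add: loc_eq_def)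

lemma loc_eq_local:
  assumes S: "cov X S" and pq: "p \<in> Ev P X" "q \<in> Ev P X"
    and "\<And>f. f \<in> S \<Longrightarrow> loc_eq (Dom C f) (Res P f p) (Res P f q)"
  shows "loc_eq X p q"
  unfolding loc_eq_def
proof (rule cov_local[OF S is_sieve_equalizer[OF P is_sieveD(1)[OF cov_sieve[OF S]] pq]])
  fix f assume f: "f \<in> S"
  then show "cov (Dom C f) (pb f (equalizer_sieve P X p q))"
    using assms(4)[OF f] is_sieveD(2,3)[OF cov_sieve[OF S] f] pq
      by (simp add: pb_equalizer loc_eq_def)
qed

text \<open>An element of the sheafification of \<open>P\<close> over \<open>X\<close>, coded by all pairs \<open>(f, p)\<close> such that \<open>p\<close> is
  locally its restriction along \<open>f\<close>. The conditions say: the entries are of the right kind, the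
    relation
  is stable under restriction, locally single-valued, closed under local membership,
    and defined on a
  covering sieve. Closedness makes the representation unique.\<close>

definition local_section :: "'o \<Rightarrow> ('m \<times> 'w) set \<Rightarrow> bool" where
  "local_section X \<sigma> \<longleftrightarrow>
     (\<forall>f p. (f, p) \<in> \<sigma> \<longrightarrow> f \<in> Arr C \<and> Cod C f = X \<and> p \<in> Ev P (Dom C f)) \<and>
     (\<forall>f p g. (f, p) \<in> \<sigma> \<longrightarrow> g \<in> Arr C \<longrightarrow> Cod C g = Dom C f \<longrightarrow> (f \<odot> g, Res P g p) \<in> \<sigma>) \<and>
     (\<forall>f p q. (f, p) \<in> \<sigma> \<longrightarrow> (f, q) \<in> \<sigma> \<longrightarrow> loc_eq (Dom C f) p q) \<and>
     (\<forall>f p R. f \<in> Arr C \<longrightarrow> Cod C f = X \<longrightarrow> p \<in> Ev P (Dom C f) \<longrightarrow> cov (Dom C f) R \<longrightarrow>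
        (\<forall>g\<in>R. (f \<odot> g, Res P g p) \<in> \<sigma>) \<longrightarrow> (f, p) \<in> \<sigma>) \<and>
     (\<exists>R. cov X R \<and> (\<forall>f\<in>R. \<exists>p. (f, p) \<in> \<sigma>))"

lemma local_sectionI:
  assumes "\<And>f p. (f, p) \<in> \<sigma> \<Longrightarrow> f \<in> Arr C \<and> Cod C f = X \<and> p \<in> Ev P (Dom C f)"
    and "\<And>f p g. (f, p) \<in> \<sigma> \<Longrightarrow> g \<in> Arr C \<Longrightarrow> Cod C g = Dom C f \<Longrightarrow> (f \<odot> g, Res P g p) \<in> \<sigma>"
    and "\<And>f p q. (f, p) \<in> \<sigma> \<Longrightarrow> (f, q) \<in> \<sigma> \<Longrightarrow> loc_eq (Dom C f) p q"
    and "\<And>f p R. f \<in> Arr C \<Longrightarrow> Cod C f = X \<Longrightarrow> p \<in> Ev P (Dom C f) \<Longrightarrow> cov (Dom C f) R \<Longrightarrow>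
        (\<And>g. g \<in> R \<Longrightarrow> (f \<odot> g, Res P g p) \<in> \<sigma>) \<Longrightarrow> (f, p) \<in> \<sigma>"
    and "cov X R" "\<And>f. f \<in> R \<Longrightarrow> \<exists>p. (f, p) \<in> \<sigma>"
  shows "local_section X \<sigma>"
  using assms unfolding local_section_def by blast

lemma local_sectionD:
  assumes "local_section X \<sigma>"
  shows "(f, p) \<in> \<sigma> \<Longrightarrow> f \<in> Arr C" "(f, p) \<in> \<sigma> \<Longrightarrow> Cod C f = X" "(f, p) \<in> \<sigma> \<Longrightarrow> p \<in> Ev P (Dom C f)"
    "(f, p) \<in> \<sigma> \<Longrightarrow> g \<in> Arr C \<Longrightarrow> Cod C g = Dom C f \<Longrightarrow> (f \<odot> g, Res P g p) \<in> \<sigma>"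
    "(f, p) \<in> \<sigma> \<Longrightarrow> (f, q) \<in> \<sigma> \<Longrightarrow> loc_eq (Dom C f) p q"
    "f \<in> Arr C \<Longrightarrow> Cod C f = X \<Longrightarrow> p \<in> Ev P (Dom C f) \<Longrightarrow> cov (Dom C f) R \<Longrightarrow>
        (\<And>g. g \<in> R \<Longrightarrow> (f \<odot> g, Res P g p) \<in> \<sigma>) \<Longrightarrow> (f, p) \<in> \<sigma>"
    "\<exists>R. cov X R \<and> (\<forall>f\<in>R. \<exists>p. (f, p) \<in> \<sigma>)"
  using assms unfolding local_section_def by blast+

lemma local_section_loc_eq:
  assumes s: "local_section X \<sigma>" and fp: "(f, p) \<in> \<sigma>" and q: "q \<in> Ev P (Dom C f)"
    and pq: "loc_eq (Dom C f) p q"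
  shows "(f, q) \<in> \<sigma>"
proof (rule local_sectionD(6)[OF s _ _ q pq[unfolded loc_eq_def]])
  show "f \<in> Arr C" "Cod C f = X" using local_sectionD[OF s] fp by blast+
  fix g assume "g \<in> equalizer_sieve P (Dom C f) p q"
  then have "g \<in> Arr C" "Cod C g = Dom C f" "Res P g p = Res P g q"
    by (auto simp: equalizer_sieve_def)
  then show "(f \<odot> g, Res P g q) \<in> \<sigma>" using local_sectionD(4)[OF s fp] by metis
qed

text \<open>A pair \<open>(f, q)\<close> of \<open>\<tau>\<close> agrees locally with the pairs of \<open>\<sigma>\<close>, which exist locally as \<open>\<sigma>\<close> is
  defined on a cover; closedness of \<open>\<sigma>\<close> does the rest.\<close>

lemma local_section_eqI:
  assumes s: "local_section X \<sigma>" and t: "local_section X \<tau>" and sub: "\<sigma> \<subseteq> \<tau>"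
  shows "\<sigma> = \<tau>"
proof (rule equalityI[OF sub], clarify)
  fix f q assume fq: "(f, q) \<in> \<tau>"
  note f = local_sectionD(1-3)[OF t fq]
  obtain R where R: "cov X R" "\<forall>f\<in>R. \<exists>p. (f, p) \<in> \<sigma>" using local_sectionD(7)[OF s] by blast
  show "(f, q) \<in> \<sigma>"
  proof (rule local_sectionD(6)[OF s f cov_pb[OF R(1) f(1,2)]])
    fix g assume "g \<in> pb f R"
    then have g: "g \<in> Arr C" "Cod C g = Dom C f" "f \<odot> g \<in> R" by (auto simp: pb_def)
    obtain p where p: "(f \<odot> g, p) \<in> \<sigma>" using R(2) g(3) by blast
    have "(f \<odot> g, p) \<in> \<tau>" "(f \<odot> g, Res P g q) \<in> \<tau>"
      using p sub local_sectionD(4)[OF t fq g(1,2)] by auto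
    then have "loc_eq (Dom C (f \<odot> g)) p (Res P g q)" by (rule local_sectionD(5)[OF t])
    then show "(f \<odot> g, Res P g q) \<in> \<sigma>"
      using f g P by (intro local_section_loc_eq[OF s p]) auto
  qed
qed

definition section_Res :: "'m \<Rightarrow> ('m \<times> 'w) set \<Rightarrow> ('m \<times> 'w) set" where
  "section_Res h \<sigma> = {(g, p). g \<in> Arr C \<and> Cod C g = Dom C h \<and> (h \<odot> g, p) \<in> \<sigma>}"

lemma section_Res_iff: "(g, p) \<in> section_Res h \<sigma> \<longleftrightarrow> g \<in> Arr C \<and> Cod C g = Dom C h \<and> (h \<odot> g, p) \<in> \<sigma>"
  by (simp add: section_Res_def)

lemma local_section_Res:
  assumes s: "local_section X \<sigma>" and h: "h \<in> Arr C" "Cod C h = X"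
  shows "local_section (Dom C h) (section_Res h \<sigma>)"
proof -
  obtain R where R: "cov X R" "\<forall>f\<in>R. \<exists>p. (f, p) \<in> \<sigma>" using local_sectionD(7)[OF s] by blast
  show ?thesis
  proof (rule local_sectionI[of _ _ "pb h R"]; (unfold section_Res_iff)?)
    fix f p assume "f \<in> Arr C \<and> Cod C f = Dom C h \<and> (h \<odot> f, p) \<in> \<sigma>"
    then show "f \<in> Arr C \<and> Cod C f = Dom C h \<and> p \<in> Ev P (Dom C f)"
      using local_sectionD(3)[OF s, of "h \<odot> f" p] h by simp
  next
    fix f p g assume "f \<in> Arr C \<and> Cod C f = Dom C h \<and> (h \<odot> f, p) \<in> \<sigma>" "g \<in> Arr C"
      "Cod C g = Dom C f"
    then show "f \<odot> g \<in> Arr C \<and> Cod C (f \<odot> g) = Dom C h \<and> (h \<odot> (f \<odot> g), Res P g p) \<in> \<sigma>"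
      using local_sectionD(4)[OF s, of "h \<odot> f" p g] h by simp
  next
    fix f p q assume "f \<in> Arr C \<and> Cod C f = Dom C h \<and> (h \<odot> f, p) \<in> \<sigma>"
      "f \<in> Arr C \<and> Cod C f = Dom C h \<and> (h \<odot> f, q) \<in> \<sigma>"
    then show "loc_eq (Dom C f) p q"
      using local_sectionD(5)[OF s, of "h \<odot> f" p q] h by simp
  next
    fix f p R' assume f: "f \<in> Arr C" "Cod C f = Dom C h" and p: "p \<in> Ev P (Dom C f)"
      and R': "cov (Dom C f) R'"
      and *: "\<And>g. g \<in> R' \<Longrightarrow> f \<odot> g \<in> Arr C \<and> Cod C (f \<odot> g) = Dom C h \<and> (h \<odot> (f \<odot> g), Res P g p) \<in> \<sigma>"
    have "(h \<odot> f, p) \<in> \<sigma>"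
    proof (rule local_sectionD(6)[OF s, of _ _ R'])
      fix g assume g: "g \<in> R'"
      have "g \<in> Arr C" "Cod C g = Dom C f" using is_sieveD(2,3)[OF cov_sieve[OF R'] g] by auto
      then show "(h \<odot> f \<odot> g, Res P g p) \<in> \<sigma>" using *[OF g] f h by simp
    qed (use f h p R' in auto)
    then show "f \<in> Arr C \<and> Cod C f = Dom C h \<and> (h \<odot> f, p) \<in> \<sigma>" using f by simp
  next
    show "cov (Dom C h) (pb h R)" using cov_pb[OF R(1) h] .
  next
    fix f assume "f \<in> pb h R"
    then show "\<exists>p. f \<in> Arr C \<and> Cod C f = Dom C h \<and> (h \<odot> f, p) \<in> \<sigma>" using R(2) by (auto simp: pb_def)
  qed
qed

definition section_unit :: "'o \<Rightarrow> 'w \<Rightarrow> ('m \<times> 'w) set" where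
  "section_unit X p = {(f, q). f \<in> Arr C \<and> Cod C f = X \<and> q \<in> Ev P (Dom C f) \<and>
    loc_eq (Dom C f) q (Res P f p)}"

lemma section_unit_iff: "(f, q) \<in> section_unit X p \<longleftrightarrow>
    f \<in> Arr C \<and> Cod C f = X \<and> q \<in> Ev P (Dom C f) \<and> loc_eq (Dom C f) q (Res P f p)"
  by (simp add: section_unit_def)

lemma local_section_unit:
  assumes X: "X \<in> Obj C" and p: "p \<in> Ev P X"
  shows "local_section X (section_unit X p)"
proof (rule local_sectionI[of _ _ "max_sieve X"]; (unfold section_unit_iff)?)
  fix f q g assume f: "f \<in> Arr C \<and> Cod C f = X \<and> q \<in> Ev P (Dom C f) \<and>
    loc_eq (Dom C f) q (Res P f p)"
    and g: "g \<in> Arr C" "Cod C g = Dom C f"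
  then have "loc_eq (Dom C g) (Res P g q) (Res P g (Res P f p))"
    using p P by (intro loc_eq_Res[of "Dom C f"]) auto
  then show "f \<odot> g \<in> Arr C \<and> Cod C (f \<odot> g) = X \<and> Res P g q \<in> Ev P (Dom C (f \<odot> g)) \<and>
      loc_eq (Dom C (f \<odot> g)) (Res P g q) (Res P (f \<odot> g) p)"
    using f g p P by simp
next
  fix f q r assume f: "f \<in> Arr C \<and> Cod C f = X \<and> q \<in> Ev P (Dom C f) \<and>
    loc_eq (Dom C f) q (Res P f p)"
    "f \<in> Arr C \<and> Cod C f = X \<and> r \<in> Ev P (Dom C f) \<and> loc_eq (Dom C f) r (Res P f p)"
  then show "loc_eq (Dom C f) q r"
    using p P by (intro loc_eq_trans[of _ q "Res P f p" r]) (auto intro: loc_eq_sym)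
next
  fix f q R assume f: "f \<in> Arr C" "Cod C f = X" and q: "q \<in> Ev P (Dom C f)" and R: "cov (Dom C f) R"
    and *: "\<And>g. g \<in> R \<Longrightarrow> f \<odot> g \<in> Arr C \<and> Cod C (f \<odot> g) = X \<and> Res P g q \<in> Ev P (Dom C (f \<odot> g)) \<and>
      loc_eq (Dom C (f \<odot> g)) (Res P g q) (Res P (f \<odot> g) p)"
  have "loc_eq (Dom C f) q (Res P f p)"
  proof (rule loc_eq_local[OF R q])
    fix g assume g: "g \<in> R"
    have "g \<in> Arr C" "Cod C g = Dom C f" using is_sieveD(2,3)[OF cov_sieve[OF R] g] by auto
    then show "loc_eq (Dom C g) (Res P g q) (Res P g (Res P f p))" using *[OF g] f p P by simp
  qed (use f p P in simp)
  then show "f \<in> Arr C \<and> Cod C f = X \<and> q \<in> Ev P (Dom C f) \<and> loc_eq (Dom C f) q (Res P f p)"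
    using f q by simp
next
  show "cov X (max_sieve X)" using cov_max[OF X] .
  fix f assume "f \<in> max_sieve X"
  then have "f \<in> Arr C" "Cod C f = X" by (auto simp: max_sieve_def)
  then show "\<exists>q. f \<in> Arr C \<and> Cod C f = X \<and> q \<in> Ev P (Dom C f) \<and> loc_eq (Dom C f) q (Res P f p)"
    using p P by (intro exI[of _ "Res P f p"]) (auto intro: loc_eq_refl)
qed auto

text \<open>This makes the unit locally surjective: a local section is given by elements of \<open>P\<close> on its own
  domain of definition.\<close>

lemma section_Res_eq_unit:
  assumes s: "local_section X \<sigma>" and fp: "(f, p) \<in> \<sigma>"
  shows "section_Res f \<sigma> = section_unit (Dom C f) p"
proof (rule local_section_eqI[symmetric])
  note f = local_sectionD(1-3)[OF s fp]
  show "local_section (Dom C f) (section_unit (Dom C f) p)"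
    using f by (intro local_section_unit) auto
  show "local_section (Dom C f) (section_Res f \<sigma>)" using f by (intro local_section_Res[OF s])
  show "section_unit (Dom C f) p \<subseteq> section_Res f \<sigma>"
  proof clarify
    fix g q assume "(g, q) \<in> section_unit (Dom C f) p"
    then have g: "g \<in> Arr C" "Cod C g = Dom C f" "q \<in> Ev P (Dom C g)"
      "loc_eq (Dom C g) q (Res P g p)"
      by (auto simp: section_unit_iff)
    have "(f \<odot> g, q) \<in> \<sigma>"
      using g f by (intro local_section_loc_eq[OF s local_sectionD(4)[OF s fp g(1,2)]]) (auto intro:
        loc_eq_sym)
    then show "(g, q) \<in> section_Res f \<sigma>" using g by (simp add: section_Res_iff)
  qed
qed

definition section_presheaf :: "('o, 'm, ('m \<times> 'w) set) presheaf" where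
  "section_presheaf = \<lparr>Ev = (\<lambda>X\<in>Obj C. {\<sigma>. local_section X \<sigma>}),
     Res = (\<lambda>h\<in>Arr C. \<lambda>\<sigma>\<in>{\<sigma>. local_section (Cod C h) \<sigma>}. section_Res h \<sigma>)\<rparr>"

lemma section_presheaf_simps:
  "X \<in> Obj C \<Longrightarrow> Ev section_presheaf X = {\<sigma>. local_section X \<sigma>}"
  "h \<in> Arr C \<Longrightarrow> local_section (Cod C h) \<sigma> \<Longrightarrow> Res section_presheaf h \<sigma> = section_Res h \<sigma>"
  by (auto simp: section_presheaf_def)

lemma is_presheaf_sections: "is_presheaf C section_presheaf"
proof (rule is_presheafI[OF section_presheaf_def])
  fix X \<sigma> assume X: "X \<in> Obj C" and "\<sigma> \<in> {\<sigma>. local_section X \<sigma>}"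
  then have s: "local_section X \<sigma>" by simp
  have "x \<in> section_Res (Ident C X) \<sigma> \<longleftrightarrow> x \<in> \<sigma>" for x
  proof (cases x)
    case (Pair f p)
    then show ?thesis
      using local_sectionD(1,2)[OF s, of f p] X
        by (cases "f \<in> Arr C \<and> Cod C f = X") (auto simp: section_Res_iff)
  qed
  then show "section_Res (Ident C X) \<sigma> = \<sigma>" by blast
next
  fix f g \<sigma> assume "f \<in> Arr C" "g \<in> Arr C" "Cod C g = Dom C f"
  then show "section_Res (f \<odot> g) \<sigma> = section_Res g (section_Res f \<sigma>)"
    by (auto simp: section_Res_def)
qed (auto intro: local_section_Res)

definition unit :: "'o \<Rightarrow> 'w \<Rightarrow> ('m \<times> 'w) set" where
  "unit = mk_nat C P section_unit"

lemma unit_NatT: "unit \<in> NatT C P section_presheaf"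
  unfolding unit_def
proof (rule mk_nat_NatT[OF _ _ P])
  fix X p assume "X \<in> Obj C" "p \<in> Ev P X"
  then show "section_unit X p \<in> Ev section_presheaf X"
    using local_section_unit by (simp add: section_presheaf_simps)
next
  fix f p assume f: "f \<in> Arr C" and p: "p \<in> Ev P (Cod C f)"
  have s: "local_section (Cod C f) (section_unit (Cod C f) p)" using local_section_unit f p by simp
  have "(f, Res P f p) \<in> section_unit (Cod C f) p"
    using f p P by (auto simp: section_unit_iff intro: loc_eq_refl)
  then show "section_unit (Dom C f) (Res P f p) = Res section_presheaf f (section_unit (Cod C f) p)"
    using section_Res_eq_unit[OF s] section_presheaf_simps(2)[OF f s] by simp
qed

lemma unit_app: "X \<in> Obj C \<Longrightarrow> p \<in> Ev P X \<Longrightarrow> unit X p = section_unit X p"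
  by (simp add: unit_def)

lemma unit_locally_injective: "locally_injective P unit"
  unfolding locally_injective_def
proof (intro ballI impI)
  fix X p q assume X: "X \<in> Obj C" and p: "p \<in> Ev P X" and q: "q \<in> Ev P X"
    and e: "unit X p = unit X q"
  have "(Ident C X, p) \<in> section_unit X p"
    using X p P by (auto simp: section_unit_iff intro: loc_eq_refl)
  then have "(Ident C X, p) \<in> section_unit X q" using e X p q by (simp add: unit_app)
  then show "cov X (equalizer_sieve P X p q)"
    using X q P by (simp add: section_unit_iff loc_eq_def)
qed

lemma unit_locally_surjective: "locally_surjective P section_presheaf unit"
  unfolding locally_surjective_def
proof (intro ballI)
  fix X \<sigma> assume X: "X \<in> Obj C" and "\<sigma> \<in> Ev section_presheaf X"
  then have s: "local_section X \<sigma>" by (simp add: section_presheaf_simps)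
  obtain R where R: "cov X R" "\<forall>f\<in>R. \<exists>p. (f, p) \<in> \<sigma>" using local_sectionD(7)[OF s] by blast
  show "cov X (lift_sieve P section_presheaf unit X \<sigma>)"
  proof (rule cov_mono[OF R(1) is_sieve_lift[OF P is_presheaf_sections unit_NatT X]])
    show "\<sigma> \<in> Ev section_presheaf X" by fact
    show "R \<subseteq> lift_sieve P section_presheaf unit X \<sigma>"
    proof
      fix f assume "f \<in> R"
      then obtain p where p: "(f, p) \<in> \<sigma>" using R(2) by blast
      note f = local_sectionD(1-3)[OF s p]
      have "Res section_presheaf f \<sigma> = unit (Dom C f) p"
        using section_Res_eq_unit[OF s p] f s by (simp add: section_presheaf_simps unit_app)
      then show "f \<in> lift_sieve P section_presheaf unit X \<sigma>" using f by (auto simp: lift_sieve_def)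
    qed
  qed
qed

text \<open>Elements are glued by taking the pairs \<open>(h, p)\<close> that belong locally to the given sections; the
  sieve \<open>R h p\<close> below is where they do.\<close>

lemma sheaf_sections: "sheaf section_presheaf"
  unfolding sheaf_def
proof (intro conjI is_presheaf_sections allI impI)
  fix X S assume S: "cov X S"
  note sv = cov_sieve[OF S]
  note SD = is_sieveD(2-4)[OF sv]
  have X: "X \<in> Obj C" using is_sieveD(1)[OF sv] .
  show "sheaf_for section_presheaf X S"
  proof (rule sheaf_forI)
    fix \<sigma> \<tau> assume st: "\<sigma> \<in> Ev section_presheaf X" "\<tau> \<in> Ev section_presheaf X"
      and e: "\<And>f. f \<in> S \<Longrightarrow> Res section_presheaf f \<sigma> = Res section_presheaf f \<tau>"
    have s: "local_section X \<sigma>" and t: "local_section X \<tau>"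
      using st X by (auto simp: section_presheaf_simps)
    have eq: "section_Res f \<sigma> = section_Res f \<tau>" if "f \<in> S" for f
      using e[OF that] SD(1,2)[OF that] s t by (simp add: section_presheaf_simps)
    show "\<sigma> = \<tau>"
    proof (rule local_section_eqI[OF s t], clarify)
      fix f p assume fp: "(f, p) \<in> \<sigma>"
      note f = local_sectionD(1-3)[OF s fp]
      show "(f, p) \<in> \<tau>"
      proof (rule local_sectionD(6)[OF t f cov_pb[OF S f(1,2)]])
        fix g assume "g \<in> pb f S"
        then have g: "g \<in> Arr C" "Cod C g = Dom C f" "f \<odot> g \<in> S" by (auto simp: pb_def)
        have "(Ident C (Dom C g), Res P g p) \<in> section_Res (f \<odot> g) \<sigma>"
          using local_sectionD(4)[OF s fp g(1,2)] f g by (simp add: section_Res_iff)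
        then have "(Ident C (Dom C g), Res P g p) \<in> section_Res (f \<odot> g) \<tau>" using eq[OF g(3)] by simp
        then show "(f \<odot> g, Res P g p) \<in> \<tau>" using f g by (simp add: section_Res_iff)
      qed
    qed
  next
    fix s assume m: "matching section_presheaf S s"
    have s: "local_section (Dom C f) (s f)" if "f \<in> S" for f
      using matchingD[OF m that] SD(1)[OF that] by (simp add: section_presheaf_simps)
    have sc: "s (f \<odot> g) = section_Res g (s f)" if "f \<in> S" "g \<in> Arr C" "Cod C g = Dom C f" for f g
      using matching_comp[OF m that] s[OF that(1)] that by (simp add: section_presheaf_simps)
    define R where "R h p = {g \<in> Arr C. Cod C g = Dom C h \<and> h \<odot> g \<in> S \<and>
      (Ident C (Dom C g), Res P g p) \<in> s (h \<odot> g)}" for h p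
    define \<sigma> where "\<sigma> = {(h, p). h \<in> Arr C \<and> Cod C h = X \<and> p \<in> Ev P (Dom C h) \<and>
      cov (Dom C h) (R h p)}"
    have \<sigma>_iff: "(h, p) \<in> \<sigma> \<longleftrightarrow> h \<in> Arr C \<and> Cod C h = X \<and> p \<in> Ev P (Dom C h) \<and> cov (Dom C h) (R h p)"
      for h p
      by (simp add: \<sigma>_def)
    have R_comp: "R (h \<odot> k) (Res P k p) = pb k (R h p)" 
      if "h \<in> Arr C" "Cod C h = X" "p \<in> Ev P (Dom C h)" "k \<in> Arr C" "Cod C k = Dom C h" for h k p
      using that P by (auto simp: R_def pb_def)
    have R_sieve: "is_sieve (Dom C h) (R h p)" if h: "h \<in> Arr C" "Cod C h = X"
      and p: "p \<in> Ev P (Dom C h)" for h p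
    proof (rule is_sieveI)
      fix g k assume "g \<in> R h p" and k: "k \<in> Arr C" "Cod C k = Dom C g"
      then have g: "g \<in> Arr C" "Cod C g = Dom C h" "h \<odot> g \<in> S"
        "(Ident C (Dom C g), Res P g p) \<in> s (h \<odot> g)"
        by (auto simp: R_def)
      have "(Ident C (Dom C g) \<odot> k, Res P k (Res P g p)) \<in> s (h \<odot> g)"
        using local_sectionD(4)[OF s[OF g(3)] g(4)] k g by simp
      then have "(Ident C (Dom C k), Res P k (Res P g p)) \<in> s (h \<odot> g \<odot> k)"
        using sc[OF g(3) k(1)] k g h by (simp add: section_Res_iff)
      then show "g \<odot> k \<in> R h p" using SD(3)[OF g(3) k(1)] k g h p P by (simp add: R_def)
    qed (use h in \<open>auto simp: R_def\<close>)
    have in_\<sigma>: "(f \<odot> g, p) \<in> \<sigma>" if f: "f \<in> S" and gp: "(g, p) \<in> s f" for f g p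
    proof -
      note g = local_sectionD(1-3)[OF s[OF f] gp]
      have fg: "f \<odot> g \<in> S" using SD(3)[OF f g(1,2)] .
      have fa: "f \<in> Arr C" "Cod C f = X" using SD f by auto
      have "R (f \<odot> g) p = max_sieve (Dom C g)"
      proof -
        have "k \<in> R (f \<odot> g) p" if k: "k \<in> Arr C" "Cod C k = Dom C g" for k
        proof -
          have "(g \<odot> k, Res P k p) \<in> s f" using local_sectionD(4)[OF s[OF f] gp k] .
          then have "(Ident C (Dom C k), Res P k p) \<in> s (f \<odot> (g \<odot> k))"
            using sc[OF f, of "g \<odot> k"] g k by (simp add: section_Res_iff)
          then show ?thesis using SD(3)[OF fg k(1)] k g fa by (simp add: R_def)
        qed
        then show ?thesis using g fa by (auto simp: R_def max_sieve_def)
      qed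
      then show ?thesis using g fa cov_max by (simp add: \<sigma>_iff)
    qed
    have ls: "local_section X \<sigma>"
    proof (rule local_sectionI[of _ _ "{f \<in> S. \<exists>p. (f, p) \<in> \<sigma>}"])
      show "f \<in> Arr C \<and> Cod C f = X \<and> p \<in> Ev P (Dom C f)" if "(f, p) \<in> \<sigma>" for f p
        using that by (simp add: \<sigma>_iff)
    next
      fix f p g assume "(f, p) \<in> \<sigma>" and g: "g \<in> Arr C" "Cod C g = Dom C f"
      then have f: "f \<in> Arr C" "Cod C f = X" "p \<in> Ev P (Dom C f)" "cov (Dom C f) (R f p)"
        by (auto simp: \<sigma>_iff)
      then show "(f \<odot> g, Res P g p) \<in> \<sigma>"
        using g P R_comp[OF f(1-3) g] cov_pb[OF f(4) g] by (simp add: \<sigma>_iff)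
    next
      fix f p q assume "(f, p) \<in> \<sigma>" "(f, q) \<in> \<sigma>"
      then have f: "f \<in> Arr C" "Cod C f = X" and p: "p \<in> Ev P (Dom C f)" and q: "q \<in> Ev P (Dom C f)"
        and cov: "cov (Dom C f) (R f p)" "cov (Dom C f) (R f q)" by (auto simp: \<sigma>_iff)
      show "loc_eq (Dom C f) p q"
      proof (rule loc_eq_local[OF cov_Int[OF cov] p q])
        fix g assume "g \<in> R f p \<inter> R f q"
        then have g: "g \<in> Arr C" "Cod C g = Dom C f" "f \<odot> g \<in> S"
          "(Ident C (Dom C g), Res P g p) \<in> s (f \<odot> g)"
          "(Ident C (Dom C g), Res P g q) \<in> s (f \<odot> g)" by (auto simp: R_def)
        show "loc_eq (Dom C g) (Res P g p) (Res P g q)"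
          using local_sectionD(5)[OF s[OF g(3)] g(4,5)] g by simp
      qed
    next
      fix f p T assume f: "f \<in> Arr C" "Cod C f = X" and p: "p \<in> Ev P (Dom C f)"
        and T: "cov (Dom C f) T"
        and *: "\<And>g. g \<in> T \<Longrightarrow> (f \<odot> g, Res P g p) \<in> \<sigma>"
      have "cov (Dom C f) (R f p)"
      proof (rule cov_local[OF T R_sieve[OF f p]])
        fix g assume g: "g \<in> T"
        have ga: "g \<in> Arr C" "Cod C g = Dom C f" using is_sieveD(2,3)[OF cov_sieve[OF T] g] by auto
        show "cov (Dom C g) (pb g (R f p))"
          using *[OF g] R_comp[OF f p ga] f ga by (simp add: \<sigma>_iff)
      qed
      then show "(f, p) \<in> \<sigma>" using f p by (simp add: \<sigma>_iff)
    next
      have restr: "(f \<odot> g, Res P g p) \<in> \<sigma>" if fp: "(f, p) \<in> \<sigma>"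
        and g: "g \<in> Arr C" "Cod C g = Dom C f" for f p g
      proof -
        have f: "f \<in> Arr C" "Cod C f = X" "p \<in> Ev P (Dom C f)" "cov (Dom C f) (R f p)"
          using fp by (auto simp: \<sigma>_iff)
        then show ?thesis using g P R_comp[OF f(1-3) g] cov_pb[OF f(4) g] by (simp add: \<sigma>_iff)
      qed
      show "cov X {f \<in> S. \<exists>p. (f, p) \<in> \<sigma>}"
      proof (rule cov_trans[OF S])
        show "is_sieve X {f \<in> S. \<exists>p. (f, p) \<in> \<sigma>}"
        proof (rule is_sieveI[OF X])
          fix f g assume f: "f \<in> {f \<in> S. \<exists>p. (f, p) \<in> \<sigma>}" and g: "g \<in> Arr C" "Cod C g = Dom C f"
          then obtain p where "(f, p) \<in> \<sigma>" by blast
          from restr[OF this g] show "f \<odot> g \<in> {f \<in> S. \<exists>p. (f, p) \<in> \<sigma>}"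
            using SD(3)[OF _ g] f by blast
        qed (use SD in auto)
        fix f assume f: "f \<in> S"
        obtain T where T: "cov (Dom C f) T" "\<forall>g\<in>T. \<exists>p. (g, p) \<in> s f"
          using local_sectionD(7)[OF s[OF f]] by blast
        have "f \<odot> g \<in> S \<and> (\<exists>p. (f \<odot> g, p) \<in> \<sigma>)" if g: "g \<in> T" for g
        proof -
          have "g \<in> Arr C" "Cod C g = Dom C f" using is_sieveD(2,3)[OF cov_sieve[OF T(1)] g] by auto
          then show ?thesis using in_\<sigma>[OF f] T(2) g SD(3)[OF f] by blast
        qed
        then show "\<exists>T. cov (Dom C f) T \<and> (\<forall>g\<in>T. f \<odot> g \<in> {f \<in> S. \<exists>p. (f, p) \<in> \<sigma>})"
          using T(1) by blast
      qed
    qed auto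
    have "Res section_presheaf f \<sigma> = s f" if f: "f \<in> S" for f
    proof -
      have fa: "f \<in> Arr C" "Cod C f = X" using SD f by auto
      have "s f = section_Res f \<sigma>"
      proof (rule local_section_eqI[OF s[OF f] local_section_Res[OF ls fa]], clarify)
        fix g p assume gp: "(g, p) \<in> s f"
        show "(g, p) \<in> section_Res f \<sigma>"
          using in_\<sigma>[OF f gp] local_sectionD(1,2)[OF s[OF f] gp] by (simp add: section_Res_iff)
      qed
      then show ?thesis using fa ls by (simp add: section_presheaf_simps)
    qed
    then show "\<exists>\<sigma>\<in>Ev section_presheaf X. \<forall>f\<in>S. Res section_presheaf f \<sigma> = s f"
      using ls X by (auto simp: section_presheaf_simps)
  qed
qed

end

section \<open>Essentially small sites\<close>

locale small_site = site_cat C for C :: "('o, 'm) cat" +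
  fixes U :: "'v set set"
  assumes universe: "set_universe U" and ess_small: "essentially_small U C"
begin

lemma small_skeleton:
  obtains G where "G \<subseteq> Obj C" "small_set U G"
    "\<And>Y. Y \<in> Obj C \<Longrightarrow> \<exists>Z\<in>G. \<exists>i\<in>Hom C Z Y. is_iso C i"
proof -
  obtain D F where D: "small_cat U D" and F: "is_equivalence D C F"
    using ess_small unfolding essentially_small_def by blast
  have "small_set U (Obj D)" using D by (intro small_set_universe) (simp add: small_cat_def)
  then have "small_set U (FObj F ` Obj D)" by (rule small_set_image[OF universe])
  moreover have "FObj F ` Obj D \<subseteq> Obj C" using F by (auto simp: is_equivalence_def is_functor_def)
  ultimately show thesis
    using F by (intro that[of "FObj F ` Obj D"]) (auto simp: is_equivalence_def)
qed

lemma small_Hom: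
  assumes X: "X \<in> Obj C" and Y: "Y \<in> Obj C" shows "small_set U (Hom C X Y)"
proof -
  obtain D and F :: "('v, 'v, 'o, 'm) functr" where D: "small_cat U D" and F: "is_equivalence D C F"
    using ess_small unfolding essentially_small_def by blast
  obtain d i where d: "d \<in> Obj D" "i \<in> Hom C (FObj F d) X" "is_iso C i"
    using F X unfolding is_equivalence_def by blast
  obtain e j where e: "e \<in> Obj D" "j \<in> Hom C (FObj F e) Y" "is_iso C j"
    using F Y unfolding is_equivalence_def by blast
  obtain i' where i': "i' \<in> Hom C X (FObj F d)" "i \<odot> i' = Ident C X"
    using is_isoE[OF d(3,2)] by metis
  obtain j' where j': "j' \<in> Hom C Y (FObj F e)" "j \<odot> j' = Ident C Y"
    using is_isoE[OF e(3,2)] by metis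
  have "Hom C X Y \<subseteq> (\<lambda>a. j \<odot> (FArr F a \<odot> i')) ` Arr D"
  proof
    fix f assume f: "f \<in> Hom C X Y"
    have "j' \<odot> (f \<odot> i) \<in> Hom C (FObj F d) (FObj F e)"
      using Comp_Hom[OF category Comp_Hom[OF category d(2) f] j'(1)] .
    moreover have "bij_betw (FArr F) (Hom D d e) (Hom C (FObj F d) (FObj F e))"
      using F d(1) e(1) by (simp add: is_equivalence_def)
    ultimately obtain a where a: "a \<in> Hom D d e" "FArr F a = j' \<odot> (f \<odot> i)"
      unfolding bij_betw_def by (metis (no_types, lifting) imageE)
    have "j \<odot> (FArr F a \<odot> i') = (j \<odot> j') \<odot> (f \<odot> (i \<odot> i'))"
      unfolding a(2) using f d(2) e(2) i'(1) j'(1) by (auto simp: Hom_def)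
    also have "\<dots> = f" using i'(2) j'(2) f by (auto simp: Hom_def)
    finally show "f \<in> (\<lambda>a. j \<odot> (FArr F a \<odot> i')) ` Arr D" using a(1) by (auto simp: Hom_def)
  qed
  moreover have "small_set U (Arr D)"
    using D by (intro small_set_universe) (simp add: small_cat_def)
  ultimately show ?thesis using small_set_subset[OF universe small_set_image[OF universe]] by blast
qed

text \<open>The arrows in \<open>T\<close> have their source in a small skeleton. A set of arrows into \<open>X\<close> that is stable
  under precomposition is determined by its intersection with \<open>T\<close>.\<close>

lemma small_dense_arrows:
  assumes X: "X \<in> Obj C"
  obtains T where "T \<subseteq> max_sieve X" "small_set U T"
    "\<And>f. f \<in> Arr C \<Longrightarrow> Cod C f = X \<Longrightarrow> \<exists>i\<in>Arr C. \<exists>j\<in>Arr C. Cod C i = Dom C f \<and> Dom C j = Dom C f \<and>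
      Cod C j = Dom C i \<and> i \<odot> j = Ident C (Dom C f) \<and> f \<odot> i \<in> T"
proof -
  obtain G where G: "G \<subseteq> Obj C" "small_set U G" "\<And>Y. Y \<in> Obj C \<Longrightarrow> \<exists>Z\<in>G. \<exists>i\<in>Hom C Z Y. is_iso C i"
    using small_skeleton by metis
  let ?T = "{f \<in> max_sieve X. Dom C f \<in> G}"
  have "small_set U (Sigma G (\<lambda>Z. Hom C Z X))"
    using G X by (intro small_set_Sigma[OF universe] small_Hom) auto
  moreover have "?T \<subseteq> snd ` Sigma G (\<lambda>Z. Hom C Z X)" by (force simp: max_sieve_def Hom_def)
  ultimately have "small_set U ?T"
    using small_set_subset[OF universe small_set_image[OF universe]] by blast
  moreover have "\<exists>i\<in>Arr C. \<exists>j\<in>Arr C. Cod C i = Dom C f \<and> Dom C j = Dom C f \<and>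
      Cod C j = Dom C i \<and> i \<odot> j = Ident C (Dom C f) \<and> f \<odot> i \<in> ?T"
        if f: "f \<in> Arr C" "Cod C f = X" for f
  proof -
    obtain Z i where i: "Z \<in> G" "i \<in> Hom C Z (Dom C f)" "is_iso C i"
      using G(3)[of "Dom C f"] f by auto
    obtain j where "j \<in> Hom C (Dom C f) Z" "i \<odot> j = Ident C (Dom C f)"
      using is_isoE[OF i(3,2)] by metis
    with i f show ?thesis by (intro bexI[of _ i] bexI[of _ j]) (auto simp: Hom_def max_sieve_def)
  qed
  ultimately show thesis by (intro that[of ?T]) auto
qed

end

locale small_topology = topology C cov + small_site C U
  for C :: "('o, 'm) cat" and cov and U :: "'v set set"
begin

text \<open>Stability under restriction along isomorphisms reduces a local section to its pairs \<open>(f, p)\<close> with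
  \<open>f\<close> in a small set.\<close>

lemma small_local_sections:
  fixes P :: "('o, 'm, 'v) presheaf"
  assumes PU: "P \<in> presheaves U C" and X: "X \<in> Obj C"
  shows "small_set U {\<sigma>. sheafification.local_section C cov P X \<sigma>}"
proof -
  interpret sheafification C cov P by unfold_locales (rule presheaves_D[OF PU])
  obtain T where T: "T \<subseteq> max_sieve X" "small_set U T"
    "\<And>f. f \<in> Arr C \<Longrightarrow> Cod C f = X \<Longrightarrow> \<exists>i\<in>Arr C. \<exists>j\<in>Arr C. Cod C i = Dom C f \<and> Dom C j = Dom C f \<and>
      Cod C j = Dom C i \<and> i \<odot> j = Ident C (Dom C f) \<and> f \<odot> i \<in> T"
    using small_dense_arrows[OF X] by metis
  let ?B = "Sigma T (\<lambda>f. Ev P (Dom C f))"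
  have B: "small_set U ?B"
    using T(1) PU by (intro small_set_Sigma[OF universe T(2)] small_set_universe)
      (auto simp: max_sieve_def presheaves_def)
  have sub: "\<sigma> \<subseteq> \<tau>" if s: "local_section X \<sigma>" and t: "local_section X \<tau>"
    and e: "\<sigma> \<inter> ?B = \<tau> \<inter> ?B" for \<sigma> \<tau>
  proof clarify
    fix f p assume fp: "(f, p) \<in> \<sigma>"
    note f = local_sectionD(1-3)[OF s fp]
    obtain i j where ij: "i \<in> Arr C" "j \<in> Arr C" "Cod C i = Dom C f" "Dom C j = Dom C f"
      "Cod C j = Dom C i" "i \<odot> j = Ident C (Dom C f)" "f \<odot> i \<in> T" using T(3)[OF f(1,2)] by blast
    have "(f \<odot> i, Res P i p) \<in> \<sigma> \<inter> ?B"
      using local_sectionD(4)[OF s fp ij(1,3)] ij f P by simp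
    then have "(f \<odot> i, Res P i p) \<in> \<tau>" using e by blast
    from local_sectionD(4)[OF t this ij(2)] have "(f \<odot> (i \<odot> j), Res P j (Res P i p)) \<in> \<tau>"
      using ij f by simp
    moreover have "Res P j (Res P i p) = Res P (i \<odot> j) p" using ij f P by (subst Res_comp) auto
    ultimately show "(f, p) \<in> \<tau>" using ij(6) f P by simp
  qed
  show ?thesis
  proof (rule small_set_inj_on[OF universe small_set_Pow[OF universe B]])
    show "inj_on (\<lambda>\<sigma>. \<sigma> \<inter> ?B) {\<sigma>. local_section X \<sigma>}"
    proof (rule inj_onI, unfold mem_Collect_eq)
      fix \<sigma> \<tau> assume "local_section X \<sigma>" "local_section X \<tau>" "\<sigma> \<inter> ?B = \<tau> \<inter> ?B"
      then show "\<sigma> = \<tau>" using sub[of \<sigma> \<tau>] sub[of \<tau> \<sigma>] by simp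
    qed
  qed auto
qed

lemma sheafification_exists:
  assumes PU: "P \<in> presheaves U C"
  obtains A \<eta> where "A \<in> presheaves U C" "sheaf A" "\<eta> \<in> NatT C P A" "locally_injective P \<eta>"
    "locally_surjective P A \<eta>"
proof -
  interpret sheafification C cov P by unfold_locales (rule presheaves_D[OF PU])
  obtain A \<theta> where A: "A \<in> presheaves U C" and t: "\<theta> \<in> NatT C section_presheaf A"
    and bij: "\<And>X. X \<in> Obj C \<Longrightarrow> bij_betw (\<theta> X) (Ev section_presheaf X) (Ev A X)"
    using small_local_sections[OF PU] is_presheaf_sections
    by (elim encode_presheaf[of _ U]) (auto simp: section_presheaf_simps)
  note Ap = presheaves_D[OF A] and Pp = P
  let ?\<eta> = "nat_comp C P \<theta> unit"
  have eta: "?\<eta> \<in> NatT C P A" using nat_comp_NatT[OF unit_NatT t Pp] .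
  have inj: "\<sigma> = \<tau>"
    if "X \<in> Obj C" "\<sigma> \<in> Ev section_presheaf X" "\<tau> \<in> Ev section_presheaf X" "\<theta> X \<sigma> = \<theta> X \<tau>" for X \<sigma> \<tau>
    using bij[OF that(1)] that by (auto simp: bij_betw_def inj_on_def)
  have "sheaf A"
    using sheaf_for_iso[OF t is_presheaf_sections Ap bij] sheaf_sections Ap cov_sieve
      by (auto simp: sheaf_def)
  moreover have "locally_injective P ?\<eta>"
    unfolding locally_injective_def
  proof (intro ballI impI)
    fix X p q assume X: "X \<in> Obj C" and p: "p \<in> Ev P X" "q \<in> Ev P X" and e: "?\<eta> X p = ?\<eta> X q"
    have "unit X p = unit X q"
      using inj[OF X NatT_app[OF unit_NatT X] NatT_app[OF unit_NatT X]] p e X by simp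
    then show "cov X (equalizer_sieve P X p q)"
      using unit_locally_injective X p by (auto simp: locally_injective_def)
  qed
  moreover have "locally_surjective P A ?\<eta>"
    unfolding locally_surjective_def
  proof (intro ballI)
    fix X a assume X: "X \<in> Obj C" and a: "a \<in> Ev A X"
    obtain \<sigma> where s: "\<sigma> \<in> Ev section_presheaf X" "a = \<theta> X \<sigma>"
      using bij[OF X] a by (auto simp: bij_betw_def)
    show "cov X (lift_sieve P A ?\<eta> X a)"
    proof (rule cov_mono[OF _ is_sieve_lift[OF Pp Ap eta X a]])
      show "cov X (lift_sieve P section_presheaf unit X \<sigma>)"
        using unit_locally_surjective X s(1) by (auto simp: locally_surjective_def)
      show "lift_sieve P section_presheaf unit X \<sigma> \<subseteq> lift_sieve P A ?\<eta> X a"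
      proof
        fix f assume "f \<in> lift_sieve P section_presheaf unit X \<sigma>"
        then obtain p where p: "f \<in> Arr C" "Cod C f = X" "p \<in> Ev P (Dom C f)"
          "Res section_presheaf f \<sigma> = unit (Dom C f) p"
          by (auto simp: lift_sieve_def)
        then have "Res A f a = ?\<eta> (Dom C f) p" using NatT_nat[OF t p(1,2) s(1)] s(2) by simp
        then show "f \<in> lift_sieve P A ?\<eta> X a" using p by (auto simp: lift_sieve_def)
      qed
    qed
  qed
  ultimately show thesis using A eta by (intro that)
qed

end

section \<open>Representables and pointwise limits\<close>

abbreviation component :: "('o, 'm, 'v) presheaf_arr \<Rightarrow> 'o \<Rightarrow> 'v \<Rightarrow> 'v" where
  "component a \<equiv> fst (snd a)"

context site_cat
begin

lemma Hom_component: "a \<in> Hom (psh_cat U C) P Q \<Longrightarrow> component a \<in> NatT C P Q"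
  by (auto simp: Hom_psh_cat)

lemma Hom_presheaf: "a \<in> Hom (psh_cat U C) P Q \<Longrightarrow> P \<in> presheaves U C"
  "a \<in> Hom (psh_cat U C) P Q \<Longrightarrow> Q \<in> presheaves U C"
  by (auto simp: Hom_psh_cat)

lemma component_Comp: "a \<in> Hom (psh_cat U C) P Q \<Longrightarrow> b \<in> Hom (psh_cat U C) Q R \<Longrightarrow> X \<in> Obj C \<Longrightarrow> x \<in> Ev P X \<Longrightarrow>
    component (Comp (psh_cat U C) b a) X x = component b X (component a X x)"
  by (auto simp: Hom_psh_cat)

lemma Hom_eqI: "a \<in> Hom (psh_cat U C) P Q \<Longrightarrow> b \<in> Hom (psh_cat U C) P Q \<Longrightarrow>
    (\<And>X x. X \<in> Obj C \<Longrightarrow> x \<in> Ev P X \<Longrightarrow> component a X x = component b X x) \<Longrightarrow> a = b"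
  by (auto simp: Hom_psh_cat intro: NatT_eqI)

lemma component_app: "a \<in> Hom (psh_cat U C) P Q \<Longrightarrow> X \<in> Obj C \<Longrightarrow> x \<in> Ev P X \<Longrightarrow> component a X x \<in> Ev Q X"
  by (rule NatT_app[OF Hom_component])

lemma component_nat: "a \<in> Hom (psh_cat U C) P Q \<Longrightarrow> f \<in> Arr C \<Longrightarrow> Cod C f = X \<Longrightarrow> x \<in> Ev P X \<Longrightarrow>
    component a (Dom C f) (Res P f x) = Res Q f (component a X x)"
  by (rule NatT_nat[OF Hom_component])

definition pointwise_limit ::
  "('i, 'k) cat \<Rightarrow> ('i, 'k, ('o, 'm, 'v) presheaf, ('o, 'm, 'v) presheaf_arr) functr \<Rightarrow>
    ('o, 'm, 'v) presheaf \<Rightarrow> ('i \<Rightarrow> ('o, 'm, 'v) presheaf_arr) \<Rightarrow> bool" where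
  "pointwise_limit K D X p \<longleftrightarrow> (\<forall>c\<in>Obj C. \<forall>s. (\<forall>i\<in>Obj K. s i \<in> Ev (FObj D i) c) \<longrightarrow>
     (\<forall>k\<in>Arr K. component (FArr D k) c (s (Dom K k)) = s (Cod K k)) \<longrightarrow>
     (\<exists>!x. x \<in> Ev X c \<and> (\<forall>i\<in>Obj K. component (p i) c x = s i)))"

lemma pointwise_limitD:
  assumes "pointwise_limit K D X p" "c \<in> Obj C" "\<And>i. i \<in> Obj K \<Longrightarrow> s i \<in> Ev (FObj D i) c"
    "\<And>k. k \<in> Arr K \<Longrightarrow> component (FArr D k) c (s (Dom K k)) = s (Cod K k)"
  shows "\<exists>!x. x \<in> Ev X c \<and> (\<forall>i\<in>Obj K. component (p i) c x = s i)"
  using assms unfolding pointwise_limit_def by blast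

lemma limit_of_pointwise_limit:
  fixes U :: "'v set set"
  assumes I: "I \<subseteq> presheaves U C"
    and K: "category K" and D: "is_functor K (full_subcat (psh_cat U C) I) D"
    and cone: "is_cone K (full_subcat (psh_cat U C) I) D X p" and lim: "pointwise_limit K D X p"
  shows "is_limit K (full_subcat (psh_cat U C) I) D X p"
  unfolding is_limit_def
proof (intro conjI cone allI impI)
  let ?A = "psh_cat U C"
  fix Y q assume q: "is_cone K (full_subcat ?A I) D Y q"
  have YI: "Y \<in> I" and XI: "X \<in> I" using q cone by (auto simp: is_cone_def)
  have qH: "q i \<in> Hom ?A Y (FObj D i)" and pH: "p i \<in> Hom ?A X (FObj D i)" if "i \<in> Obj K" for i
    using q cone that by (auto simp: is_cone_def Hom_full_subcat)
  have DH: "FArr D k \<in> Hom ?A (FObj D (Dom K k)) (FObj D (Cod K k))" if "k \<in> Arr K" for k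
    using D that by (auto simp: is_functor_def Hom_full_subcat)
  have qk: "Comp ?A (FArr D k) (q (Dom K k)) = q (Cod K k)" if "k \<in> Arr K" for k
    using q that by (auto simp: is_cone_def)
  have KD: "Dom K k \<in> Obj K" "Cod K k \<in> Obj K" if "k \<in> Arr K" for k
    using K that by (auto simp: category_def)
  show "\<exists>!u. u \<in> Hom (full_subcat ?A I) Y X \<and> (\<forall>i\<in>Obj K. Comp (full_subcat ?A I) (p i) u = q i)"
  proof -
    have Y: "Y \<in> presheaves U C" and X: "X \<in> presheaves U C" using I YI XI by auto
    note Yp = presheaves_D[OF Y] and Xp = presheaves_D[OF X]
    have ex1: "\<exists>!x. x \<in> Ev X c \<and> (\<forall>i\<in>Obj K. component (p i) c x = component (q i) c y)" if c: "c \<in> Obj C"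
      and y: "y \<in> Ev Y c" for c y
    proof -
      have "component (FArr D k) c (component (q (Dom K k)) c y) = component (q (Cod K k)) c y" if k: "k \<in> Arr K" for k
        using component_Comp[OF qH[OF KD(1)[OF k]] DH[OF k] c y] qk[OF k] by simp
      then show ?thesis using lim c component_app[OF qH c y] unfolding pointwise_limit_def by simp
    qed
    define u where "u c y = (THE x. x \<in> Ev X c \<and> (\<forall>i\<in>Obj K. component (p i) c x = component (q i) c y))" for c y
    have u: "u c y \<in> Ev X c" "i \<in> Obj K \<Longrightarrow> component (p i) c (u c y) = component (q i) c y"
      if "c \<in> Obj C" "y \<in> Ev Y c" for c y i
      using theI'[OF ex1[OF that]] unfolding u_def by auto
    have uu: "x = u c y"
      if "c \<in> Obj C" "y \<in> Ev Y c" "x \<in> Ev X c" "\<And>i. i \<in> Obj K \<Longrightarrow> component (p i) c x = component (q i) c y"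
      for c x y
      using ex1[OF that(1,2)] u[OF that(1,2)] that(3,4) by blast
    have uN: "mk_nat C Y u \<in> NatT C Y X"
    proof (rule mk_nat_NatT[OF u(1) _ Yp])
      fix f y assume f: "f \<in> Arr C" and y: "y \<in> Ev Y (Cod C f)"
      have uy: "u (Cod C f) y \<in> Ev X (Cod C f)" using u(1) f y by simp
      show "u (Dom C f) (Res Y f y) = Res X f (u (Cod C f) y)"
      proof (rule uu[symmetric])
        fix i assume i: "i \<in> Obj K"
        show "component (p i) (Dom C f) (Res X f (u (Cod C f) y)) = component (q i) (Dom C f) (Res Y f y)"
          using component_nat[OF pH[OF i] f refl uy] component_nat[OF qH[OF i] f refl y] u(2)[OF _ y i] f by simp
      qed (use f y uy Xp Yp in auto)
    qed
    have mH: "(Y, mk_nat C Y u, X) \<in> Hom ?A Y X" using uN X Y by (simp add: Hom_psh_cat)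
    show ?thesis
    proof (rule ex1I[of _ "(Y, mk_nat C Y u, X)"], intro conjI ballI)
      show "(Y, mk_nat C Y u, X) \<in> Hom (full_subcat ?A I) Y X"
        using mH YI XI by (simp add: Hom_full_subcat)
      fix i assume i: "i \<in> Obj K"
      have "Comp ?A (p i) (Y, mk_nat C Y u, X) = q i"
        by (rule Hom_eqI[OF Comp_Hom[OF category_psh_cat mH pH[OF i]] qH[OF i]])
          (use component_Comp[OF mH pH[OF i]] u(2) i in simp)
      then show "Comp (full_subcat ?A I) (p i) (Y, mk_nat C Y u, X) = q i" by simp
    next
      fix v assume v: "v \<in> Hom (full_subcat ?A I) Y X \<and> (\<forall>i\<in>Obj K. Comp (full_subcat ?A I) (p i) v =
        q i)"
      then have vH: "v \<in> Hom ?A Y X" and vq: "\<And>i. i \<in> Obj K \<Longrightarrow> Comp ?A (p i) v = q i"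
        by (auto simp: Hom_full_subcat)
      show "v = (Y, mk_nat C Y u, X)"
      proof (rule Hom_eqI[OF vH mH])
        fix c y assume c: "c \<in> Obj C" and y: "y \<in> Ev Y c"
        have "component v c y = u c y"
          by (rule uu[OF c y component_app[OF vH c y]]) (use component_Comp[OF vH pH c y] vq in simp)
        then show "component v c y = component (Y, mk_nat C Y u, X) c y" using c y by simp
      qed
    qed
  qed
qed

end

context small_site
begin

text \<open>The Yoneda lemma, for a copy \<open>Y\<close> of \<open>y(X)\<close> with values in the universe; \<open>u\<close> stands for the
  identity of \<open>X\<close>.\<close>

lemma representable:
  assumes X: "X \<in> Obj C"
  obtains Y u where "Y \<in> presheaves U C" "u \<in> Ev Y X"
    "\<And>Z. Z \<in> Obj C \<Longrightarrow> bij_betw (\<lambda>f. Res Y f u) (Hom C Z X) (Ev Y Z)"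
    "\<And>Q q. Q \<in> presheaves U C \<Longrightarrow> q \<in> Ev Q X \<Longrightarrow> \<exists>a\<in>Hom (psh_cat U C) Y Q. component a X u = q"
    "\<And>Q a b. a \<in> Hom (psh_cat U C) Y Q \<Longrightarrow> b \<in> Hom (psh_cat U C) Y Q \<Longrightarrow> component a X u = component b X u \<Longrightarrow> a = b"
proof -
  have yp: "is_presheaf C (yoneda C X)" using sieves_D(1)[OF yoneda_sieve(1)[OF X]] .
  obtain Y \<theta> where Y: "Y \<in> presheaves U C" and t: "\<theta> \<in> NatT C (yoneda C X) Y"
    and bij: "\<And>Z. Z \<in> Obj C \<Longrightarrow> bij_betw (\<theta> Z) (Ev (yoneda C X) Z) (Ev Y Z)"
    using small_Hom X encode_presheaf[OF yp, of U] by (metis (no_types, lifting) yoneda_simps(1))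
  note Yp = presheaves_D[OF Y]
  define u where "u = \<theta> X (Ident C X)"
  have id: "Ident C X \<in> Ev (yoneda C X) X" using X by (simp add: yoneda_simps Hom_def)
  have u: "u \<in> Ev Y X" unfolding u_def by (rule NatT_app[OF t X id])
  have th: "Res Y f u = \<theta> (Dom C f) f" if "f \<in> Arr C" "Cod C f = X" for f
    using NatT_nat[OF t that id] that X by (simp add: u_def yoneda_simps Hom_def)
  have b: "bij_betw (\<lambda>f. Res Y f u) (Hom C Z X) (Ev Y Z)" if Z: "Z \<in> Obj C" for Z
    using bij[OF Z] th by (subst bij_betw_cong[of _ _ "\<theta> Z"]) (auto simp: yoneda_simps Z Hom_def)
  have gen: "\<exists>f. f \<in> Arr C \<and> Dom C f = Z \<and> Cod C f = X \<and> y = Res Y f u"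
    if "Z \<in> Obj C" "y \<in> Ev Y Z" for Z y
    using b[OF that(1)] that(2) by (auto simp: bij_betw_def Hom_def)
  have inj: "f = g"
    if "f \<in> Arr C" "g \<in> Arr C" "Cod C f = X" "Cod C g = X" "Dom C f = Dom C g"
    "Res Y f u = Res Y g u" for f g
    using b[of "Dom C g"] that by (auto simp: bij_betw_def inj_on_def Hom_def)
  have ex: "\<exists>a\<in>Hom (psh_cat U C) Y Q. component a X u = q" if Q: "Q \<in> presheaves U C"
    and q: "q \<in> Ev Q X" for Q q
  proof -
    note Qp = presheaves_D[OF Q]
    define d where "d Z y = (SOME f. f \<in> Arr C \<and> Dom C f = Z \<and> Cod C f = X \<and> y = Res Y f u)" for Z y
    have d: "d Z y \<in> Arr C" "Dom C (d Z y) = Z" "Cod C (d Z y) = X" "Res Y (d Z y) u = y"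
      if "Z \<in> Obj C" "y \<in> Ev Y Z" for Z y
      using someI_ex[OF gen[OF that]] unfolding d_def by auto
    have dd: "d (Dom C f) (Res Y f u) = f" if "f \<in> Arr C" "Cod C f = X" for f
      using that d[of "Dom C f" "Res Y f u"] u Yp by (intro inj) auto
    have N: "mk_nat C Y (\<lambda>Z y. Res Q (d Z y) q) \<in> NatT C Y Q"
    proof (rule mk_nat_NatT[OF _ _ Yp])
      fix Z y assume "Z \<in> Obj C" "y \<in> Ev Y Z"
      then show "Res Q (d Z y) q \<in> Ev Q Z" using d[of Z y] q Qp by simp
    next
      fix f y assume f: "f \<in> Arr C" and y: "y \<in> Ev Y (Cod C f)"
      let ?g = "d (Cod C f) y"
      have g: "?g \<in> Arr C" "Dom C ?g = Cod C f" "Cod C ?g = X" "Res Y ?g u = y"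
        using d[OF _ y] f by auto
      have "Res Y f y = Res Y (?g \<odot> f) u" using g f u Yp by simp
      then have "d (Dom C f) (Res Y f y) = ?g \<odot> f" using dd[of "?g \<odot> f"] g f by simp
      then show "Res Q (d (Dom C f) (Res Y f y)) q = Res Q f (Res Q ?g q)" using g f q Qp by simp
    qed
    have "d X u = Ident C X" using dd[of "Ident C X"] X u Yp by simp
    then have "mk_nat C Y (\<lambda>Z y. Res Q (d Z y) q) X u = q" using X u q Qp by simp
    then show ?thesis
      using N Y Q by (intro bexI[of _ "(Y, mk_nat C Y (\<lambda>Z y. Res Q (d Z y) q), Q)"]) (auto simp:
        Hom_psh_cat)
  qed
  have un: "a = b" if a: "a \<in> Hom (psh_cat U C) Y Q" and b: "b \<in> Hom (psh_cat U C) Y Q"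
    and e: "component a X u = component b X u" for Q a b
  proof (rule Hom_eqI[OF a b])
    fix Z y assume "Z \<in> Obj C" "y \<in> Ev Y Z"
    then obtain f where f: "f \<in> Arr C" "Dom C f = Z" "Cod C f = X" "y = Res Y f u"
      using gen by blast
    then show "component a Z y = component b Z y"
      using component_nat[OF a f(1,3) u] component_nat[OF b f(1,3) u] e by simp
  qed
  show thesis by (rule that[OF Y u b ex un])
qed

text \<open>Elements over \<open>c\<close> are arrows from the representable of \<open>c\<close>, so that compatible families of
  elements are cones.\<close>

lemma pointwise_limit_of_limit:
  assumes K: "category K" and D: "is_functor K (psh_cat U C) D"
    and lim: "is_limit K (psh_cat U C) D X p"
  shows "pointwise_limit K D X p"
  unfolding pointwise_limit_def
proof (intro ballI allI impI)
  let ?A = "psh_cat U C"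
  have pH: "p i \<in> Hom ?A X (FObj D i)" if "i \<in> Obj K" for i
    using lim that by (auto simp: is_limit_def is_cone_def)
  have X: "X \<in> presheaves U C" using lim by (auto simp: is_limit_def is_cone_def)
  have pk: "Comp ?A (FArr D k) (p (Dom K k)) = p (Cod K k)" if "k \<in> Arr K" for k
    using lim that by (auto simp: is_limit_def is_cone_def)
  have DH: "FArr D k \<in> Hom ?A (FObj D (Dom K k)) (FObj D (Cod K k))" if "k \<in> Arr K" for k
    using D that by (auto simp: is_functor_def)
  have KD: "Dom K k \<in> Obj K" "Cod K k \<in> Obj K" if "k \<in> Arr K" for k
    using K that by (auto simp: category_def)
  have DO: "FObj D i \<in> presheaves U C" if "i \<in> Obj K" for i
    using D that by (auto simp: is_functor_def)
  fix c s assume c: "c \<in> Obj C" and s: "\<forall>i\<in>Obj K. s i \<in> Ev (FObj D i) c"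
    and sk: "\<forall>k\<in>Arr K. component (FArr D k) c (s (Dom K k)) = s (Cod K k)"
  obtain Y u where Y: "Y \<in> presheaves U C" and u: "u \<in> Ev Y c"
    and ex: "\<And>Q q. Q \<in> presheaves U C \<Longrightarrow> q \<in> Ev Q c \<Longrightarrow> \<exists>a\<in>Hom ?A Y Q. component a c u = q"
    and un: "\<And>Q a b. a \<in> Hom ?A Y Q \<Longrightarrow> b \<in> Hom ?A Y Q \<Longrightarrow> component a c u = component b c u \<Longrightarrow> a = b"
    using representable[OF c] by metis
  have "\<forall>i\<in>Obj K. \<exists>a. a \<in> Hom ?A Y (FObj D i) \<and> component a c u = s i" using ex DO s by blast
  then obtain q where qH: "\<And>i. i \<in> Obj K \<Longrightarrow> q i \<in> Hom ?A Y (FObj D i)"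
    and qu: "\<And>i. i \<in> Obj K \<Longrightarrow> component (q i) c u = s i"
    by metis
  have "is_cone K ?A D Y q"
    unfolding is_cone_def
  proof (intro conjI ballI)
    show "Y \<in> Obj ?A" using Y by simp
    show "q i \<in> Hom ?A Y (FObj D i)" if "i \<in> Obj K" for i using qH that .
    fix k assume k: "k \<in> Arr K"
    note q1 = qH[OF KD(1)[OF k]]
    show "Comp ?A (FArr D k) (q (Dom K k)) = q (Cod K k)"
      by (rule un[OF Comp_Hom[OF category_psh_cat q1 DH[OF k]] qH[OF KD(2)[OF k]]])
        (use component_Comp[OF q1 DH[OF k] c u] qu KD[OF k] sk k in simp)
  qed
  then have ex1: "\<exists>!w. w \<in> Hom ?A Y X \<and> (\<forall>i\<in>Obj K. Comp ?A (p i) w = q i)"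
    using lim by (auto simp: is_limit_def)
  have iff: "(\<forall>i\<in>Obj K. Comp ?A (p i) w = q i) \<longleftrightarrow> (\<forall>i\<in>Obj K. component (p i) c (component w c u) = s i)"
    if w: "w \<in> Hom ?A Y X" for w
  proof (intro ball_cong refl)
    fix i assume i: "i \<in> Obj K"
    show "Comp ?A (p i) w = q i \<longleftrightarrow> component (p i) c (component w c u) = s i"
      using component_Comp[OF w pH[OF i] c u] qu[OF i] un[OF Comp_Hom[OF category_psh_cat w pH[OF i]] qH[OF
        i]] by auto
  qed
  obtain w where w: "w \<in> Hom ?A Y X" "\<forall>i\<in>Obj K. Comp ?A (p i) w = q i" using ex1 by blast
  show "\<exists>!x. x \<in> Ev X c \<and> (\<forall>i\<in>Obj K. component (p i) c x = s i)"
  proof (rule ex1I[of _ "component w c u"])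
    show "component w c u \<in> Ev X c \<and> (\<forall>i\<in>Obj K. component (p i) c (component w c u) = s i)"
      using component_app[OF w(1) c u] iff[OF w(1)] w(2) by blast
    fix x assume x: "x \<in> Ev X c \<and> (\<forall>i\<in>Obj K. component (p i) c x = s i)"
    then obtain v where v: "v \<in> Hom ?A Y X" "component v c u = x" using ex[OF X] by blast
    then have "\<forall>i\<in>Obj K. Comp ?A (p i) v = q i" using iff[OF v(1)] x by simp
    then have "v = w" using ex1 v(1) w by blast
    then show "x = component w c u" using v(2) by simp
  qed
qed

end

section \<open>Sheaves form a subtopos\<close>

context small_topology
begin

text \<open>Let \<open>K'\<close> and \<open>Y\<close> be copies of \<open>S\<close> and \<open>y(X)\<close>, with sheafifications \<open>A\<close> and \<open>B\<close>, and
  \<open>\<psi> : A \<rightarrow> B\<close> the morphism induced by \<open>S \<subseteq> y(X)\<close>. As \<open>A\<close> is a sheaf for \<open>S\<close>, there is \<open>a \<in> A(X)\<close>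
  whose restrictions to \<open>S\<close> are the elements of \<open>S\<close>, and \<open>\<psi>(a)\<close> is the identity of \<open>X\<close> since \<open>B\<close> is
  a sheaf for \<open>S\<close>. Locally \<open>a\<close> comes from \<open>S\<close>, hence locally the identity of \<open>X\<close> equals an element
    of
  \<open>S\<close>.\<close>

lemma cov_of_sheaf_for:
  assumes S: "is_sieve X S"
    and sh: "\<And>P :: ('o, 'm, 'v) presheaf. P \<in> presheaves U C \<Longrightarrow> sheaf P \<Longrightarrow> sheaf_for P X S"
  shows "cov X S"
proof -
  let ?A = "psh_cat U C"
  let ?K = "sieve_presheaf X S"
  note SD = is_sieveD(2-4)[OF S]
  have X: "X \<in> Obj C" by (rule is_sieveD(1)[OF S])
  have Kp: "is_presheaf C ?K" by (rule is_presheaf_sieve[OF S])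
  have "small_set U (Ev ?K Z)" if Z: "Z \<in> Obj C" for Z
    using SD by (intro small_set_subset[OF universe small_Hom[OF Z X]]) (auto simp:
      sieve_presheaf_simps Z Hom_def)
  then obtain K' \<kappa> where K': "K' \<in> presheaves U C" and k: "\<kappa> \<in> NatT C ?K K'"
    and bij: "\<And>Z. Z \<in> Obj C \<Longrightarrow> bij_betw (\<kappa> Z) (Ev ?K Z) (Ev K' Z)"
    using encode_presheaf[OF Kp, of U] by metis
  note K'p = presheaves_D[OF K']
  obtain A e where A: "A \<in> presheaves U C" "sheaf A" and e: "e \<in> NatT C K' A"
    and li: "locally_injective K' e" and ls: "locally_surjective K' A e"
    using sheafification_exists[OF K'] by metis
  note Ap = presheaves_D[OF A(1)]
  obtain Y u where Y: "Y \<in> presheaves U C" and u: "u \<in> Ev Y X"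
    and bijY: "\<And>Z. Z \<in> Obj C \<Longrightarrow> bij_betw (\<lambda>f. Res Y f u) (Hom C Z X) (Ev Y Z)"
    using representable[OF X] by metis
  note Yp = presheaves_D[OF Y]
  obtain B z where B: "B \<in> presheaves U C" "sheaf B" and z: "z \<in> NatT C Y B"
    and liY: "locally_injective Y z"
    using sheafification_exists[OF Y] by metis
  note Bp = presheaves_D[OF B(1)]
  have Kmem: "f \<in> Ev ?K (Dom C f)" if "f \<in> S" for f
    using SD(1)[OF that] that by (simp add: sieve_presheaf_simps)
  have km: "\<kappa> (Dom C f) f \<in> Ev K' (Dom C f)" if "f \<in> S" for f
    using NatT_app[OF k _ Kmem[OF that]] SD(1)[OF that] by simp
  have kn: "\<kappa> (Dom C g) (f \<odot> g) = Res K' g (\<kappa> (Dom C f) f)"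
    if "f \<in> S" "g \<in> Arr C" "Cod C g = Dom C f" for f g
    using NatT_nat[OF k that(2,3) Kmem[OF that(1)]] sieve_presheaf_simps(2)[OF that(2,1) _ S]
      that(3) by simp
  obtain d where d: "d \<in> NatT C K' ?K" "\<And>Z f. Z \<in> Obj C \<Longrightarrow> f \<in> Ev ?K Z \<Longrightarrow> d Z (\<kappa> Z f) = f"
    "\<And>Z y. Z \<in> Obj C \<Longrightarrow> y \<in> Ev K' Z \<Longrightarrow> \<kappa> Z (d Z y) = y"
    using NatT_inverse[OF k Kp K'p bij] by metis
  have jN: "mk_nat C K' (\<lambda>Z y. z Z (Res Y (d Z y) u)) \<in> NatT C K' B" (is "?j \<in> _")
  proof (rule mk_nat_NatT[OF _ _ K'p])
    have dS: "d Z y \<in> S" "Dom C (d Z y) = Z" if "Z \<in> Obj C" "y \<in> Ev K' Z" for Z y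
      using NatT_app[OF d(1) that] that by (auto simp: sieve_presheaf_simps)
    show "z Z (Res Y (d Z y) u) \<in> Ev B Z" if Zy: "Z \<in> Obj C" "y \<in> Ev K' Z" for Z y
      using dS[OF Zy] SD(1,2)[OF dS(1)[OF Zy]] u Yp Zy by (intro NatT_app[OF z]) auto
    fix f y assume f: "f \<in> Arr C" and y: "y \<in> Ev K' (Cod C f)"
    let ?g = "d (Cod C f) y"
    have g: "?g \<in> S" "Dom C ?g = Cod C f" using dS[OF _ y] f by auto
    have ga: "?g \<in> Arr C" "Cod C ?g = X" using SD g(1) by auto
    have "d (Dom C f) (Res K' f y) = ?g \<odot> f"
      using NatT_nat[OF d(1) f refl y] sieve_presheaf_simps(2)[OF f g S] by simp
    then show "z (Dom C f) (Res Y (d (Dom C f) (Res K' f y)) u) =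
      Res B f (z (Cod C f) (Res Y ?g u))"
      using NatT_nat[OF z f refl, of "Res Y ?g u"] ga g f u Yp by simp
  qed
  obtain \<psi> where psi: "\<psi> \<in> NatT C A B" "\<And>Z y. Z \<in> Obj C \<Longrightarrow> y \<in> Ev K' Z \<Longrightarrow> \<psi> Z (e Z y) = ?j Z y"
    using extend_along_locally_bijective[OF K'p Ap e li ls B(2) jN] by blast
  have psi_e: "\<psi> (Dom C f) (e (Dom C f) (\<kappa> (Dom C f) f)) = z (Dom C f) (Res Y f u)"
    if f: "f \<in> S" for f
    using psi(2)[OF _ km[OF f]] km[OF f] SD(1)[OF f] d(2)[OF _ Kmem[OF f]] by simp
  have "matching A S (\<lambda>f. e (Dom C f) (\<kappa> (Dom C f) f))"
    unfolding matching_def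
  proof (intro ballI conjI impI)
    fix f assume f: "f \<in> S"
    show "e (Dom C f) (\<kappa> (Dom C f) f) \<in> Ev A (Dom C f)"
      using NatT_app[OF e _ km[OF f]] SD(1)[OF f] by simp
    fix g assume g: "g \<in> Arr C" "Cod C g = Dom C f"
    show "e (Dom C (f \<odot> g)) (\<kappa> (Dom C (f \<odot> g)) (f \<odot> g)) = Res A g (e (Dom C f) (\<kappa> (Dom C f) f))"
      using kn[OF f g] NatT_nat[OF e g km[OF f]] SD(1)[OF f] g by simp
  qed
  from sheaf_for_ex[OF sh[OF A] this]
  obtain a where a: "a \<in> Ev A X" "\<And>f. f \<in> S \<Longrightarrow> Res A f a = e (Dom C f) (\<kappa> (Dom C f) f)" by blast
  have eq: "\<psi> X a = z X u"
  proof (rule sheaf_for_eq[OF sh[OF B] Bp S NatT_app[OF psi(1) X a(1)] NatT_app[OF z X u]])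
    fix f assume f: "f \<in> S"
    show "Res B f (\<psi> X a) = Res B f (z X u)"
      using NatT_nat[OF psi(1) SD(1,2)[OF f] a(1)] NatT_nat[OF z SD(1,2)[OF f] u] a(2)[OF f]
        psi_e[OF f] by simp
  qed
  have cov: "cov X (lift_sieve K' A e X a)" using ls X a(1) by (auto simp: locally_surjective_def)
  show ?thesis
  proof (rule cov_trans[OF cov S])
    fix g assume "g \<in> lift_sieve K' A e X a"
    then obtain y where g: "g \<in> Arr C" "Cod C g = X"
      and y: "y \<in> Ev K' (Dom C g)" "Res A g a = e (Dom C g) y"
      by (auto simp: lift_sieve_def)
    let ?f = "d (Dom C g) y"
    have f: "?f \<in> S" "Dom C ?f = Dom C g"
      using NatT_app[OF d(1) _ y(1)] g by (auto simp: sieve_presheaf_simps)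
    have fa: "?f \<in> Arr C" "Cod C ?f = X" using SD f(1) by auto
    have "z (Dom C g) (Res Y g u) = Res B g (\<psi> X a)" using NatT_nat[OF z g u] eq by simp
    also have "\<dots> = \<psi> (Dom C g) (e (Dom C g) y)" using NatT_nat[OF psi(1) g a(1)] y(2) by simp
    also have "\<dots> = z (Dom C g) (Res Y ?f u)" using psi(2)[OF _ y(1)] y(1) g by simp
    finally have "cov (Dom C g) (equalizer_sieve Y (Dom C g) (Res Y g u) (Res Y ?f u))"
      using liY g fa f u Yp by (auto simp: locally_injective_def)
    moreover have "g \<odot> h \<in> S" if "h \<in> equalizer_sieve Y (Dom C g) (Res Y g u) (Res Y ?f u)" for h
    proof -
      have h: "h \<in> Arr C" "Cod C h = Dom C g" "Res Y h (Res Y g u) = Res Y h (Res Y ?f u)"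
        using that by (auto simp: equalizer_sieve_def)
      then have "Res Y (g \<odot> h) u = Res Y (?f \<odot> h) u" using g fa f u Yp by simp
      moreover have "inj_on (\<lambda>f. Res Y f u) (Hom C (Dom C h) X)"
        using bijY[of "Dom C h"] h by (simp add: bij_betw_def)
      ultimately have "g \<odot> h = ?f \<odot> h" using g fa f h by (auto simp: inj_on_def Hom_def)
      then show ?thesis using SD(3)[OF f(1)] h f by simp
    qed
    ultimately show "\<exists>R. cov (Dom C g) R \<and> (\<forall>h\<in>R. g \<odot> h \<in> S)" by blast
  qed
qed

text \<open>A compatible family in the sheafifications comes locally, for all \<open>i\<close> simultaneously, from a family
  in the \<open>D\<^sub>i\<close>, which is again locally compatible; so it comes locally from \<open>X\<close>,
    and these elements of
  \<open>X\<close> glue in \<open>LX\<close>. That \<open>K\<close> is finite enters by the intersections of covering sieves indexed by its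
  objects and its arrows.\<close>

lemma locally_bijective_pointwise_limit:
  fixes D :: "(nat, nat, ('o, 'm, 'v) presheaf, ('o, 'm, 'v) presheaf_arr) functr"
  assumes K: "category K" "finite (Obj K)" "finite (Arr K)"
    and D: "is_functor K (psh_cat U C) D" and cone: "is_cone K (psh_cat U C) D X p"
    and lim: "pointwise_limit K D X p"
    and L: "is_functor (psh_cat U C) (psh_cat U C) L"
    and eta: "\<And>P. P \<in> presheaves U C \<Longrightarrow> \<eta> P \<in> Hom (psh_cat U C) P (FObj L P)"
    and eta_nat: "\<And>f P Q. f \<in> Hom (psh_cat U C) P Q \<Longrightarrow>
      Comp (psh_cat U C) (\<eta> Q) f = Comp (psh_cat U C) (FArr L f) (\<eta> P)"
    and li: "\<And>P. P \<in> presheaves U C \<Longrightarrow> locally_injective P (component (\<eta> P))"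
    and ls: "\<And>P. P \<in> presheaves U C \<Longrightarrow> locally_surjective P (FObj L P) (component (\<eta> P))"
    and sh: "\<And>P. P \<in> presheaves U C \<Longrightarrow> sheaf (FObj L P)"
  shows "pointwise_limit K (comp_functor L D) (FObj L X) (\<lambda>i. FArr L (p i))"
proof -
  let ?A = "psh_cat U C"
  have X: "X \<in> presheaves U C" using cone by (simp add: is_cone_def)
  have DO: "FObj D i \<in> presheaves U C" if "i \<in> Obj K" for i
    using D that by (simp add: is_functor_def)
  have LO: "FObj L P \<in> presheaves U C" if "P \<in> presheaves U C" for P
    using L that by (simp add: is_functor_def)
  have pH: "p i \<in> Hom ?A X (FObj D i)" if "i \<in> Obj K" for i
    using cone that by (simp add: is_cone_def)
  have DH: "FArr D k \<in> Hom ?A (FObj D (Dom K k)) (FObj D (Cod K k))" if "k \<in> Arr K" for k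
    using D that by (simp add: is_functor_def)
  have KD: "Dom K k \<in> Obj K" "Cod K k \<in> Obj K" if "k \<in> Arr K" for k
    using K(1) that by (auto simp: category_def)
  note LH = is_functor_Hom[OF L]
  have nat: "component (FArr L f) c (component (\<eta> P) c x) = component (\<eta> Q) c (component f c x)"
    if f: "f \<in> Hom ?A P Q" and c: "c \<in> Obj C" and x: "x \<in> Ev P c" for f P Q c x
    using component_Comp[OF eta[OF Hom_presheaf(1)[OF f]] LH[OF f] c x] component_Comp[OF f eta[OF
      Hom_presheaf(2)[OF f]] c x]
      eta_nat[OF f] by simp
  have psh: "is_presheaf C P" if "P \<in> presheaves U C" for P :: "('o, 'm, 'v) presheaf"
    using that by (rule presheaves_D)
  note Xp = psh[OF X]
  have jinj: "x = y"
    if "c \<in> Obj C" "x \<in> Ev X c" "y \<in> Ev X c" "\<And>i. i \<in> Obj K \<Longrightarrow> component (p i) c x = component (p i) c y" for c x y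
  proof -
    have "component (FArr D k) c (component (p (Dom K k)) c x) = component (p (Cod K k)) c x" if "k \<in> Arr K" for k
      using component_Comp[OF pH[OF KD(1)] DH] that \<open>c \<in> Obj C\<close> \<open>x \<in> Ev X c\<close> cone
        by (simp add: is_cone_def)
    then have "\<exists>!z. z \<in> Ev X c \<and> (\<forall>i\<in>Obj K. component (p i) c z = component (p i) c x)"
      using lim that(1) component_app[OF pH that(1,2)] unfolding pointwise_limit_def by simp
    then show ?thesis using that by metis
  qed
  \<comment> \<open>\<open>\<eta>\<^sub>X(x)\<close> is determined by the images of \<open>x\<close> in all \<open>LD\<^sub>i\<close>.\<close>
  have U: "component (\<eta> X) c x = component (\<eta> X) c y"
    if c: "c \<in> Obj C" and x: "x \<in> Ev X c" and y: "y \<in> Ev X c"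
      and e: "\<And>i. i \<in> Obj K \<Longrightarrow> component (\<eta> (FObj D i)) c (component (p i) c x) =
        component (\<eta> (FObj D i)) c (component (p i) c y)" for c x y
  proof (rule sheaf_eq[OF sh[OF X]])
    let ?E = "\<lambda>i. equalizer_sieve (FObj D i) c (component (p i) c x) (component (p i) c y)"
    have "cov c (?E i)" if i: "i \<in> Obj K" for i
      using li[OF DO[OF i]] c e[OF i] component_app[OF pH[OF i] c] x y by (simp add: locally_injective_def)
    from cov_INT[OF K(2) c this]
    show "cov c ({f \<in> Arr C. Cod C f = c} \<inter> (\<Inter>i\<in>Obj K. ?E i))" .
    show "component (\<eta> X) c x \<in> Ev (FObj L X) c" "component (\<eta> X) c y \<in> Ev (FObj L X) c"
      using component_app[OF eta[OF X] c] x y by auto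
    fix f assume f: "f \<in> {f \<in> Arr C. Cod C f = c} \<inter> (\<Inter>i\<in>Obj K. ?E i)"
    then have fa: "f \<in> Arr C" "Cod C f = c" by auto
    have "Res X f x = Res X f y"
    proof (rule jinj)
      fix i assume i: "i \<in> Obj K"
      then have "Res (FObj D i) f (component (p i) c x) = Res (FObj D i) f (component (p i) c y)"
        using f by (auto simp: equalizer_sieve_def)
      then show "component (p i) (Dom C f) (Res X f x) = component (p i) (Dom C f) (Res X f y)"
        using component_nat[OF pH[OF i] fa x] component_nat[OF pH[OF i] fa y] by simp
    qed (use fa x y Xp in auto)
    then show "Res (FObj L X) f (component (\<eta> X) c x) = Res (FObj L X) f (component (\<eta> X) c y)"
      using component_nat[OF eta[OF X] fa x] component_nat[OF eta[OF X] fa y] by simp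
  qed
  show ?thesis
    unfolding pointwise_limit_def
  proof (intro ballI allI impI)
    fix c s assume c: "c \<in> Obj C" and "\<forall>i\<in>Obj K. s i \<in> Ev (FObj (comp_functor L D) i) c"
      and "\<forall>k\<in>Arr K. component (FArr (comp_functor L D) k) c (s (Dom K k)) = s (Cod K k)"
    then have s: "\<And>i. i \<in> Obj K \<Longrightarrow> s i \<in> Ev (FObj L (FObj D i)) c"
      and sk: "\<And>k. k \<in> Arr K \<Longrightarrow> component (FArr L (FArr D k)) c (s (Dom K k)) = s (Cod K k)"
      by (auto simp: comp_functor_def)
    define R where "R = {f \<in> Arr C. Cod C f = c \<and> (\<exists>x\<in>Ev X (Dom C f). \<forall>i\<in>Obj K.
      Res (FObj L (FObj D i)) f (s i) = component (\<eta> (FObj D i)) (Dom C f) (component (p i) (Dom C f) x))}"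
    have Rsv: "is_sieve c R"
    proof (rule is_sieveI[OF c])
      fix f g assume "f \<in> R" and g: "g \<in> Arr C" "Cod C g = Dom C f"
      then obtain x where f: "f \<in> Arr C" "Cod C f = c" and x: "x \<in> Ev X (Dom C f)"
        and e: "\<And>i. i \<in> Obj K \<Longrightarrow> Res (FObj L (FObj D i)) f (s i) =
          component (\<eta> (FObj D i)) (Dom C f) (component (p i) (Dom C f) x)"
        by (auto simp: R_def)
      have "Res (FObj L (FObj D i)) (f \<odot> g) (s i) =
        component (\<eta> (FObj D i)) (Dom C g) (component (p i) (Dom C g) (Res X g x))"
        if i: "i \<in> Obj K" for i
        using component_nat[OF pH[OF i] g x] component_nat[OF eta[OF DO[OF i]] g component_app[OF pH[OF i] Dom_obj[OF
          f(1)] x]] e[OF i] f g s[OF i]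
          psh[OF LO[OF DO[OF i]]] by simp
      moreover have "Res X g x \<in> Ev X (Dom C g)" using g x Xp by simp
      ultimately show "f \<odot> g \<in> R" using f g unfolding R_def by auto
    qed (auto simp: R_def)
    have Rcov: "cov c R"
    proof -
      let ?S = "\<lambda>i. lift_sieve (FObj D i) (FObj L (FObj D i)) (component (\<eta> (FObj D i))) c (s i)"
      have "cov c (?S i)" if i: "i \<in> Obj K" for i
        using ls[OF DO[OF i]] c s[OF i] by (simp add: locally_surjective_def)
      from cov_INT[OF K(2) c this] show ?thesis
      proof (rule cov_trans[OF _ Rsv])
        fix f assume "f \<in> {f \<in> Arr C. Cod C f = c} \<inter> (\<Inter>i\<in>Obj K. ?S i)"
        then have f: "f \<in> Arr C" "Cod C f = c" and fS: "\<And>i. i \<in> Obj K \<Longrightarrow> f \<in> ?S i" by auto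
        have fO: "Dom C f \<in> Obj C" using f by simp
        have "\<forall>i\<in>Obj K. \<exists>x. x \<in> Ev (FObj D i) (Dom C f) \<and> Res (FObj L (FObj D i)) f (s i) =
          component (\<eta> (FObj D i)) (Dom C f) x"
          using fS unfolding lift_sieve_def by blast
        then obtain x where x: "\<And>i. i \<in> Obj K \<Longrightarrow> x i \<in> Ev (FObj D i) (Dom C f)"
          "\<And>i. i \<in> Obj K \<Longrightarrow> Res (FObj L (FObj D i)) f (s i) = component (\<eta> (FObj D i)) (Dom C f) (x i)"
          by metis
        let ?E = "\<lambda>k. equalizer_sieve (FObj D (Cod K k)) (Dom C f) (component (FArr D k) (Dom C f) (x (Dom
          K k))) (x (Cod K k))"
        have "cov (Dom C f) (?E k)" if k: "k \<in> Arr K" for k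
        proof -
          note i = KD(1)[OF k] and j = KD(2)[OF k]
          have "component (\<eta> (FObj D (Cod K k))) (Dom C f) (component (FArr D k) (Dom C f) (x (Dom K k))) =
              component (FArr L (FArr D k)) (Dom C f) (Res (FObj L (FObj D (Dom K k))) f (s (Dom K k)))"
            using nat[OF DH[OF k] fO x(1)[OF i]] x(2)[OF i] by simp
          also have "\<dots> = Res (FObj L (FObj D (Cod K k))) f (s (Cod K k))"
            using component_nat[OF LH[OF DH[OF k]] f s[OF i]] sk[OF k] by simp
          also have "\<dots> = component (\<eta> (FObj D (Cod K k))) (Dom C f) (x (Cod K k))" by (rule x(2)[OF j])
          finally show ?thesis
            using li[OF DO[OF j]] fO component_app[OF DH[OF k] fO x(1)[OF i]] x(1)[OF j]
              by (simp add: locally_injective_def)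
        qed
        from cov_INT[OF K(3) fO this]
        have cv: "cov (Dom C f) ({g \<in> Arr C. Cod C g = Dom C f} \<inter> (\<Inter>k\<in>Arr K. ?E k))" .
        have "f \<odot> g \<in> R" if g: "g \<in> {g \<in> Arr C. Cod C g = Dom C f} \<inter> (\<Inter>k\<in>Arr K. ?E k)" for g
        proof -
          have ga: "g \<in> Arr C" "Cod C g = Dom C f" and gE: "\<And>k. k \<in> Arr K \<Longrightarrow> g \<in> ?E k"
            using g by auto
          let ?y = "\<lambda>i. Res (FObj D i) g (x i)"
          have y: "?y i \<in> Ev (FObj D i) (Dom C g)" if i: "i \<in> Obj K" for i
            using x(1)[OF i] ga psh[OF DO[OF i]] by simp
          have yk: "component (FArr D k) (Dom C g) (?y (Dom K k)) = ?y (Cod K k)" if k: "k \<in> Arr K" for k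
            using component_nat[OF DH[OF k] ga x(1)[OF KD(1)[OF k]]] gE[OF k]
              by (simp add: equalizer_sieve_def)
          obtain z where z: "z \<in> Ev X (Dom C g)" "\<And>i. i \<in> Obj K \<Longrightarrow> component (p i) (Dom C g) z = ?y i"
            using pointwise_limitD[OF lim Dom_obj[OF ga(1)], of ?y, OF y yk] by blast
          have "Res (FObj L (FObj D i)) (f \<odot> g) (s i) =
            component (\<eta> (FObj D i)) (Dom C g) (component (p i) (Dom C g) z)"
            if i: "i \<in> Obj K" for i
            using z(2)[OF i] component_nat[OF eta[OF DO[OF i]] ga x(1)[OF i]] x(2)[OF i] f ga s[OF i]
              psh[OF LO[OF DO[OF i]]] by simp
          then show ?thesis using f ga z(1) by (auto simp: R_def)
        qed
        then show "\<exists>T. cov (Dom C f) T \<and> (\<forall>g\<in>T. f \<odot> g \<in> R)" using cv by blast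
      qed
    qed
    have Ra: "f \<in> Arr C" "Cod C f = c" if "f \<in> R" for f using that by (auto simp: R_def)
    have "\<forall>f\<in>R. \<exists>x. x \<in> Ev X (Dom C f) \<and> (\<forall>i\<in>Obj K.
      Res (FObj L (FObj D i)) f (s i) = component (\<eta> (FObj D i)) (Dom C f) (component (p i) (Dom C f) x))"
        by (auto simp: R_def)
    then obtain x where x: "\<And>f. f \<in> R \<Longrightarrow> x f \<in> Ev X (Dom C f)"
      "\<And>f i. f \<in> R \<Longrightarrow> i \<in> Obj K \<Longrightarrow>
        Res (FObj L (FObj D i)) f (s i) = component (\<eta> (FObj D i)) (Dom C f) (component (p i) (Dom C f) (x f))"
      by metis
    have fam: "matching (FObj L X) R (\<lambda>f. component (\<eta> X) (Dom C f) (x f))"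
      unfolding matching_def
    proof (intro ballI conjI impI)
      fix f assume f: "f \<in> R"
      show "component (\<eta> X) (Dom C f) (x f) \<in> Ev (FObj L X) (Dom C f)"
        using component_app[OF eta[OF X] _ x(1)[OF f]] Ra[OF f] by simp
      fix g assume g: "g \<in> Arr C" "Cod C g = Dom C f"
      have fg: "f \<odot> g \<in> R" using is_sieveD(4)[OF Rsv f g] .
      have fO: "Dom C f \<in> Obj C" using Ra[OF f] by simp
      have "component (\<eta> X) (Dom C g) (x (f \<odot> g)) = component (\<eta> X) (Dom C g) (Res X g (x f))"
      proof (rule U)
        fix i assume i: "i \<in> Obj K"
        have "component (\<eta> (FObj D i)) (Dom C g) (component (p i) (Dom C g) (x (f \<odot> g))) =
          Res (FObj L (FObj D i)) (f \<odot> g) (s i)"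
          using x(2)[OF fg i] Ra[OF f] g by simp
        also have "\<dots> =
          Res (FObj L (FObj D i)) g (component (\<eta> (FObj D i)) (Dom C f) (component (p i) (Dom C f) (x f)))"
          using x(2)[OF f i] Ra[OF f] g s[OF i] psh[OF LO[OF DO[OF i]]] by simp
        also have "\<dots> = component (\<eta> (FObj D i)) (Dom C g) (component (p i) (Dom C g) (Res X g (x f)))"
          using component_nat[OF pH[OF i] g x(1)[OF f]] component_nat[OF eta[OF DO[OF i]] g component_app[OF pH[OF i] fO
            x(1)[OF f]]] by simp
        finally show "component (\<eta> (FObj D i)) (Dom C g) (component (p i) (Dom C g) (x (f \<odot> g))) = \<dots>" .
      qed (use g x(1)[OF fg] x(1)[OF f] Ra[OF f] Xp in auto)
      then show "component (\<eta> X) (Dom C (f \<odot> g)) (x (f \<odot> g)) = Res (FObj L X) g (component (\<eta> X) (Dom C f) (x f))"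
        using component_nat[OF eta[OF X] g x(1)[OF f]] Ra[OF f] g by simp
    qed
    obtain t where t: "t \<in> Ev (FObj L X) c"
      "\<And>f. f \<in> R \<Longrightarrow> Res (FObj L X) f t = component (\<eta> X) (Dom C f) (x f)"
      using sheaf_ex[OF sh[OF X] Rcov fam] by blast
    have ts: "component (FArr L (p i)) c t = s i" if i: "i \<in> Obj K" for i
    proof (rule sheaf_eq[OF sh[OF DO[OF i]] Rcov component_app[OF LH[OF pH[OF i]] c t(1)] s[OF i]])
      fix f assume f: "f \<in> R"
      have fO: "Dom C f \<in> Obj C" using Ra[OF f] by simp
      show "Res (FObj L (FObj D i)) f (component (FArr L (p i)) c t) = Res (FObj L (FObj D i)) f (s i)"
        using component_nat[OF LH[OF pH[OF i]] Ra[OF f] t(1)] t(2)[OF f] nat[OF pH[OF i] fO x(1)[OF f]]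
          x(2)[OF f i] by simp
    qed
    show "\<exists>!t. t \<in> Ev (FObj L X) c \<and> (\<forall>i\<in>Obj K. component (FArr L (p i)) c t = s i)"
    proof (rule ex1I[of _ t])
      show "t \<in> Ev (FObj L X) c \<and> (\<forall>i\<in>Obj K. component (FArr L (p i)) c t = s i)" using t(1) ts by simp
      fix t' assume t': "t' \<in> Ev (FObj L X) c \<and> (\<forall>i\<in>Obj K. component (FArr L (p i)) c t' = s i)"
      let ?S = "lift_sieve X (FObj L X) (component (\<eta> X)) c"
      have cv: "cov c (?S t')" using ls[OF X] c t' by (simp add: locally_surjective_def)
      show "t' = t"
      proof (rule sheaf_eq[OF sh[OF X] cov_Int[OF Rcov cv] _ t(1)])
        fix f assume fR: "f \<in> R \<inter> ?S t'"
        then have f: "f \<in> R" by simp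
        obtain y where y: "y \<in> Ev X (Dom C f)" "Res (FObj L X) f t' = component (\<eta> X) (Dom C f) y"
          using fR by (auto simp: lift_sieve_def)
        have fO: "Dom C f \<in> Obj C" using Ra[OF f] by simp
        have "component (\<eta> X) (Dom C f) y = component (\<eta> X) (Dom C f) (x f)"
        proof (rule U[OF fO y(1) x(1)[OF f]])
          fix i assume i: "i \<in> Obj K"
          have "component (\<eta> (FObj D i)) (Dom C f) (component (p i) (Dom C f) y) =
            component (FArr L (p i)) (Dom C f) (Res (FObj L X) f t')"
            using nat[OF pH[OF i] fO y(1)] y(2) by simp
          also have "\<dots> = Res (FObj L (FObj D i)) f (s i)"
            using component_nat[OF LH[OF pH[OF i]] Ra[OF f]] t' i by simp
          finally show "component (\<eta> (FObj D i)) (Dom C f) (component (p i) (Dom C f) y) =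
            component (\<eta> (FObj D i)) (Dom C f) (component (p i) (Dom C f) (x f))"
            using x(2)[OF f i] by simp
        qed
        then show "Res (FObj L X) f t' = Res (FObj L X) f t" using y(2) t(2)[OF f] by simp
      qed (use t' in simp)
    qed
  qed
qed

lemma subtopos_of_sheaves:
  "is_subtopos U C {P \<in> presheaves U C. sheaf (P :: ('o, 'm, 'v) presheaf)}" (is "is_subtopos U C
    ?I")
proof -
  let ?A = "psh_cat U C :: (('o, 'm, 'v) presheaf, ('o, 'm, 'v) presheaf_arr) cat"
  note A = category_psh_cat[of U]
  have "\<forall>P\<in>presheaves U C. \<exists>R. (fst R :: ('o, 'm, 'v) presheaf) \<in> presheaves U C \<and> sheaf (fst R) \<and>
    snd R \<in> NatT C P (fst R) \<and>
    locally_injective P (snd R) \<and> locally_surjective P (fst R) (snd R)"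
    using sheafification_exists by (metis fst_conv snd_conv)
  then obtain R where R: "\<And>P. P \<in> presheaves U C \<Longrightarrow> fst (R P) \<in> presheaves U C \<and> sheaf (fst (R P)) \<and>
    snd (R P) \<in> NatT C P (fst (R P)) \<and>
    locally_injective P (snd (R P)) \<and> locally_surjective P (fst (R P)) (snd (R P) :: 'o \<Rightarrow> 'v \<Rightarrow> 'v)"
    by metis
  define r where "r P = fst (R P)" for P
  define h where "h P = snd (R P)" for P
  have r: "r P \<in> presheaves U C" "sheaf (r P)"
    and h: "h P \<in> NatT C P (r P)" "locally_injective P (h P)"
    "locally_surjective P (r P) (h P)" if "P \<in> presheaves U C" for P
    using R[OF that] by (auto simp: r_def h_def)
  define \<eta> where "\<eta> P = (P, h P, r P)" for P
  have eta: "\<eta> P \<in> Hom ?A P (r P)" if "P \<in> presheaves U C" for P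
    using h(1)[OF that] r(1)[OF that] that by (simp add: Hom_psh_cat \<eta>_def)
  have univ: "\<exists>!g. g \<in> Hom ?A (r P) Q \<and> Comp ?A g (\<eta> P) = f"
    if P: "P \<in> Obj ?A" and Q: "Q \<in> ?I" and f: "f \<in> Hom ?A P Q" for P Q f
  proof -
    have PU: "P \<in> presheaves U C" and QU: "Q \<in> presheaves U C" "sheaf Q" using P Q by auto
    note Pp = presheaves_D[OF PU] and rp = presheaves_D[OF r(1)[OF PU]]
    obtain \<psi> where psi: "\<psi> \<in> NatT C (r P) Q"
      "\<And>X x. X \<in> Obj C \<Longrightarrow> x \<in> Ev P X \<Longrightarrow> \<psi> X (h P X x) = component f X x"
      using extend_along_locally_bijective[OF Pp rp h[OF PU] QU(2) Hom_component[OF f]] by blast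
    have pH: "(r P, \<psi>, Q) \<in> Hom ?A (r P) Q" using psi(1) r(1)[OF PU] QU by (simp add: Hom_psh_cat)
    show ?thesis
    proof (rule ex1I[of _ "(r P, \<psi>, Q)"], intro conjI pH)
      show "Comp ?A (r P, \<psi>, Q) (\<eta> P) = f"
        by (rule Hom_eqI[OF Comp_Hom[OF A eta[OF PU] pH] f]) (use psi(2) in \<open>simp add: \<eta>_def\<close>)
      fix g assume g: "g \<in> Hom ?A (r P) Q \<and> Comp ?A g (\<eta> P) = f"
      then have gH: "g \<in> Hom ?A (r P) Q" by simp
      have "component g = \<psi>"
      proof (rule locally_surjective_eq[OF h(3)[OF PU] rp h(1)[OF PU] QU(2) Hom_component[OF gH] psi(1)])
        fix X x assume X: "X \<in> Obj C" and x: "x \<in> Ev P X"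
        have "component g X (h P X x) = component f X x"
          using component_Comp[OF eta[OF PU] gH X x] g by (simp add: \<eta>_def)
        then show "component g X (h P X x) = \<psi> X (h P X x)" using psi(2)[OF X x] by simp
      qed
      then show "g = (r P, \<psi>, Q)" using gH by (auto simp: Hom_psh_cat)
    qed
  qed
  have I: "?I \<subseteq> Obj ?A" by auto
  obtain L where refl: "reflection ?A ?I L \<eta>" and Lr: "\<And>P. FObj L P = r P"
    using reflection_of_universal_arrows[OF A I, of r \<eta>] r eta univ by auto
  interpret reflection ?A ?I L \<eta> by (rule refl)
  obtain \<epsilon> where adj: "adjunction ?A (full_subcat ?A ?I) L id_functor \<eta> \<epsilon>" using adjunction by blast
  have LA: "is_functor ?A ?A L"
    using L unfolding is_functor_def by (auto simp: Hom_full_subcat)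
  have lims: "preserves_finite_limits ?A (full_subcat ?A ?I) L"
    unfolding preserves_finite_limits_def
  proof (intro allI impI, elim conjE)
    fix K :: "(nat, nat) cat" and D X p
    assume K: "category K" "finite (Obj K)" "finite (Arr K)" and D: "is_functor K ?A D"
      and lim: "is_limit K ?A D X p"
    have cone: "is_cone K ?A D X p" using lim by (simp add: is_limit_def)
    have "pointwise_limit K (comp_functor L D) (FObj L X) (\<lambda>i. FArr L (p i))"
      by (rule locally_bijective_pointwise_limit[OF K D cone pointwise_limit_of_limit[OF K(1) D lim]
        LA, of \<eta>])
        (use eta eta_nat h r in \<open>auto simp: Lr \<eta>_def\<close>)
    moreover have "is_functor K (full_subcat ?A ?I) (comp_functor L D)"
      using L D unfolding is_functor_def comp_functor_def by (simp add: Hom_def)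
    ultimately show "is_limit K (full_subcat ?A ?I) (comp_functor L D) (FObj L X) (\<lambda>i. FArr L (p
      i))"
      using is_cone_image[OF K(1) L D cone] K(1) by (intro limit_of_pointwise_limit) auto
  qed
  have iso: "P \<in> ?I \<longleftrightarrow> is_iso ?A (\<eta> P)" if P: "P \<in> presheaves U C" for P
  proof
    assume "is_iso ?A (\<eta> P)"
    then have bij: "bij_betw (h P X) (Ev P X) (Ev (r P) X)" if "X \<in> Obj C" for X
      using is_iso_psh_catD that by (simp add: \<eta>_def)
    note Pp = presheaves_D[OF P] and rp = presheaves_D[OF r(1)[OF P]]
    obtain \<theta> where t: "\<theta> \<in> NatT C (r P) P"
      and inv: "\<And>X p. X \<in> Obj C \<Longrightarrow> p \<in> Ev P X \<Longrightarrow> \<theta> X (h P X p) = p"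
      "\<And>X q. X \<in> Obj C \<Longrightarrow> q \<in> Ev (r P) X \<Longrightarrow> h P X (\<theta> X q) = q"
      using NatT_inverse[OF h(1)[OF P] Pp rp bij] by blast
    have "bij_betw (\<theta> X) (Ev (r P) X) (Ev P X)" if X: "X \<in> Obj C" for X
      using inv[OF X] NatT_app[OF t X] NatT_app[OF h(1)[OF P] X]
        by (intro bij_betw_byWitness[of _ "h P X"]) auto
    then have "sheaf P"
      using sheaf_for_iso[OF t rp Pp] r(2)[OF P] Pp cov_sieve by (simp add: sheaf_def)
    then show "P \<in> ?I" using P by simp
  qed (rule eta_iso)
  show ?thesis
    unfolding is_subtopos_def using adj preserves_colimits lims iso by blast
qed

end

section \<open>Arrows inverted by a subtopos are locally surjective\<close>

context small_site
begin

lemma pullback_exists: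
  assumes f: "f \<in> Hom (psh_cat U C) X Y" and g: "g \<in> Hom (psh_cat U C) Z Y"
  obtains W a b where "is_pullback (psh_cat U C) W X Z Y a b f g"
    "\<And>c x z. c \<in> Obj C \<Longrightarrow> x \<in> Ev X c \<Longrightarrow> z \<in> Ev Z c \<Longrightarrow> component f c x = component g c z \<Longrightarrow>
      \<exists>w\<in>Ev W c. component a c w = x \<and> component b c w = z"
    "\<And>c w w'. c \<in> Obj C \<Longrightarrow> w \<in> Ev W c \<Longrightarrow> w' \<in> Ev W c \<Longrightarrow> component a c w = component a c w' \<Longrightarrow> component b c w = component b c w' \<Longrightarrow>
      w = w'"
proof -
  let ?A = "psh_cat U C"
  have X: "X \<in> presheaves U C" and Y: "Y \<in> presheaves U C" and Z: "Z \<in> presheaves U C"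
    using Hom_presheaf[OF f] Hom_presheaf[OF g] by auto
  note Xp = presheaves_D[OF X] and Yp = presheaves_D[OF Y] and Zp = presheaves_D[OF Z]
  define E where "E c = {(x, z). x \<in> Ev X c \<and> z \<in> Ev Z c \<and> component f c x = component g c z}" for c
  define V where "V = \<lparr>Ev = (\<lambda>c\<in>Obj C. E c), Res =
    (\<lambda>k\<in>Arr C. \<lambda>w\<in>E (Cod C k). (Res X k (fst w), Res Z k (snd w)))\<rparr>"
  have V: "is_presheaf C V"
  proof (rule is_presheafI[OF V_def])
    fix k w assume k: "k \<in> Arr C" and "w \<in> E (Cod C k)"
    then obtain x z where "w = (x, z)" "x \<in> Ev X (Cod C k)" "z \<in> Ev Z (Cod C k)"
      "component f (Cod C k) x = component g (Cod C k) z"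
      by (auto simp: E_def)
    then show "(Res X k (fst w), Res Z k (snd w)) \<in> E (Dom C k)"
      using component_nat[OF f k refl, of x] component_nat[OF g k refl, of z] k Xp Zp by (simp add: E_def)
  qed (use Xp Zp in \<open>auto simp: E_def\<close>)
  have EvV: "Ev V c = E c" if "c \<in> Obj C" for c using that by (simp add: V_def)
  have "small_set U (Ev V c)" if c: "c \<in> Obj C" for c
  proof (rule small_set_subset[OF universe])
    show "small_set U (Ev X c \<times> Ev Z c)"
      using X Z c by (intro small_set_Sigma[OF universe] small_set_universe) (auto simp:
        presheaves_def)
    show "Ev V c \<subseteq> Ev X c \<times> Ev Z c" using c by (auto simp: EvV E_def)
  qed
  then obtain W \<theta> where W: "W \<in> presheaves U C" and t: "\<theta> \<in> NatT C V W"
    and bij: "\<And>c. c \<in> Obj C \<Longrightarrow> bij_betw (\<theta> c) (Ev V c) (Ev W c)"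
    using encode_presheaf[OF V, of U] by metis
  note Wp = presheaves_D[OF W]
  obtain d where d: "d \<in> NatT C W V" "\<And>c v. c \<in> Obj C \<Longrightarrow> v \<in> Ev V c \<Longrightarrow> d c (\<theta> c v) = v"
    "\<And>c w. c \<in> Obj C \<Longrightarrow> w \<in> Ev W c \<Longrightarrow> \<theta> c (d c w) = w"
    using NatT_inverse[OF t V Wp bij] by metis
  have dE: "d c w \<in> E c" if "c \<in> Obj C" "w \<in> Ev W c" for c w
    using NatT_app[OF d(1) that] EvV[OF that(1)] by simp
  have dR: "d (Dom C k) (Res W k w) =
    (Res X k (fst (d (Cod C k) w)), Res Z k (snd (d (Cod C k) w)))"
    if k: "k \<in> Arr C" and w: "w \<in> Ev W (Cod C k)" for k w
    using NatT_nat[OF d(1) k refl w] dE[OF _ w] k by (simp add: V_def)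
  define a where "a = (W, mk_nat C W (\<lambda>c w. fst (d c w)), X)"
  define b where "b = (W, mk_nat C W (\<lambda>c w. snd (d c w)), Z)"
  have aH: "a \<in> Hom ?A W X" unfolding a_def Hom_psh_cat using W X dE dR Wp
    by (auto intro!: mk_nat_NatT simp: E_def split_beta)
  have bH: "b \<in> Hom ?A W Z" unfolding b_def Hom_psh_cat using W Z dE dR Wp
    by (auto intro!: mk_nat_NatT simp: E_def split_beta)
  have ab: "component a c w = fst (d c w)" "component b c w = snd (d c w)" if "c \<in> Obj C" "w \<in> Ev W c" for c w
    using that by (auto simp: a_def b_def)
  have ex: "\<exists>w\<in>Ev W c. component a c w = x \<and> component b c w = z"
    if "c \<in> Obj C" "x \<in> Ev X c" "z \<in> Ev Z c" "component f c x = component g c z" for c x z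
  proof -
    have "(x, z) \<in> Ev V c" using that by (simp add: EvV E_def)
    then show ?thesis
      using NatT_app[OF t that(1)] d(2)[OF that(1)] ab that(1)
      by (intro bexI[of _ "\<theta> c (x, z)"]) auto
  qed
  have un: "w = w'"
    if "c \<in> Obj C" "w \<in> Ev W c" "w' \<in> Ev W c" "component a c w = component a c w'" "component b c w = component b c w'"
    for c w w'
    using that ab d(3) by (metis prod.expand)
  have comm: "Comp ?A f a = Comp ?A g b"
  proof (rule Hom_eqI[OF Comp_Hom[OF category_psh_cat aH f] Comp_Hom[OF category_psh_cat bH g]])
    fix c w assume cw: "c \<in> Obj C" "w \<in> Ev W c"
    show "component (Comp ?A f a) c w = component (Comp ?A g b) c w"
      using component_Comp[OF aH f cw] component_Comp[OF bH g cw] ab[OF cw] dE[OF cw] by (auto simp: E_def)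
  qed
  have "is_pullback ?A W X Z Y a b f g"
    unfolding is_pullback_def
  proof (intro conjI aH bH f g comm allI impI)
    fix T h k assume h: "h \<in> Hom ?A T X" and k: "k \<in> Hom ?A T Z" and e: "Comp ?A f h = Comp ?A g k"
    have T: "T \<in> presheaves U C" using Hom_presheaf[OF h] by simp
    note Tp = presheaves_D[OF T]
    have hk: "(component h c y, component k c y) \<in> Ev V c" if "c \<in> Obj C" "y \<in> Ev T c" for c y
      using component_app[OF h that] component_app[OF k that] component_Comp[OF h f that] component_Comp[OF k g that] e that
        by (simp add: EvV E_def)
    have N: "mk_nat C T (\<lambda>c y. \<theta> c (component h c y, component k c y)) \<in> NatT C T W"
    proof (rule mk_nat_NatT[OF _ _ Tp])
      show "\<theta> c (component h c y, component k c y) \<in> Ev W c" if "c \<in> Obj C" "y \<in> Ev T c" for c y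
        using NatT_app[OF t that(1) hk[OF that]] .
      fix m y assume m: "m \<in> Arr C" and y: "y \<in> Ev T (Cod C m)"
      have "(component h (Cod C m) y, component k (Cod C m) y) \<in> E (Cod C m)" using hk[OF _ y] m EvV by simp
      then show "\<theta> (Dom C m) (component h (Dom C m) (Res T m y), component k (Dom C m) (Res T m y)) =
        Res W m (\<theta> (Cod C m) (component h (Cod C m) y, component k (Cod C m) y))"
        using NatT_nat[OF t m refl hk[OF _ y]] component_nat[OF h m refl y] component_nat[OF k m refl y] m
          by (simp add: V_def)
    qed
    let ?u = "(T, mk_nat C T (\<lambda>c y. \<theta> c (component h c y, component k c y)), W)"
    have uH: "?u \<in> Hom ?A T W" using N T W by (simp add: Hom_psh_cat)
    have u: "component ?u c y \<in> Ev W c" "component a c (component ?u c y) = component h c y" "component b c (component ?u c y) = component k c y"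
      if "c \<in> Obj C" "y \<in> Ev T c" for c y
      using NatT_app[OF t that(1) hk[OF that]] ab[OF that(1)] d(2)[OF that(1) hk[OF that]] that
        by auto
    show "\<exists>!u. u \<in> Hom ?A T W \<and> Comp ?A a u = h \<and> Comp ?A b u = k"
    proof (rule ex1I[of _ ?u], intro conjI uH)
      show "Comp ?A a ?u = h"
        by (rule Hom_eqI[OF Comp_Hom[OF category_psh_cat uH aH] h]) (use component_Comp[OF uH aH] u(2) in
          simp)
      show "Comp ?A b ?u = k"
        by (rule Hom_eqI[OF Comp_Hom[OF category_psh_cat uH bH] k]) (use component_Comp[OF uH bH] u(3) in
          simp)
      fix v assume v: "v \<in> Hom ?A T W \<and> Comp ?A a v = h \<and> Comp ?A b v = k"
      then have vH: "v \<in> Hom ?A T W" by simp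
      show "v = ?u"
      proof (rule Hom_eqI[OF vH uH])
        fix c y assume cy: "c \<in> Obj C" "y \<in> Ev T c"
        show "component v c y = component ?u c y"
          by (rule un[OF cy(1) component_app[OF vH cy] u(1)[OF cy]])
            (use component_Comp[OF vH aH cy] component_Comp[OF vH bH cy] v u[OF cy] in auto)
      qed
    qed
  qed
  then show thesis using ex un by (rule that)
qed

end

context site_cat
begin

lemma pb_lift_sieve:
  assumes "is_presheaf C A" "a \<in> Ev A X" "x \<in> Arr C" "Cod C x = X"
  shows "pb x (lift_sieve P A \<eta> X a) = lift_sieve P A \<eta> (Dom C x) (Res A x a)"
  using assms by (auto simp: pb_def lift_sieve_def)

end

context small_site
begin

text \<open>Let \<open>H\<close> represent \<open>c\<close>, and pull \<open>w\<close> back along the arrow \<open>\<tau> : H \<rightarrow> Y\<close> that corresponds to \<open>t\<close>.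
  The projection \<open>a : W \<rightarrow> H\<close> is inverted by \<open>L\<close>, and its image is the sieve in question: a matching
  family on the sieve is a morphism \<open>W \<rightarrow> Q\<close> that is constant on the fibres of \<open>a\<close>, and it extends
  uniquely to \<open>H\<close>.\<close>

lemma inverted_sheaf_for:
  fixes I :: "('o, 'm, 'v) presheaf set"
  assumes rfl: "reflection (psh_cat U C) I L \<eta>"
    and pres: "preserves_finite_limits (psh_cat U C) (full_subcat (psh_cat U C) I) L"
    and w: "w \<in> Hom (psh_cat U C) Z Y" and iso: "is_iso (psh_cat U C) (FArr L w)"
    and c: "c \<in> Obj C" and t: "t \<in> Ev Y c" and Q: "Q \<in> I"
  shows "sheaf_for Q c (lift_sieve Z Y (component w) c t)"
proof -
  let ?A = "psh_cat U C :: (('o, 'm, 'v) presheaf, ('o, 'm, 'v) presheaf_arr) cat"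
  interpret reflection ?A I L \<eta> by (rule rfl)
  have Z: "Z \<in> presheaves U C" and Y: "Y \<in> presheaves U C" using Hom_presheaf[OF w] by auto
  have QU: "Q \<in> presheaves U C" using Q I by auto
  note Yp = presheaves_D[OF Y] and Qp = presheaves_D[OF QU]
  obtain H u where H: "H \<in> presheaves U C" and u: "u \<in> Ev H c"
    and bij: "\<And>Z. Z \<in> Obj C \<Longrightarrow> bij_betw (\<lambda>f. Res H f u) (Hom C Z c) (Ev H Z)"
    and yon: "\<And>Q q. Q \<in> presheaves U C \<Longrightarrow> q \<in> Ev Q c \<Longrightarrow> \<exists>a\<in>Hom ?A H Q. component a c u = q"
    using representable[OF c, where thesis = thesis] by metis
  note Hp = presheaves_D[OF H]
  obtain \<tau> where \<tau>: "\<tau> \<in> Hom ?A H Y" "component \<tau> c u = t" using yon[OF Y t] by blast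
  obtain W a b where W: "is_pullback ?A W H Z Y a b \<tau> w"
    and Wex: "\<And>e x z. e \<in> Obj C \<Longrightarrow> x \<in> Ev H e \<Longrightarrow> z \<in> Ev Z e \<Longrightarrow> component \<tau> e x = component w e z \<Longrightarrow>
      \<exists>v\<in>Ev W e. component a e v = x \<and> component b e v = z"
    using pullback_exists[OF \<tau>(1) w] by metis
  have aH: "a \<in> Hom ?A W H" and bH: "b \<in> Hom ?A W Z" and comm: "Comp ?A \<tau> a = Comp ?A w b"
    using W by (auto simp: is_pullback_def)
  have WU: "W \<in> presheaves U C" using Hom_presheaf[OF aH] by simp
  note Wp = presheaves_D[OF WU]
  let ?B = "full_subcat ?A I"
  have B: "category ?B" by (rule category_full_subcat[OF A I])
  have isoB: "is_iso ?B (FArr L w)"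
    using is_iso_full_subcat[OF L_Hom[OF w]] iso L_obj Z Y by simp
  have "is_iso ?B (FArr L a)"
    by (rule pullback_of_iso[OF B preserves_pullback[OF A B L pres W] isoB])
  then have La: "is_iso ?A (FArr L a)" using is_iso_full_subcat[OF L_Hom[OF aH]] L_obj WU H by simp
  note orth = inverted_orthogonal[OF aH La Q]
  let ?S = "lift_sieve Z Y (component w) c t"
  have Ssv: "is_sieve c ?S" by (rule is_sieve_lift[OF presheaves_D[OF Z] Yp Hom_component[OF w] c t])
  have inj: "f = g"
    if "f \<in> Arr C" "g \<in> Arr C" "Cod C f = c" "Cod C g = c" "Dom C f = Dom C g"
    "Res H f u = Res H g u" for f g
    using bij[of "Dom C g"] that by (auto simp: bij_betw_def inj_on_def Hom_def)
  have "\<exists>f. f \<in> ?S \<and> Dom C f = e \<and> component a e v = Res H f u" if e: "e \<in> Obj C"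
    and v: "v \<in> Ev W e" for e v
  proof -
    have "component a e v \<in> Ev H e" using component_app[OF aH e v] .
    then have "component a e v \<in> (\<lambda>f. Res H f u) ` Hom C e c" using bij[OF e] by (simp add: bij_betw_def)
    then obtain f where f: "f \<in> Arr C" "Dom C f = e" "Cod C f = c" "component a e v = Res H f u"
      by (auto simp: Hom_def)
    have "Res Y f t = component \<tau> e (component a e v)" using component_nat[OF \<tau>(1) f(1,3) u] \<tau>(2) f by simp
    also have "\<dots> = component w e (component b e v)"
      using component_Comp[OF aH \<tau>(1) e v] component_Comp[OF bH w e v] comm by simp
    finally have "f \<in> ?S" using f component_app[OF bH e v] by (auto simp: lift_sieve_def)
    then show ?thesis using f by blast
  qed
  then obtain F where F: "\<And>e v. e \<in> Obj C \<Longrightarrow> v \<in> Ev W e \<Longrightarrow> F e v \<in> ?S"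
    "\<And>e v. e \<in> Obj C \<Longrightarrow> v \<in> Ev W e \<Longrightarrow> Dom C (F e v) = e"
    "\<And>e v. e \<in> Obj C \<Longrightarrow> v \<in> Ev W e \<Longrightarrow> component a e v = Res H (F e v) u" by metis
  note SD = is_sieveD(2-4)[OF Ssv]
  have Feq: "F e v = f"
    if "e \<in> Obj C" "v \<in> Ev W e" "f \<in> Arr C" "Cod C f = c" "Dom C f = e" "component a e v = Res H f u"
    for e v f
    using inj[of "F e v" f] F[OF that(1,2)] SD that by simp
  show ?thesis
  proof (rule sheaf_forI)
    fix s assume m: "matching Q ?S s"
    have N: "mk_nat C W (\<lambda>e v. s (F e v)) \<in> NatT C W Q"
    proof (rule mk_nat_NatT[OF _ _ Wp])
      show "s (F e v) \<in> Ev Q e" if "e \<in> Obj C" "v \<in> Ev W e" for e v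
        using matchingD[OF m F(1)[OF that]] F(2)[OF that] by simp
      fix k v assume k: "k \<in> Arr C" and v: "v \<in> Ev W (Cod C k)"
      let ?f = "F (Cod C k) v"
      have f: "?f \<in> ?S" "Dom C ?f = Cod C k" "component a (Cod C k) v = Res H ?f u"
        using F[OF _ v] k by auto
      have "F (Dom C k) (Res W k v) = ?f \<odot> k"
        using component_nat[OF aH k refl v] f k SD(1,2)[OF f(1)] u Hp Wp v by (intro Feq) auto
      then show "s (F (Dom C k) (Res W k v)) = Res Q k (s ?f)"
        using matching_comp[OF m f(1) k] f(2) by simp
    qed
    let ?g = "(W, mk_nat C W (\<lambda>e v. s (F e v)), Q)"
    have gH: "?g \<in> Hom ?A W Q" using N WU QU by (simp add: Hom_psh_cat)
    obtain h where h: "h \<in> Hom ?A H Q" "Comp ?A h a = ?g" using orth[OF gH] by blast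
    have "Res Q f (component h c u) = s f" if f: "f \<in> ?S" for f
    proof -
      have fa: "f \<in> Arr C" "Cod C f = c" "Dom C f \<in> Obj C" using SD f by auto
      obtain z where z: "z \<in> Ev Z (Dom C f)" "Res Y f t = component w (Dom C f) z"
        using f by (auto simp: lift_sieve_def)
      have fu: "Res H f u \<in> Ev H (Dom C f)" using fa u Hp by simp
      have "component \<tau> (Dom C f) (Res H f u) = component w (Dom C f) z"
        using component_nat[OF \<tau>(1) fa(1,2) u] \<tau>(2) z(2) by simp
      then obtain v where v: "v \<in> Ev W (Dom C f)" "component a (Dom C f) v = Res H f u"
        using Wex[OF fa(3) fu z(1)] by blast
      have "Res Q f (component h c u) = component h (Dom C f) (component a (Dom C f) v)"
        using component_nat[OF h(1) fa(1,2) u] v(2) by simp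
      also have "\<dots> = component ?g (Dom C f) v" using component_Comp[OF aH h(1) fa(3) v(1)] h(2) by simp
      also have "\<dots> = s f" using Feq[OF fa(3) v(1) fa(1,2) refl v(2)] fa(3) v(1) by simp
      finally show ?thesis .
    qed
    then show "\<exists>q\<in>Ev Q c. \<forall>f\<in>?S. Res Q f q = s f" using component_app[OF h(1) c u] by blast
  next
    fix q q' assume q: "q \<in> Ev Q c" "q' \<in> Ev Q c" and e: "\<And>f. f \<in> ?S \<Longrightarrow> Res Q f q = Res Q f q'"
    obtain h where h: "h \<in> Hom ?A H Q" "component h c u = q" using yon[OF QU q(1)] by blast
    obtain h' where h': "h' \<in> Hom ?A H Q" "component h' c u = q'" using yon[OF QU q(2)] by blast
    have ha: "Comp ?A h a \<in> Hom ?A W Q" and ha': "Comp ?A h' a \<in> Hom ?A W Q"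
      using Comp_Hom[OF A aH h(1)] Comp_Hom[OF A aH h'(1)] by auto
    have "Comp ?A h a = Comp ?A h' a"
    proof (rule Hom_eqI[OF ha ha'])
      fix e v assume ev: "e \<in> Obj C" "v \<in> Ev W e"
      have f: "F e v \<in> Arr C" "Cod C (F e v) = c" "Dom C (F e v) = e" using F[OF ev] SD by auto
      have "component h e (component a e v) = Res Q (F e v) q" "component h' e (component a e v) = Res Q (F e v) q'"
        using component_nat[OF h(1) f(1,2) u] component_nat[OF h'(1) f(1,2) u] F(3)[OF ev] f(3) h(2) h'(2) by auto
      then show "component (Comp ?A h a) e v = component (Comp ?A h' a) e v"
        using component_Comp[OF aH h(1) ev] component_Comp[OF aH h'(1) ev] e[OF F(1)[OF ev]] by simp
    qed
    then have "h = h'" using orth[OF ha] h(1) h'(1) by metis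
    then show "q = q'" using h(2) h'(2) by simp
  qed
qed

section \<open>The correspondence\<close>

definition cov_of :: "('o \<times> ('o, 'm, 'm) presheaf) set \<Rightarrow> 'o \<Rightarrow> 'm set \<Rightarrow> bool" where
  "cov_of J X S \<longleftrightarrow> is_sieve X S \<and> (X, sieve_presheaf X S) \<in> J"

lemma cov_of_sieve_arrows:
  assumes "(X, K) \<in> sieves C" shows "cov_of J X (sieve_arrows K) \<longleftrightarrow> (X, K) \<in> J"
  using sieves_D(3)[OF assms] sieve_presheaf_sieve_arrows[OF assms] by (simp add: cov_of_def)

lemma F_R_iff:
  assumes "J \<subseteq> sieves C"
  shows "P \<in> F_R U C J \<longleftrightarrow> P \<in> presheaves U C \<and> (\<forall>X K. (X, K) \<in> J \<longrightarrow>
    stably_sheaf_for P X (sieve_arrows K))"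
proof -
  have "((X, K), P) \<in> duality_rel U C \<longleftrightarrow> stably_sheaf_for P X (sieve_arrows K)"
    if "P \<in> presheaves U C" "(X, K) \<in> J" for X K
    using duality_rel_iff[OF _ that(1), of X K] that(2) assms by blast
  then show ?thesis unfolding F_R_def by auto
qed

lemma G_R_iff:
  assumes "I \<subseteq> presheaves U C"
  shows "(X, K) \<in> G_R U C I \<longleftrightarrow> (X, K) \<in> sieves C \<and> (\<forall>P\<in>I. stably_sheaf_for P X (sieve_arrows K))"
proof -
  have "((X, K), P) \<in> duality_rel U C \<longleftrightarrow> stably_sheaf_for P X (sieve_arrows K)"
    if "(X, K) \<in> sieves C" "P \<in> I" for P
    using duality_rel_iff[OF that(1), of P U] that(2) assms by blast
  then show ?thesis unfolding G_R_def by auto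
qed

lemma G_R_sieves: "G_R U C I \<subseteq> sieves C" by (auto simp: G_R_def)

lemma F_R_presheaves: "F_R U C J \<subseteq> presheaves U C" by (auto simp: F_R_def)

lemma cov_of_G_R:
  assumes I: "I \<subseteq> presheaves U C"
  shows "cov_of (G_R U C I) X S \<longleftrightarrow> is_sieve X S \<and> (\<forall>P\<in>I. stably_sheaf_for P X S)"
  using sieve_presheaf_sieves[of X S] sieve_arrows_sieve_presheaf[of X S]
  by (auto simp: cov_of_def G_R_iff[OF I])

lemma grothendieck_topology_G_R:
  assumes I: "I \<subseteq> presheaves U C"
  shows "grothendieck_topology U C (G_R U C I)"
proof -
  have psh: "is_presheaf C P" if "P \<in> I" for P using that I presheaves_D by blast
  show ?thesis
    unfolding grothendieck_topology_def
  proof (intro conjI ballI allI impI; (clarify)?)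
    fix X assume X: "X \<in> Obj C"
    show "(X, yoneda C X) \<in> G_R U C I"
      using yoneda_sieve[OF X] stably_sheaf_for_max[OF psh X] by (simp add: G_R_iff[OF I])
  next
    fix X K X' x assume K: "(X, K) \<in> G_R U C I" and "x \<in> Hom C X' X"
    then have x: "x \<in> Arr C" "Cod C x = X" and X': "X' = Dom C x" by (auto simp: Hom_def)
    have Ks: "(X, K) \<in> sieves C" using K G_R_sieves by blast
    have sv: "is_sieve (Dom C x) (pb x (sieve_arrows K))"
      using is_sieve_pb[OF sieves_D(3)[OF Ks] x] .
    have "cov_of (G_R U C I) (Dom C x) (pb x (sieve_arrows K))"
      using K sv stably_sheaf_for_pb[OF _ x] by (auto simp: cov_of_G_R[OF I] G_R_iff[OF I])
    then show "(X', pullback_sieve C x K) \<in> G_R U C I"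
      unfolding X' pullback_sieve_eq[OF Ks x] by (simp add: cov_of_def)
  next
    fix X A and x :: "'v \<Rightarrow> 'm" and K
    assume X: "X \<in> Obj C" and x: "\<forall>i\<in>A. x i \<in> Arr C \<and> Cod C (x i) = X"
      and gen: "(X, generated_sieve C X A x) \<in> G_R U C I" and K: "(X, K) \<in> sieves C"
      and loc: "\<forall>i\<in>A. (Dom C (x i), pullback_sieve C (x i) K) \<in> G_R U C I"
    let ?S = "{x i \<odot> f |i f. i \<in> A \<and> f \<in> Arr C \<and> Cod C f = Dom C (x i)}"
    have S: "is_sieve X ?S" by (rule is_sieve_generated[OF X]) (use x in auto)
    have "cov_of (G_R U C I) X ?S"
      using gen S generated_sieve_eq[of A x X] x by (simp add: cov_of_def)
    then have st: "stably_sheaf_for P X ?S" if "P \<in> I" for P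
      using that by (simp add: cov_of_G_R[OF I])
    have "stably_sheaf_for P X (sieve_arrows K)" if P: "P \<in> I" for P
    proof (rule stably_sheaf_for_trans[OF psh[OF P] S sieves_D(3)[OF K] st[OF P]])
      fix h assume "h \<in> ?S"
      then obtain i f where i: "i \<in> A" and f: "f \<in> Arr C" "Cod C f = Dom C (x i)"
        and h: "h = x i \<odot> f" by blast
      have xi: "x i \<in> Arr C" "Cod C (x i) = X" using x i by auto
      have "(Dom C (x i), pullback_sieve C (x i) K) \<in> G_R U C I" using loc i by blast
      then have "cov_of (G_R U C I) (Dom C (x i)) (pb (x i) (sieve_arrows K))"
        unfolding pullback_sieve_eq[OF K xi]
          using is_sieve_pb[OF sieves_D(3)[OF K] xi] by (simp add: cov_of_def)
      then have "stably_sheaf_for P (Dom C (x i)) (pb (x i) (sieve_arrows K))"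
        using P by (simp add: cov_of_G_R[OF I])
      from stably_sheaf_for_pb[OF this f] show "stably_sheaf_for P (Dom C h) (pb h (sieve_arrows
        K))"
        using xi f by (simp add: h pb_comp)
    qed
    then show "(X, K) \<in> G_R U C I" using K by (simp add: G_R_iff[OF I])
  qed
qed

text \<open>Locality is required only for small generating families. Every sieve has one: its arrows with
  source in a small skeleton.\<close>

lemma topology_cov_of:
  assumes J: "J \<subseteq> sieves C" and G: "grothendieck_topology U C J"
  shows "topology C (cov_of J)"
proof unfold_locales
  show "is_sieve X S" if "cov_of J X S" for X S using that by (simp add: cov_of_def)
  have max: "\<And>X. X \<in> Obj C \<Longrightarrow> (X, yoneda C X) \<in> J"
    and pbk: "\<And>X K x. (X, K) \<in> J \<Longrightarrow> x \<in> Arr C \<Longrightarrow> Cod C x = X \<Longrightarrow> (Dom C x, pullback_sieve C x K) \<in> J"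
    and loc: "\<And>X A (x :: 'v \<Rightarrow> 'm) K. X \<in> Obj C \<Longrightarrow> A \<in> U \<Longrightarrow> (\<And>i. i \<in> A \<Longrightarrow> x i \<in> Arr C \<and> Cod C (x i) =
      X) \<Longrightarrow>
      (X, generated_sieve C X A x) \<in> J \<Longrightarrow> (X, K) \<in> sieves C \<Longrightarrow>
      (\<And>i. i \<in> A \<Longrightarrow> (Dom C (x i), pullback_sieve C (x i) K) \<in> J) \<Longrightarrow> (X, K) \<in> J"
  proof -
    note G' = G[unfolded grothendieck_topology_def]
    show "(X, yoneda C X) \<in> J" if "X \<in> Obj C" for X using G' that by blast
    show "(Dom C x, pullback_sieve C x K) \<in> J" if "(X, K) \<in> J" "x \<in> Arr C" "Cod C x = X" for X K x
      using conjunct1[OF conjunct2[OF G']] that by (auto simp: Hom_def)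
    show "(X, K) \<in> J" if "X \<in> Obj C" "A \<in> U" "\<And>i. i \<in> A \<Longrightarrow> x i \<in> Arr C \<and> Cod C (x i) = X"
      "(X, generated_sieve C X A x) \<in> J" "(X, K) \<in> sieves C"
      "\<And>i. i \<in> A \<Longrightarrow> (Dom C (x i), pullback_sieve C (x i) K) \<in> J" for X A and x :: "'v \<Rightarrow> 'm" and K
      by (rule conjunct2[OF conjunct2[OF G'], rule_format, OF that(1,2) _ that(4,5)]) (use that in
        auto)
  qed
  show "cov_of J X (max_sieve X)" if X: "X \<in> Obj C" for X
    using cov_of_sieve_arrows[OF yoneda_sieve(1)[OF X]] yoneda_sieve(2)[OF X] max[OF X] by simp
  have pb': "cov_of J (Dom C x) (pb x S) \<longleftrightarrow> (Dom C x, pullback_sieve C x (sieve_presheaf X S)) \<in> J"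
    if "is_sieve X S" "x \<in> Arr C" "Cod C x = X" for X S x
    using pullback_sieve_eq[OF sieve_presheaf_sieves[OF that(1)] that(2,3)] is_sieve_pb[OF that]
      sieve_arrows_sieve_presheaf[OF that(1)] by (simp add: cov_of_def)
  show "cov_of J (Dom C x) (pb x S)" if "cov_of J X S" "x \<in> Arr C" "Cod C x = X" for X S x
    using pb'[of X S x] pbk[of X "sieve_presheaf X S" x] that by (simp add: cov_of_def)
  fix X S S' assume S: "cov_of J X S" and S': "is_sieve X S'"
    and l: "\<And>f. f \<in> S \<Longrightarrow> cov_of J (Dom C f) (pb f S')"
  have Ssv: "is_sieve X S" using S by (simp add: cov_of_def)
  note SD = is_sieveD(2-4)[OF Ssv]
  have X: "X \<in> Obj C" using is_sieveD(1)[OF Ssv] .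
  obtain T where T: "T \<subseteq> max_sieve X" "small_set U T"
    "\<And>f. f \<in> Arr C \<Longrightarrow> Cod C f = X \<Longrightarrow> \<exists>i\<in>Arr C. \<exists>j\<in>Arr C. Cod C i = Dom C f \<and> Dom C j = Dom C f \<and>
      Cod C j = Dom C i \<and> i \<odot> j = Ident C (Dom C f) \<and> f \<odot> i \<in> T"
    using small_dense_arrows[OF X] by metis
  have "small_set U (T \<inter> S)" using small_set_subset[OF universe T(2)] by blast
  then obtain e :: "'m \<Rightarrow> 'v" where e: "inj_on e (T \<inter> S)" "e ` (T \<inter> S) \<in> U"
    unfolding small_set_def by blast
  let ?A = "e ` (T \<inter> S)" and ?x = "inv_into (T \<inter> S) e"
  have xi: "?x i \<in> T \<inter> S" if "i \<in> ?A" for i using that by (rule inv_into_into)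
  have gen: "S = {?x i \<odot> f |i f. i \<in> ?A \<and> f \<in> Arr C \<and> Cod C f = Dom C (?x i)}" (is "S = ?G")
  proof (rule set_eqI)
    fix h
    show "h \<in> S \<longleftrightarrow> h \<in> ?G"
    proof
      assume h: "h \<in> S"
      then have ha: "h \<in> Arr C" "Cod C h = X" using SD by auto
      obtain i j where ij: "i \<in> Arr C" "j \<in> Arr C" "Cod C i = Dom C h" "Dom C j = Dom C h"
        "Cod C j = Dom C i" "i \<odot> j = Ident C (Dom C h)" "h \<odot> i \<in> T" using T(3)[OF ha] by blast
      have hi: "h \<odot> i \<in> T \<inter> S" using ij SD(3)[OF h] by simp
      have "?x (e (h \<odot> i)) = h \<odot> i" using e(1) hi by (rule inv_into_f_f)
      moreover have "h = h \<odot> i \<odot> j" using ij ha by simp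
      ultimately show "h \<in> ?G"
        using hi ij ha by (intro CollectI exI[of _ "e (h \<odot> i)"] exI[of _ j]) auto
    next
      assume "h \<in> ?G"
      then obtain i f where i: "i \<in> ?A" and f: "f \<in> Arr C" "Cod C f = Dom C (?x i)"
        and h: "h = ?x i \<odot> f" by blast
      show "h \<in> S" unfolding h using xi[OF i] SD(3)[OF _ f] by blast
    qed
  qed
  have xa: "?x i \<in> Arr C \<and> Cod C (?x i) = X" if "i \<in> ?A" for i using xi[OF that] SD by blast
  have "(X, sieve_presheaf X S') \<in> J"
  proof (rule loc[OF X e(2) xa])
    have "generated_sieve C X ?A ?x = sieve_presheaf X ?G" by (rule generated_sieve_eq) (rule xa)
    then show "(X, generated_sieve C X ?A ?x) \<in> J"
      unfolding gen[symmetric] using S by (simp add: cov_of_def)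
    show "(X, sieve_presheaf X S') \<in> sieves C" by (rule sieve_presheaf_sieves[OF S'])
    show "(Dom C (?x i), pullback_sieve C (?x i) (sieve_presheaf X S')) \<in> J" if i: "i \<in> ?A" for i
      using pb'[OF S', of "?x i"] xa[OF i] xi[OF i] l[of "?x i"] by simp
  qed
  then show "cov_of J X S'" using S' by (simp add: cov_of_def)
qed

lemma F_R_sheaves:
  assumes J: "J \<subseteq> sieves C" and G: "grothendieck_topology U C J"
  shows "F_R U C J = {P \<in> presheaves U C. topology.sheaf C (cov_of J) P}"
proof -
  interpret topology C "cov_of J" by (rule topology_cov_of[OF J G])
  have "(\<forall>X K. (X, K) \<in> J \<longrightarrow> stably_sheaf_for P X (sieve_arrows K)) \<longleftrightarrow> (\<forall>X S. cov_of J X S \<longrightarrow>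
    sheaf_for P X S)"
    if P: "P \<in> presheaves U C" for P :: "('o, 'm, 'v) presheaf"
  proof (intro iffI allI impI)
    fix X S assume *: "\<forall>X K. (X, K) \<in> J \<longrightarrow> stably_sheaf_for P X (sieve_arrows K)"
      and S: "cov_of J X S"
    then have "stably_sheaf_for P X (sieve_arrows (sieve_presheaf X S))" by (simp add: cov_of_def)
    then have "stably_sheaf_for P X S"
      using sieve_arrows_sieve_presheaf[of X S] S by (simp add: cov_of_def)
    then show "sheaf_for P X S" using S by (intro stably_sheaf_for_self) (auto simp: cov_of_def)
  next
    fix X K assume *: "\<forall>X S. cov_of J X S \<longrightarrow> sheaf_for P X S" and K: "(X, K) \<in> J"
    then have "cov_of J X (sieve_arrows K)" using cov_of_sieve_arrows[of X K J] J by blast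
    then show "stably_sheaf_for P X (sieve_arrows K)" using cov_pb *
      unfolding stably_sheaf_for_def by blast
  qed
  then show ?thesis using presheaves_D unfolding sheaf_def by (auto simp: F_R_iff[OF J])
qed

lemma topology_fixed_point:
  assumes J: "J \<subseteq> sieves C" and G: "grothendieck_topology U C J"
  shows "G_R U C (F_R U C J) = J"
proof (rule equalityI)
  interpret topology C "cov_of J" by (rule topology_cov_of[OF J G])
  interpret small_topology C "cov_of J" U by unfold_locales
  show "G_R U C (F_R U C J) \<subseteq> J"
  proof clarify
    fix X K assume "(X, K) \<in> G_R U C (F_R U C J)"
    then have K: "(X, K) \<in> sieves C"
      and st: "\<And>P. P \<in> F_R U C J \<Longrightarrow> stably_sheaf_for P X (sieve_arrows K)"
      by (auto simp: G_R_iff[OF F_R_presheaves])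
    note sv = sieves_D(3)[OF K]
    have "cov_of J X (sieve_arrows K)"
      using st F_R_sheaves[OF J G]
        by (intro cov_of_sheaf_for[OF sv] stably_sheaf_for_self[OF _ sv]) auto
    then show "(X, K) \<in> J" using cov_of_sieve_arrows[OF K] by simp
  qed
  show "J \<subseteq> G_R U C (F_R U C J)" using J by (auto simp: G_R_def F_R_def)
qed

lemma subtopos_F_R:
  assumes J: "J \<subseteq> sieves C" and G: "grothendieck_topology U C J"
  shows "is_subtopos U C (F_R U C J)"
proof -
  interpret topology C "cov_of J" by (rule topology_cov_of[OF J G])
  interpret small_topology C "cov_of J" U by unfold_locales
  show ?thesis unfolding F_R_sheaves[OF J G] by (rule subtopos_of_sheaves)
qed

text \<open>A \<open>J\<close>-sheaf \<open>P\<close>, for \<open>J = G\<^sub>R(I)\<close>, belongs to \<open>I\<close> because \<open>\<eta>\<^sub>P\<close> is locally bijective between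
  sheaves. Local injectivity of \<open>\<eta>\<^sub>P\<close> is local surjectivity of the diagonal of \<open>P \<times>\<^bsub>LP\<^esub> P\<close>, which is
  inverted by \<open>L\<close> as a section of a projection that is a pullback of \<open>\<eta>\<^sub>P\<close>.\<close>

lemma subtopos_fixed_point:
  assumes IP: "I \<subseteq> presheaves U C" and sub: "is_subtopos U C I"
  shows "F_R U C (G_R U C I) = I"
proof (rule equalityI)
  show "I \<subseteq> F_R U C (G_R U C I)" using IP by (auto simp: F_R_def G_R_def)
  let ?A = "psh_cat U C :: (('o, 'm, 'v) presheaf, ('o, 'm, 'v) presheaf_arr) cat"
  obtain L \<eta> \<epsilon> where adj: "adjunction ?A (full_subcat ?A I) L id_functor \<eta> \<epsilon>"
    and pres: "preserves_finite_limits ?A (full_subcat ?A I) L"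
    and iso: "\<And>P. P \<in> presheaves U C \<Longrightarrow> P \<in> I \<longleftrightarrow> is_iso ?A (\<eta> P)"
    using sub unfolding is_subtopos_def by blast
  have IO: "I \<subseteq> Obj ?A" using IP by simp
  have rfl: "reflection ?A I L \<eta>" by (rule reflection_of_adjunction[OF category_psh_cat IO adj])
  interpret reflection ?A I L \<eta> by (rule rfl)
  let ?J = "G_R U C I"
  have Gt: "grothendieck_topology U C ?J" by (rule grothendieck_topology_G_R[OF IP])
  interpret topology C "cov_of ?J" by (rule topology_cov_of[OF G_R_sieves Gt])
  have inv: "locally_surjective Z Y (component w)" if w: "w \<in> Hom ?A Z Y"
    and Lw: "is_iso ?A (FArr L w)" for w Z Y
    unfolding locally_surjective_def
  proof (intro ballI)
    fix c t assume c: "c \<in> Obj C" and t: "t \<in> Ev Y c"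
    have Zp: "is_presheaf C Z" and Yp: "is_presheaf C Y"
      using Hom_presheaf[OF w] presheaves_D by auto
    have "stably_sheaf_for Q c (lift_sieve Z Y (component w) c t)" if Q: "Q \<in> I" for Q
      unfolding stably_sheaf_for_def
    proof (intro ballI impI)
      fix x assume x: "x \<in> Arr C" "Cod C x = c"
      show "sheaf_for Q (Dom C x) (pb x (lift_sieve Z Y (component w) c t))"
        unfolding pb_lift_sieve[OF Yp t x]
        by (rule inverted_sheaf_for[OF rfl pres w Lw _ _ Q]) (use x t Yp in auto)
    qed
    then show "cov_of ?J c (lift_sieve Z Y (component w) c t)"
      using is_sieve_lift[OF Zp Yp Hom_component[OF w] c t] by (simp add: cov_of_G_R[OF IP])
  qed
  show "F_R U C ?J \<subseteq> I"
  proof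
    fix P assume "P \<in> F_R U C ?J"
    then have P: "P \<in> presheaves U C" and shP: "sheaf P" using F_R_sheaves[OF G_R_sieves Gt] by auto
    have PO: "P \<in> Obj ?A" using P by simp
    note eP = eta[OF PO]
    let ?h = "component (\<eta> P)" and ?LP = "FObj L P"
    have LPI: "?LP \<in> I" using L_obj(1)[OF PO] .
    have shL: "sheaf ?LP"
      using \<open>I \<subseteq> F_R U C ?J\<close> LPI F_R_sheaves[OF G_R_sieves Gt] by blast
    note Pp = presheaves_D[OF P]
    have ls: "locally_surjective P ?LP ?h" by (rule inv[OF eP L_eta_iso[OF PO]])
    obtain W a b where W: "is_pullback ?A W P P ?LP a b (\<eta> P) (\<eta> P)"
      and Wex: "\<And>c x z. c \<in> Obj C \<Longrightarrow> x \<in> Ev P c \<Longrightarrow> z \<in> Ev P c \<Longrightarrow> component (\<eta> P) c x = component (\<eta> P) c z \<Longrightarrow>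
        \<exists>w\<in>Ev W c. component a c w = x \<and> component b c w = z"
      using pullback_exists[OF eP eP] by metis
    have aH: "a \<in> Hom ?A W P" and bH: "b \<in> Hom ?A W P" using W by (auto simp: is_pullback_def)
    have WU: "W \<in> presheaves U C" using Hom_presheaf[OF aH] by simp
    note Wp = presheaves_D[OF WU]
    let ?B = "full_subcat ?A I"
    have B: "category ?B" by (rule category_full_subcat[OF A IO])
    have "is_iso ?B (FArr L (\<eta> P))"
      using is_iso_full_subcat[OF L_Hom[OF eP]] L_eta_iso[OF PO] L_obj PO by simp
    then have "is_iso ?B (FArr L a)"
      by (rule pullback_of_iso[OF B preserves_pullback[OF A B L pres W]])
    then have La: "is_iso ?A (FArr L a)"
      using is_iso_full_subcat[OF L_Hom[OF aH]] L_obj WU P by simp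
    \<comment> \<open>The diagonal.\<close>
    obtain \<delta> where d: "\<delta> \<in> Hom ?A P W" "Comp ?A a \<delta> = Ident ?A P" "Comp ?A b \<delta> = Ident ?A P"
      using W Ident_Hom[OF A PO] unfolding is_pullback_def by blast
    have "FArr L (Ident ?A P) = Ident ?B ?LP" using L PO unfolding is_functor_def by blast
    then have "Comp ?A (FArr L a) (FArr L \<delta>) = Ident ?A ?LP"
      using is_functor_Comp[OF L d(1) aH] d(2) by simp
    then have Ld: "is_iso ?A (FArr L \<delta>)"
      by (rule is_iso_right_inverse[OF A L_Hom[OF aH] La L_Hom[OF d(1)]])
    have lsd: "locally_surjective P W (component \<delta>)" by (rule inv[OF d(1) Ld])
    have li: "locally_injective P ?h"
      unfolding locally_injective_def
    proof (intro ballI impI)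
      fix X p q assume X: "X \<in> Obj C" and p: "p \<in> Ev P X" and q: "q \<in> Ev P X"
        and e: "?h X p = ?h X q"
      obtain w where w: "w \<in> Ev W X" "component a X w = p" "component b X w = q" using Wex[OF X p q e] by blast
      have cv: "cov_of ?J X (lift_sieve P W (component \<delta>) X w)"
        using lsd X w(1) by (simp add: locally_surjective_def)
      show "cov_of ?J X (equalizer_sieve P X p q)"
      proof (rule cov_mono[OF cv is_sieve_equalizer[OF Pp X p q]], rule subsetI)
        fix f assume "f \<in> lift_sieve P W (component \<delta>) X w"
        then obtain r where f: "f \<in> Arr C" "Cod C f = X"
          and r: "r \<in> Ev P (Dom C f)" "Res W f w = component \<delta> (Dom C f) r"
          by (auto simp: lift_sieve_def)
        have "Res P f p = r"
          using component_nat[OF aH f w(1)] w(2) r(2) component_Comp[OF d(1) aH _ r(1)] d(2) f r(1) by simp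
        moreover have "Res P f q = r"
          using component_nat[OF bH f w(1)] w(3) r(2) component_Comp[OF d(1) bH _ r(1)] d(3) f r(1) by simp
        ultimately show "f \<in> equalizer_sieve P X p q" using f by (simp add: equalizer_sieve_def)
      qed
    qed
    have "is_iso ?A (P, ?h, ?LP)"
      using locally_bijective_sheaves[OF shP shL Hom_component[OF eP] li ls] P Hom_presheaf[OF eP]
      by (intro is_iso_psh_catI[OF Hom_component[OF eP]]) auto
    moreover have "(P, ?h, ?LP) = \<eta> P" using eP by (auto simp: Hom_psh_cat)
    ultimately show "P \<in> I" using iso[OF P] by simp
  qed
qed

end

theorem mainTheorem4:
  fixes U :: "'v set set" and C :: "('o, 'm) cat"
  assumes "set_universe U" and "category C" and "essentially_small U C"
  shows "(\<forall>J \<subseteq> sieves C. G_R U C (F_R U C J) = J \<longleftrightarrow> grothendieck_topology U C J) \<and>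
         (\<forall>I \<subseteq> presheaves U C. F_R U C (G_R U C I) = I \<longleftrightarrow> is_subtopos U C I)"
proof -
  interpret small_site C U using assms by unfold_locales
  show ?thesis
  proof (intro conjI allI impI iffI)
    fix J assume J: "J \<subseteq> sieves C"
    show "grothendieck_topology U C J" if "G_R U C (F_R U C J) = J"
      using grothendieck_topology_G_R[OF F_R_presheaves, of J] that by simp
    show "G_R U C (F_R U C J) = J" if "grothendieck_topology U C J"
      by (rule topology_fixed_point[OF J that])
  next
    fix I :: "('o, 'm, 'v) presheaf set" assume I: "I \<subseteq> presheaves U C"
    show "is_subtopos U C I" if "F_R U C (G_R U C I) = I"
      using subtopos_F_R[OF G_R_sieves grothendieck_topology_G_R[OF I]] that by simp
    show "F_R U C (G_R U C I) = I" if "is_subtopos U C I"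
      by (rule subtopos_fixed_point[OF I that])
  qed
qed

end
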